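(* (i) For each $\textsc{Q-DT-FOIL}$ formula $\phi$ there is $k\ge1$ such that $\textsc{Eval}(\phi)$ is in $\mathrm{BH}_k$. (ii) For every $k\ge1$ there is a $\textsc{Q-DT-FOIL}$ formula $\phi_k$ such that $\textsc{Eval}(\phi_k)$ is $\mathrm{BH}_k$-hard.
   Context: Partial instances of dimension $n$ are tuples in $\{0,1,\bot\}^n$; $\mathbf{e}_\bot=\{i\mid\mathbf{e}[i]=\bot\}$. A decision tree of dimension $n$ is a rooted binary tree with internal nodes labeled by features in $\{1,\dots,n\}$, edges labeled $0/1$, leaves labeled $\mathsf{true}/\mathsf{false}$, no feature repeated on a root-to-leaf path. For a node $u$ with root-to-$u$ path $u_1\cdots u_k$, $\mathbf{e}_u[j]$ is the label of the edge leaving the node $u_i$ ($i<k$) labeled $j$, and $\bot$ if no such node exists. Formulas are interpreted for $\mathcal{T}$ over domain $\{0,1,\bot\}^n$: $\mathbf{e}_1\subseteq\mathbf{e}_2$ iff $\mathbf{e}_1[i]=\mathbf{e}_2[i]$ whenever $\mathbf{e}_1[i]\neq\bot$; $\mathbf{e}\preceq\mathbf{e}'$ iff $|\mathbf{e}_\bot|\ge|\mathbf{e}'_\bot|$; $\textsc{Node}(\mathbf{e})$ iff $\mathbf{e}=\mathbf{e}_u$ for some node $u$; $\textsc{PosLeaf}(\mathbf{e})$ iff $\mathbf{e}=\mathbf{e}_u$ for some leaf $u$ labeled $\mathsf{true}$. $\textsc{DT-FOIL}$: all first-order formulas over $\{\subseteq,\preceq\}$, closed under Boolean combinations and under the guarded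 quantifications $\exists x(\textsc{Node}(x)\wedge\phi)$, $\forall x(\textsc{Node}(x)\to\phi)$, $\exists x(\textsc{PosLeaf}(x)\wedge\phi)$, $\forall x(\textsc{PosLeaf}(x)\to\phi)$. $\textsc{Q-DT-FOIL}$: (i) every $\textsc{DT-FOIL}$ formula; (ii) Boolean combinations of $\textsc{Q-DT-FOIL}$ formulas; (iii) if $\phi$ is $\textsc{DT-FOIL}$, then $\exists x_1\cdots\exists x_\ell\,\phi$ and $\forall x_1\cdots\forall x_\ell\,\phi$ (unguarded, ranging over all of $\{0,1,\bot\}^n$). $\textsc{Eval}(\phi)$ for fixed $\phi(x_1,\dots,x_k)$: given a decision tree $\mathcal{T}$ of dimension $n$ and partial instances $\mathbf{e}_1,\dots,\mathbf{e}_k$ of dimension $n$, decide whether $\mathcal{T}\models\phi(\mathbf{e}_1,\dots,\mathbf{e}_k)$. Boolean hierarchy: $\mathrm{BH}_1=\mathrm{NP}$, $\mathrm{BH}_{2i}=\{L_1\cap L_2\mid L_1\in\mathrm{BH}_{2i-1},L_2\in\mathrm{coNP}\}$, $\mathrm{BH}_{2i+1}=\{L_1\cup L_2\mid L_1\in\mathrm{BH}_{2i},L_2\in\mathrm{NP}\}$. *)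

theory Defs
  imports Main "HOL-Computational_Algebra.Polynomial"
begin

section \<open>Polynomial time\<close>

text \<open>
  Deterministic multi-tape Turing machines with two-way infinite tapes.  States, tape symbols and
  tapes are initial segments of the natural numbers.  State 0 is initial and state 1 is the
  halting state; symbol 0 is the blank and symbols 1 and 2 represent the bits 0 and 1.  The input
  is on the first tape, the output on the last one.
\<close>

datatype move = MLeft | MStay | MRight

record tm =
  n_tapes :: nat
  n_states :: nat
  n_syms :: nat
  delta :: "nat \<Rightarrow> nat list \<Rightarrow> nat \<times> (nat \<times> move) list"

definition wf_tm :: "tm \<Rightarrow> bool" where
  "wf_tm M \<longleftrightarrow> n_tapes M \<ge> 1 \<and> n_states M \<ge> 2 \<and> n_syms M \<ge> 3 \<and>
     (\<forall>q ss q' as. q < n_states M \<longrightarrow> length ss = n_tapes M \<longrightarrow> set ss \<subseteq> {..<n_syms M} \<longrightarrow>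
        delta M q ss = (q', as) \<longrightarrow>
        q' < n_states M \<and> length as = n_tapes M \<and> fst ` set as \<subseteq> {..<n_syms M})"

text \<open>A tape is its content together with the position of the head.\<close>

type_synonym tape = "(int \<Rightarrow> nat) \<times> int"
type_synonym config = "nat \<times> tape list"

fun shift :: "move \<Rightarrow> int" where
  "shift MLeft = - 1"
| "shift MStay = 0"
| "shift MRight = 1"

fun act :: "nat \<times> move \<Rightarrow> tape \<Rightarrow> tape" where
  "act (s, d) (c, h) = (c(h := s), h + shift d)"

fun step :: "tm \<Rightarrow> config \<Rightarrow> config" where
  "step M (q, ts) =
     (if q = 1 then (q, ts)
      else let (q', as) = delta M q (map (\<lambda>(c, h). c h) ts) in (q', map2 act as ts))"

definition content :: "bool list \<Rightarrow> int \<Rightarrow> nat" where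
  "content x i =
     (if 0 \<le> i \<and> i < int (length x) then (if x ! nat i then 2 else 1) else 0)"

definition init_config :: "tm \<Rightarrow> bool list \<Rightarrow> config" where
  "init_config M x = (0, (content x, 0) # replicate (n_tapes M - 1) (content [], 0))"

definition computes_within :: "tm \<Rightarrow> bool list \<Rightarrow> bool list \<Rightarrow> nat \<Rightarrow> bool" where
  "computes_within M x y T \<longleftrightarrow>
     (\<exists>t\<le>T. \<exists>ts. (step M ^^ t) (init_config M x) = (1, ts) \<and> fst (last ts) = content y)"

definition polytime :: "(bool list \<Rightarrow> bool list) \<Rightarrow> bool" where
  "polytime f \<longleftrightarrow>
     (\<exists>M. wf_tm M \<and> (\<exists>p :: nat poly. \<forall>x. computes_within M x (f x) (poly p (length x))))"

section \<open>Complexity classes\<close>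

type_synonym lang = "bool list set"

definition PTIME :: "lang set" where
  "PTIME = {A. polytime (\<lambda>x. [x \<in> A])}"

text \<open>
  Injective pairing of binary strings: each bit of the first string is doubled, and 01 serves as
  the separator.
\<close>

definition pair_str :: "bool list \<Rightarrow> bool list \<Rightarrow> bool list" where
  "pair_str x u = concat (map (\<lambda>b. [b, b]) x) @ [False, True] @ u"

definition NP :: "lang set" where
  "NP = {A. \<exists>V\<in>PTIME. \<exists>p :: nat poly.
              \<forall>x. x \<in> A \<longleftrightarrow> (\<exists>u. length u \<le> poly p (length x) \<and> pair_str x u \<in> V)}"

definition coNP :: "lang set" where
  "coNP = {A. - A \<in> NP}"

text \<open>The hierarchy starts at level 1; the value at 0 is a dummy.\<close>

fun BH :: "nat \<Rightarrow> lang set" where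
  "BH 0 = {}"
| "BH (Suc 0) = NP"
| "BH (Suc (Suc k)) =
     (if even k then {A \<inter> B | A B. A \<in> BH (Suc k) \<and> B \<in> coNP}
      else {A \<union> B | A B. A \<in> BH (Suc k) \<and> B \<in> NP})"

definition poly_reducible :: "lang \<Rightarrow> lang \<Rightarrow> bool" (infix "\<le>\<^sub>p" 50) where
  "A \<le>\<^sub>p B \<longleftrightarrow> (\<exists>f. polytime f \<and> (\<forall>x. x \<in> A \<longleftrightarrow> f x \<in> B))"

definition hard_for :: "lang set \<Rightarrow> lang \<Rightarrow> bool" where
  "hard_for C B \<longleftrightarrow> (\<forall>A\<in>C. A \<le>\<^sub>p B)"

section \<open>Partial instances and decision trees\<close>

text \<open>
  A partial instance of dimension \<open>n\<close> is a list of length \<open>n\<close>, with \<open>None\<close> for the undefined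
  value.  Features are numbered from 0 to \<open>n - 1\<close>.
\<close>

type_synonym pinst = "bool option list"

definition undef_feats :: "pinst \<Rightarrow> nat set" where
  "undef_feats e = {i. i < length e \<and> e ! i = None}"

definition subsumed :: "pinst \<Rightarrow> pinst \<Rightarrow> bool" where
  "subsumed e e' \<longleftrightarrow> (\<forall>i<length e. e ! i \<noteq> None \<longrightarrow> e ! i = e' ! i)"

definition less_defined :: "pinst \<Rightarrow> pinst \<Rightarrow> bool" where
  "less_defined e e' \<longleftrightarrow> card (undef_feats e) \<ge> card (undef_feats e')"

text \<open>In \<open>Branch i t0 t1\<close> the edge to \<open>t0\<close> is labeled 0 and the edge to \<open>t1\<close> is labeled 1.\<close>

datatype dtree = Leaf bool | Branch nat dtree dtree

text \<open>
  \<open>path_to t ps u\<close>: there is a node with subtree \<open>u\<close> that is reached from the root of \<open>t\<close> along a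
  path whose successive node and edge labels are \<open>ps\<close>.  The path determines the node.
\<close>

inductive path_to :: "dtree \<Rightarrow> (nat \<times> bool) list \<Rightarrow> dtree \<Rightarrow> bool" where
  "path_to t [] t"
| "path_to t0 ps u \<Longrightarrow> path_to (Branch i t0 t1) ((i, False) # ps) u"
| "path_to t1 ps u \<Longrightarrow> path_to (Branch i t0 t1) ((i, True) # ps) u"

definition decision_tree :: "nat \<Rightarrow> dtree \<Rightarrow> bool" where
  "decision_tree n t \<longleftrightarrow>
     (\<forall>ps b. path_to t ps (Leaf b) \<longrightarrow> distinct (map fst ps) \<and> fst ` set ps \<subseteq> {..<n})"

definition path_inst :: "nat \<Rightarrow> (nat \<times> bool) list \<Rightarrow> pinst" where
  "path_inst n ps = map (map_of ps) [0..<n]"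

definition is_node :: "nat \<Rightarrow> dtree \<Rightarrow> pinst \<Rightarrow> bool" where
  "is_node n t e \<longleftrightarrow> (\<exists>ps u. path_to t ps u \<and> e = path_inst n ps)"

definition is_pos_leaf :: "nat \<Rightarrow> dtree \<Rightarrow> pinst \<Rightarrow> bool" where
  "is_pos_leaf n t e \<longleftrightarrow> (\<exists>ps. path_to t ps (Leaf True) \<and> e = path_inst n ps)"

section \<open>The logics\<close>

datatype fm =
    Sub nat nat
  | Prec nat nat
  | Equal nat nat
  | Node nat
  | PosLeaf nat
  | Neg fm
  | Conj fm fm
  | Disj fm fm
  | Impl fm fm
  | Exists nat fm
  | Forall nat fm

primrec sat :: "nat \<Rightarrow> dtree \<Rightarrow> (nat \<Rightarrow> pinst) \<Rightarrow> fm \<Rightarrow> bool" where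
  "sat n t \<sigma> (Sub x y) \<longleftrightarrow> subsumed (\<sigma> x) (\<sigma> y)"
| "sat n t \<sigma> (Prec x y) \<longleftrightarrow> less_defined (\<sigma> x) (\<sigma> y)"
| "sat n t \<sigma> (Equal x y) \<longleftrightarrow> \<sigma> x = \<sigma> y"
| "sat n t \<sigma> (Node x) \<longleftrightarrow> is_node n t (\<sigma> x)"
| "sat n t \<sigma> (PosLeaf x) \<longleftrightarrow> is_pos_leaf n t (\<sigma> x)"
| "sat n t \<sigma> (Neg \<phi>) \<longleftrightarrow> \<not> sat n t \<sigma> \<phi>"
| "sat n t \<sigma> (Conj \<phi> \<psi>) \<longleftrightarrow> sat n t \<sigma> \<phi> \<and> sat n t \<sigma> \<psi>"
| "sat n t \<sigma> (Disj \<phi> \<psi>) \<longleftrightarrow> sat n t \<sigma> \<phi> \<or> sat n t \<sigma> \<psi>"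
| "sat n t \<sigma> (Impl \<phi> \<psi>) \<longleftrightarrow> (sat n t \<sigma> \<phi> \<longrightarrow> sat n t \<sigma> \<psi>)"
| "sat n t \<sigma> (Exists x \<phi>) \<longleftrightarrow> (\<exists>e. length e = n \<and> sat n t (\<sigma>(x := e)) \<phi>)"
| "sat n t \<sigma> (Forall x \<phi>) \<longleftrightarrow> (\<forall>e. length e = n \<longrightarrow> sat n t (\<sigma>(x := e)) \<phi>)"

primrec fv :: "fm \<Rightarrow> nat set" where
  "fv (Sub x y) = {x, y}"
| "fv (Prec x y) = {x, y}"
| "fv (Equal x y) = {x, y}"
| "fv (Node x) = {x}"
| "fv (PosLeaf x) = {x}"
| "fv (Neg \<phi>) = fv \<phi>"
| "fv (Conj \<phi> \<psi>) = fv \<phi> \<union> fv \<psi>"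
| "fv (Disj \<phi> \<psi>) = fv \<phi> \<union> fv \<psi>"
| "fv (Impl \<phi> \<psi>) = fv \<phi> \<union> fv \<psi>"
| "fv (Exists x \<phi>) = fv \<phi> - {x}"
| "fv (Forall x \<phi>) = fv \<phi> - {x}"

text \<open>First-order formulas over the two order relations only, with unrestricted quantification.\<close>

primrec order_fm :: "fm \<Rightarrow> bool" where
  "order_fm (Sub x y) \<longleftrightarrow> True"
| "order_fm (Prec x y) \<longleftrightarrow> True"
| "order_fm (Equal x y) \<longleftrightarrow> True"
| "order_fm (Node x) \<longleftrightarrow> False"
| "order_fm (PosLeaf x) \<longleftrightarrow> False"
| "order_fm (Neg \<phi>) \<longleftrightarrow> order_fm \<phi>"
| "order_fm (Conj \<phi> \<psi>) \<longleftrightarrow> order_fm \<phi> \<and> order_fm \<psi>"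
| "order_fm (Disj \<phi> \<psi>) \<longleftrightarrow> order_fm \<phi> \<and> order_fm \<psi>"
| "order_fm (Impl \<phi> \<psi>) \<longleftrightarrow> order_fm \<phi> \<and> order_fm \<psi>"
| "order_fm (Exists x \<phi>) \<longleftrightarrow> order_fm \<phi>"
| "order_fm (Forall x \<phi>) \<longleftrightarrow> order_fm \<phi>"

inductive dt_foil :: "fm \<Rightarrow> bool" where
  "order_fm \<phi> \<Longrightarrow> dt_foil \<phi>"
| "dt_foil \<phi> \<Longrightarrow> dt_foil (Neg \<phi>)"
| "dt_foil \<phi> \<Longrightarrow> dt_foil \<psi> \<Longrightarrow> dt_foil (Conj \<phi> \<psi>)"
| "dt_foil \<phi> \<Longrightarrow> dt_foil \<psi> \<Longrightarrow> dt_foil (Disj \<phi> \<psi>)"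
| "dt_foil \<phi> \<Longrightarrow> dt_foil \<psi> \<Longrightarrow> dt_foil (Impl \<phi> \<psi>)"
| "dt_foil \<phi> \<Longrightarrow> dt_foil (Exists x (Conj (Node x) \<phi>))"
| "dt_foil \<phi> \<Longrightarrow> dt_foil (Forall x (Impl (Node x) \<phi>))"
| "dt_foil \<phi> \<Longrightarrow> dt_foil (Exists x (Conj (PosLeaf x) \<phi>))"
| "dt_foil \<phi> \<Longrightarrow> dt_foil (Forall x (Impl (PosLeaf x) \<phi>))"

inductive q_dt_foil :: "fm \<Rightarrow> bool" where
  "dt_foil \<phi> \<Longrightarrow> q_dt_foil \<phi>"
| "q_dt_foil \<phi> \<Longrightarrow> q_dt_foil (Neg \<phi>)"
| "q_dt_foil \<phi> \<Longrightarrow> q_dt_foil \<psi> \<Longrightarrow> q_dt_foil (Conj \<phi> \<psi>)"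
| "q_dt_foil \<phi> \<Longrightarrow> q_dt_foil \<psi> \<Longrightarrow> q_dt_foil (Disj \<phi> \<psi>)"
| "q_dt_foil \<phi> \<Longrightarrow> q_dt_foil \<psi> \<Longrightarrow> q_dt_foil (Impl \<phi> \<psi>)"
| "dt_foil \<phi> \<Longrightarrow> q_dt_foil (foldr Exists xs \<phi>)"
| "dt_foil \<phi> \<Longrightarrow> q_dt_foil (foldr Forall xs \<phi>)"

section \<open>The evaluation problem\<close>

text \<open>
  Binary encoding of inputs.  The dimension and the features are written in unary; as a partial
  instance of dimension \<open>n\<close> is an \<open>n\<close>-tuple, the dimension counts towards the input size in full.
\<close>

definition enc_nat :: "nat \<Rightarrow> bool list" where
  "enc_nat i = replicate i True @ [False]"

fun enc_tree :: "dtree \<Rightarrow> bool list" where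
  "enc_tree (Leaf b) = [False, b]"
| "enc_tree (Branch i t0 t1) = True # enc_nat i @ enc_tree t0 @ enc_tree t1"

fun enc_val :: "bool option \<Rightarrow> bool list" where
  "enc_val None = [False]"
| "enc_val (Some b) = [True, b]"

definition enc_inst :: "pinst \<Rightarrow> bool list" where
  "enc_inst e = concat (map enc_val e)"

definition enc_input :: "nat \<Rightarrow> dtree \<Rightarrow> pinst list \<Rightarrow> bool list" where
  "enc_input n t es = enc_nat n @ enc_tree t @ concat (map enc_inst es)"

lemma enc_nat_append_inj: "enc_nat i @ x = enc_nat j @ y \<longleftrightarrow> i = j \<and> x = y"
  unfolding enc_nat_def
proof (induction i arbitrary: j)
  case 0
  show ?case by (cases j) auto
next
  case (Suc i)
  then show ?case by (cases j) auto
qed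

lemma enc_tree_append_inj: "enc_tree t @ x = enc_tree t' @ y \<longleftrightarrow> t = t' \<and> x = y"
proof (induction t arbitrary: t' x y)
  case (Leaf b)
  show ?case by (cases t') auto
next
  case (Branch i t0 t1)
  then show ?case by (cases t') (auto simp: enc_nat_append_inj)
qed

lemma enc_inst_append_inj:
  "length e = length e' \<Longrightarrow> enc_inst e @ x = enc_inst e' @ y \<longleftrightarrow> e = e' \<and> x = y"
proof (induction e e' rule: list_induct2)
  case Nil
  show ?case by (simp add: enc_inst_def)
next
  case (Cons a e b e')
  then show ?case by (cases a; cases b) (auto simp: enc_inst_def)
qed

lemma enc_input_inj:
  assumes "enc_input n t es = enc_input n' t' es'" "length es = length es'"
    "\<forall>e\<in>set es. length e = n" "\<forall>e\<in>set es'. length e = n'"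
  shows "n = n' \<and> t = t' \<and> es = es'"
proof -
  have eq: "n = n'" "t = t'" "concat (map enc_inst es) = concat (map enc_inst es')"
    using assms(1) by (auto simp: enc_input_def enc_nat_append_inj enc_tree_append_inj)
  have "es = es'"
    using assms(2) eq(3) assms(3,4)
    by (induction es es' rule: list_induct2) (auto simp: eq(1) enc_inst_append_inj)
  with eq show ?thesis by simp
qed

text \<open>The given partial instances are assigned to the free variables in increasing order.\<close>

definition free_vars :: "fm \<Rightarrow> nat list" where
  "free_vars \<phi> = sorted_list_of_set (fv \<phi>)"

definition assign :: "nat list \<Rightarrow> pinst list \<Rightarrow> nat \<Rightarrow> pinst" where
  "assign xs es x = the (map_of (zip xs es) x)"

definition Eval :: "fm \<Rightarrow> lang" where
  "Eval \<phi> = {enc_input n t es | n t es.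
      decision_tree n t \<and> length es = length (free_vars \<phi>) \<and> (\<forall>e\<in>set es. length e = n) \<and>
      sat n t (assign (free_vars \<phi>) es) \<phi>}"

end

theory Submission imports Defs "HOL-Library.Nat_Bijection" begin

text \<open>
  Membership: up to a permutation of the features, an instance is determined by how often each
  value occurs among the features with equal values in the other instances.  Hence an unrestricted
  quantifier in front of an order formula ranges over polynomially many candidates, a guarded one
  ranges over the nodes of the tree, and DT-FOIL formulas are decided in polynomial time.  An
  unguarded existential prefix is an NP certificate.  A Boolean combination of NP languages is a
  symmetric difference of NP languages, and the parity of the number of languages that contain
  \<open>x\<close> is read off the decreasing chain of the NP languages "at least \<open>j\<close> of them contain \<open>x\<close>".

  Hardness: the computation of a verifier is expressed by clauses over facts about cells relative
  to the heads.  A clause becomes a path to a positive leaf that carries the violating assignment,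
  so that a satisfying assignment is an instance which is incompatible with every positive leaf.
  This takes one existential quantifier, and several sets of clauses share one tree in which a
  parameter activates one of them.

  Polynomial-time functions are obtained by closure under pairing, case distinction and bounded
  iteration on binary trees, which are implemented on a stack machine with tapes as stacks.
\<close>

section \<open>A stack language compiled to Turing machines\<close>

text \<open>A formula is fixed, so with \<open>w\<close> other variables in scope the features fall
  into at most \<open>3 ^ w\<close> classes, a constant; this keeps the candidates polynomially
  many. The tree predicates break the symmetry between features, which is why quantifiers around
  them are guarded in DT-FOIL.

  In the reduction all clauses share one tree without repeated features on a path, so each hangs at
  its own address of selector features. An assignment could then escape a clause by merely
  contradicting its address. Two parameters that are 0 and 1 on all selectors prevent this:
  compatibility with both leaves the selectors undefined, so an incompatibility can only arise at a
  variable of the clause.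

  Cells are numbered from the head, so that no head position has to be encoded. The price is that
  the known part of a tape loses one cell per step on either side; the tableau is wide enough for
  the output to stay in the known part.

  Symmetric differences are used because complement only flips a parity, which leaves monotone
  thresholds as the sole work on certificates.\<close>

text \<open>Register 5 is an output queue, all other registers are stacks.\<close>

datatype cmd =
    Push nat nat
  | Pop nat
  | Out nat
  | Seq cmd cmd (infixr ";;" 60)
  | If nat "nat \<Rightarrow> bool" cmd cmd
  | While nat "nat \<Rightarrow> bool" cmd

definition top :: "nat list \<Rightarrow> nat" where
  "top xs = (case xs of [] \<Rightarrow> 0 | s # _ \<Rightarrow> s)"

lemma top_simps [simp]: "top [] = 0" "top (s # xs) = s"
  by (simp_all add: top_def)

inductive exec :: "cmd \<Rightarrow> (nat \<Rightarrow> nat list) \<Rightarrow> (nat \<Rightarrow> nat list) \<Rightarrow> nat \<Rightarrow> bool" where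
  Push: "exec (Push k s) \<sigma> (\<sigma>(k := s # \<sigma> k)) 2"
| Pop: "exec (Pop k) \<sigma> (\<sigma>(k := tl (\<sigma> k))) 1"
| Out: "exec (Out s) \<sigma> (\<sigma>(5 := \<sigma> 5 @ [s])) 1"
| Seq: "exec c \<sigma> \<sigma>1 t1 \<Longrightarrow> exec d \<sigma>1 \<sigma>' t2 \<Longrightarrow> exec (c ;; d) \<sigma> \<sigma>' (t1 + t2)"
| IfT: "P (top (\<sigma> k)) \<Longrightarrow> exec c \<sigma> \<sigma>' t \<Longrightarrow> exec (If k P c d) \<sigma> \<sigma>' (Suc t)"
| IfF: "\<not> P (top (\<sigma> k)) \<Longrightarrow> exec d \<sigma> \<sigma>' t \<Longrightarrow> exec (If k P c d) \<sigma> \<sigma>' (Suc t)"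
| WhileF: "\<not> P (top (\<sigma> k)) \<Longrightarrow> exec (While k P c) \<sigma> \<sigma> 1"
| WhileT: "P (top (\<sigma> k)) \<Longrightarrow> exec c \<sigma> \<sigma>1 t1 \<Longrightarrow> exec (While k P c) \<sigma>1 \<sigma>' t2 \<Longrightarrow>
    exec (While k P c) \<sigma> \<sigma>' (Suc (t1 + t2))"

primrec wf_cmd :: "cmd \<Rightarrow> bool" where
  "wf_cmd (Push k s) \<longleftrightarrow> k < 5 \<and> s < 3"
| "wf_cmd (Pop k) \<longleftrightarrow> k < 5"
| "wf_cmd (Out s) \<longleftrightarrow> s < 3"
| "wf_cmd (c ;; d) \<longleftrightarrow> wf_cmd c \<and> wf_cmd d"
| "wf_cmd (If k P c d) \<longleftrightarrow> k < 5 \<and> wf_cmd c \<and> wf_cmd d"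
| "wf_cmd (While k P c) \<longleftrightarrow> k < 5 \<and> wf_cmd c"

text \<open>The fragment of \<open>c\<close> has the states \<open>0, \<dots>, nst c - 1\<close>, entry 0 and exit \<open>nst c\<close>.\<close>

primrec nst :: "cmd \<Rightarrow> nat" where
  "nst (Push k s) = 2"
| "nst (Pop k) = 1"
| "nst (Out s) = 1"
| "nst (c ;; d) = nst c + nst d"
| "nst (If k P c d) = Suc (nst c + nst d)"
| "nst (While k P c) = Suc (nst c)"

lemma nst_pos [simp]: "0 < nst c"
  by (induction c) auto

definition idle :: "nat list \<Rightarrow> (nat \<times> move) list" where
  "idle = map (\<lambda>s. (s, MStay))"

text \<open>A machine writes before it moves, so a push on a stack that grows to the left takes two
  steps; the first rewrites the scanned symbol while stepping left. A subprogram announces its end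
  by the state \<open>nst c\<close>, which the surrounding construct redirects: to the next command,
  past the other branch, or back to the loop test.\<close>

primrec frag :: "cmd \<Rightarrow> nat \<Rightarrow> nat list \<Rightarrow> nat \<times> (nat \<times> move) list" where
  "frag (Push k s) q ss =
     (if q = 0 then (1, (idle ss)[k := (ss ! k, MLeft)]) else (2, (idle ss)[k := (s, MStay)]))"
| "frag (Pop k) q ss = (1, (idle ss)[k := (0, MRight)])"
| "frag (Out s) q ss = (1, (idle ss)[5 := (s, MRight)])"
| "frag (c ;; d) q ss =
     (if q < nst c then frag c q ss else apfst ((+) (nst c)) (frag d (q - nst c) ss))"
| "frag (If k P c d) q ss =
     (if q = 0 then (if P (ss ! k) then 1 else Suc (nst c), idle ss)
      else if q \<le> nst c
      then apfst (\<lambda>q'. if q' < nst c then Suc q' else Suc (nst c + nst d)) (frag c (q - 1) ss)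
      else apfst ((+) (Suc (nst c))) (frag d (q - Suc (nst c)) ss))"
| "frag (While k P c) q ss =
     (if q = 0 then (if P (ss ! k) then 1 else Suc (nst c), idle ss)
      else apfst (\<lambda>q'. if q' < nst c then Suc q' else 0) (frag c (q - 1) ss))"

lemma length_idle [simp]: "length (idle ss) = length ss"
  by (simp add: idle_def)

lemma frag_bounds:
  assumes "wf_cmd c" "q < nst c" "set ss \<subseteq> {..<3}" "length ss = 6" "frag c q ss = (q', as)"
  shows "q' \<le> nst c \<and> length as = 6 \<and> fst ` set as \<subseteq> {..<3}"
  using assms
proof (induction c arbitrary: q q' as)
  case (Push k s)
  then have "ss ! k \<in> set ss" by (intro nth_mem) auto
  with \<open>set ss \<subseteq> {..<3}\<close> have "ss ! k < 3" by blast
  with Push show ?case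
    by (auto simp: idle_def split: if_splits dest!: set_update_subset_insert[THEN subsetD])
next
  case (Pop k)
  then show ?case
    by (auto simp: idle_def dest!: set_update_subset_insert[THEN subsetD])
next
  case (Out s)
  then show ?case
    by (auto simp: idle_def dest!: set_update_subset_insert[THEN subsetD])
next
  case (Seq c d)
  show ?case
  proof (cases "q < nst c")
    case True
    then show ?thesis using Seq.IH(1)[of q q' as] Seq.prems by auto
  next
    case False
    obtain q1 as1 where "frag d (q - nst c) ss = (q1, as1)" by fastforce
    then show ?thesis using Seq.IH(2)[of "q - nst c" q1 as1] Seq.prems False by auto
  qed
next
  case (If k P c d)
  obtain q1 as1 where 1: "frag c (q - 1) ss = (q1, as1)" by fastforce
  obtain q2 as2 where 2: "frag d (q - Suc (nst c)) ss = (q2, as2)" by fastforce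
  have "q \<noteq> 0 \<Longrightarrow> q \<le> nst c \<Longrightarrow> q - 1 < nst c" by linarith
  moreover have "\<not> q \<le> nst c \<Longrightarrow> q - Suc (nst c) < nst d" using If.prems(2) by auto
  ultimately show ?case
    using If.IH(1)[OF _ _ _ _ 1] If.IH(2)[OF _ _ _ _ 2] If.prems 1 2
    by (auto simp: idle_def split: if_splits)
next
  case (While k P c)
  obtain q1 as1 where 1: "frag c (q - 1) ss = (q1, as1)" by fastforce
  then show ?case using While.IH[OF _ _ _ _ 1] While.prems
    by (auto simp: idle_def split: if_splits)
qed

section \<open>Correctness of the compiled fragments on tapes\<close>

definition heads :: "tape list \<Rightarrow> nat list" where
  "heads = map (\<lambda>(c, h). c h)"

definition frag_step :: "(nat \<Rightarrow> nat list \<Rightarrow> nat \<times> (nat \<times> move) list) \<Rightarrow> config \<Rightarrow> config" where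
  "frag_step d cf = (case d (fst cf) (heads (snd cf)) of (q', as) \<Rightarrow> (q', map2 act as (snd cf)))"

inductive reach :: "(nat \<Rightarrow> nat list \<Rightarrow> nat \<times> (nat \<times> move) list) \<Rightarrow> nat \<Rightarrow> nat \<Rightarrow>
    config \<Rightarrow> config \<Rightarrow> bool" for d n where
  reach_0: "reach d n 0 cf cf"
| reach_Suc: "fst cf < n \<Longrightarrow> reach d n t (frag_step d cf) cf' \<Longrightarrow> reach d n (Suc t) cf cf'"

lemma reach_trans: "reach d n t cf cf1 \<Longrightarrow> reach d n t' cf1 cf2 \<Longrightarrow> reach d n (t + t') cf cf2"
  by (induction rule: reach.induct) (auto intro: reach.intros)

lemma reach_step: "reach d n t (frag_step d (q, ts)) cf' \<Longrightarrow> q < n \<Longrightarrow> reach d n (Suc t) (q, ts) cf'"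
  by (rule reach_Suc) auto

text \<open>Runs counted by \<open>reach\<close> leave only states below \<open>n\<close>, so the
  renaming has to commute with transitions there and may send the exit anywhere. One lemma thus
  covers shifting a fragment as well as diverting its exit to a loop head or past another
  branch.\<close>

lemma reach_embed:
  assumes "reach d n t cf cf'"
    and "\<And>q ss. q < n \<Longrightarrow> \<rho> q < n'" "\<And>q ss. q < n \<Longrightarrow> d' (\<rho> q) ss = apfst \<rho> (d q ss)"
  shows "reach d' n' t (apfst \<rho> cf) (apfst \<rho> cf')"
  using assms(1)
proof (induction rule: reach.induct)
  case (reach_0 cf)
  show ?case by (rule reach.reach_0)
next
  case (reach_Suc cf t cf')
  have "frag_step d' (apfst \<rho> cf) = apfst \<rho> (frag_step d cf)"
    using assms(3)[OF reach_Suc(1)] by (cases cf) (simp add: frag_step_def split: prod.splits)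
  then show ?case
    using reach_Suc assms(2) by (cases cf) (auto intro!: reach.reach_Suc)
qed

definition lay :: "nat list \<Rightarrow> int \<Rightarrow> nat" where
  "lay x i = (if 0 \<le> i \<and> i < int (length x) then x ! nat i else 0)"

definition rep_stack :: "nat list \<Rightarrow> tape \<Rightarrow> bool" where
  "rep_stack x tp \<longleftrightarrow> (\<forall>i. fst tp (snd tp + i) = lay x i)"

text \<open>Stacks are read relative to the head and may drift along the tape, but
  \<open>computes_within\<close> expects the output to start at cell 0. Hence register 5 is laid out
  from the origin, with its head just behind the last symbol.\<close>

definition rep :: "(nat \<Rightarrow> nat list) \<Rightarrow> tape list \<Rightarrow> bool" where
  "rep \<sigma> ts \<longleftrightarrow> length ts = 6 \<and> (\<forall>k<5. rep_stack (\<sigma> k) (ts ! k)) \<and>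
     ts ! 5 = (lay (\<sigma> 5), int (length (\<sigma> 5)))"

lemma lay_0: "lay x 0 = top x"
  by (cases x) (auto simp: lay_def)

lemma rep_stack_head: "rep_stack x (c, h) \<Longrightarrow> c h = top x"
  by (metis add.right_neutral fst_conv lay_0 rep_stack_def snd_conv)

lemma rep_stack_pop: "rep_stack x tp \<Longrightarrow> rep_stack (tl x) (act (0, MRight) tp)"
proof -
  obtain c h where tp: "tp = (c, h)" by fastforce
  assume "rep_stack x tp"
  then have c: "c (h + i) = lay x i" for i by (simp add: tp rep_stack_def)
  have "c (h + 1 + i) = lay x (1 + i)" for i using c[of "1 + i"] by (simp add: add.assoc)
  then have "(c(h := 0)) (h + 1 + i) = lay (tl x) i" for i
    by (cases x) (auto simp: lay_def nth_tl nat_add_distrib nth_Cons split: nat.splits)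
  then show ?thesis by (simp add: tp rep_stack_def)
qed

lemma rep_stack_push:
  assumes "rep_stack x tp"
  shows "rep_stack (s # x) (act (s, MStay) (act (fst tp (snd tp), MLeft) tp))"
proof -
  obtain c h where tp: "tp = (c, h)" by fastforce
  have c: "c (h + i) = lay x i" for i using assms by (simp add: tp rep_stack_def)
  have "(c(h - 1 := s)) (h - 1 + i) = lay (s # x) i" for i
    using c[of "i - 1"] by (auto simp: lay_def nth_Cons nat_diff_distrib' algebra_simps split: nat.splits)
  then show ?thesis by (simp add: tp rep_stack_def)
qed

lemma lay_append: "(lay x)(int (length x) := s) = lay (x @ [s])"
  by (auto simp: lay_def fun_eq_iff nth_append)

lemma act_idle: "map2 act (idle (heads ts)) ts = ts"
  by (induction ts) (auto simp: idle_def heads_def)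

lemma act_update:
  "map2 act ((idle (heads ts))[k := a]) ts = ts[k := act a (ts ! k)]"
proof (cases "k < length ts")
  case True
  then show ?thesis
    by (intro nth_equalityI) (auto simp: idle_def heads_def nth_list_update split: prod.splits)
next
  case False
  then have "(idle (heads ts))[k := a] = idle (heads ts)" by (simp add: heads_def list_update_beyond)
  with False show ?thesis by (simp add: act_idle list_update_beyond)
qed

lemma rep_heads:
  assumes "rep \<sigma> ts" "k < 5"
  shows "heads ts ! k = top (\<sigma> k)"
proof -
  obtain c h where "ts ! k = (c, h)" by fastforce
  then show ?thesis using assms rep_stack_head[of "\<sigma> k" c h] by (auto simp: rep_def heads_def)
qed

lemma rep_update:
  assumes "rep \<sigma> ts" "k < 5" "rep_stack x tp"
  shows "rep (\<sigma>(k := x)) (ts[k := tp])"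
  using assms by (auto simp: rep_def nth_list_update)

text \<open>The costs in \<open>exec\<close> are exact numbers of machine steps, so the induction
  involves no inequalities.\<close>

lemma exec_reach:
  "exec c \<sigma> \<sigma>' t \<Longrightarrow> wf_cmd c \<Longrightarrow> rep \<sigma> ts \<Longrightarrow>
    \<exists>ts'. reach (frag c) (nst c) t (0, ts) (nst c, ts') \<and> rep \<sigma>' ts'"
proof (induction arbitrary: ts rule: exec.induct)
  case (Push k s \<sigma>)
  let ?ts1 = "ts[k := act (heads ts ! k, MLeft) (ts ! k)]"
  let ?ts2 = "?ts1[k := act (s, MStay) (?ts1 ! k)]"
  have k: "k < length ts" using Push by (auto simp: rep_def)
  have "frag_step (frag (Push k s)) (0, ts) = (1, ?ts1)" "frag_step (frag (Push k s)) (1, ?ts1) = (2, ?ts2)"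
    by (simp_all add: frag_step_def act_update)
  then have "reach (frag (Push k s)) 2 (Suc (Suc 0)) (0, ts) (2, ?ts2)"
    by (metis reach_step reach_0 one_less_numeral_iff semiring_norm(76) zero_less_numeral)
  moreover have "rep (\<sigma>(k := s # \<sigma> k)) ?ts2"
    using rep_update[OF Push(2), of k] rep_stack_push[of "\<sigma> k" "ts ! k" s] Push k
    by (auto simp: rep_def heads_def split_beta)
  ultimately show ?case unfolding nst.simps numeral_2_eq_2 by blast
next
  case (Pop k \<sigma>)
  let ?ts1 = "ts[k := act (0, MRight) (ts ! k)]"
  have "frag_step (frag (Pop k)) (0, ts) = (1, ?ts1)"
    by (simp add: frag_step_def act_update)
  then have "reach (frag (Pop k)) 1 (Suc 0) (0, ts) (1, ?ts1)"
    by (metis reach_step reach_0 zero_less_one)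
  moreover have "rep (\<sigma>(k := tl (\<sigma> k))) ?ts1"
    using Pop by (auto intro!: rep_update rep_stack_pop simp: rep_def)
  ultimately show ?case unfolding nst.simps One_nat_def by blast
next
  case (Out s \<sigma>)
  let ?ts1 = "ts[5 := act (s, MRight) (ts ! 5)]"
  have "frag_step (frag (Out s)) (0, ts) = (1, ?ts1)"
    by (simp add: frag_step_def act_update)
  then have "reach (frag (Out s)) 1 (Suc 0) (0, ts) (1, ?ts1)"
    by (metis reach_step reach_0 zero_less_one)
  moreover have "rep (\<sigma>(5 := \<sigma> 5 @ [s])) ?ts1"
    using Out by (auto simp: rep_def lay_append)
  ultimately show ?case unfolding nst.simps One_nat_def by blast
next
  case (Seq c \<sigma> \<sigma>1 t1 d \<sigma>' t2)
  then obtain ts1 where 1: "reach (frag c) (nst c) t1 (0, ts) (nst c, ts1)" "rep \<sigma>1 ts1" by auto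
  with Seq obtain ts2 where 2: "reach (frag d) (nst d) t2 (0, ts1) (nst d, ts2)" "rep \<sigma>' ts2" by fastforce
  have "reach (frag (c ;; d)) (nst (c ;; d)) t1 (0, ts) (nst c, ts1)"
    using reach_embed[OF 1(1), of "\<lambda>q. q" "nst (c ;; d)" "frag (c ;; d)"]
    by (simp add: apfst_def map_prod_def split_beta)
  moreover have "reach (frag (c ;; d)) (nst (c ;; d)) t2 (nst c, ts1) (nst c + nst d, ts2)"
    using reach_embed[OF 2(1), of "(+) (nst c)" "nst (c ;; d)" "frag (c ;; d)"] by simp
  ultimately show ?case using 2(2) reach_trans unfolding nst.simps by blast
next
  case (IfT P \<sigma> k c \<sigma>' t d)
  let ?c = "If k P c d"
  obtain ts1 where 1: "reach (frag c) (nst c) t (0, ts) (nst c, ts1)" "rep \<sigma>' ts1" using IfT by auto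
  have "frag_step (frag ?c) (0, ts) = (1, ts)"
    using IfT by (simp add: frag_step_def act_idle rep_heads)
  moreover have "reach (frag ?c) (nst ?c) t (1, ts) (nst ?c, ts1)"
    using reach_embed[OF 1(1), of "\<lambda>q. if q < nst c then Suc q else Suc (nst c + nst d)" "nst ?c" "frag ?c"]
    by simp
  ultimately show ?case using 1(2) reach_step[of "frag ?c" "nst ?c" t 0 ts]
    by (auto simp del: frag.simps)
next
  case (IfF P \<sigma> k d \<sigma>' t c)
  let ?c = "If k P c d"
  obtain ts1 where 1: "reach (frag d) (nst d) t (0, ts) (nst d, ts1)" "rep \<sigma>' ts1" using IfF by auto
  have "frag_step (frag ?c) (0, ts) = (Suc (nst c), ts)"
    using IfF by (simp add: frag_step_def act_idle rep_heads)
  moreover have "reach (frag ?c) (nst ?c) t (Suc (nst c), ts) (nst ?c, ts1)"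
    using reach_embed[OF 1(1), of "(+) (Suc (nst c))" "nst ?c" "frag ?c"] by simp
  ultimately show ?case using 1(2) reach_step[of "frag ?c" "nst ?c" t 0 ts]
    by (auto simp del: frag.simps)
next
  case (WhileF P \<sigma> k c)
  let ?c = "While k P c"
  have "frag_step (frag ?c) (0, ts) = (nst ?c, ts)"
    using WhileF by (simp add: frag_step_def act_idle rep_heads)
  then have "reach (frag ?c) (nst ?c) (Suc 0) (0, ts) (nst ?c, ts)"
    by (metis nst_pos reach_0 reach_step)
  then show ?case using WhileF unfolding One_nat_def by blast
next
  case (WhileT P \<sigma> k c \<sigma>1 t1 \<sigma>' t2)
  let ?c = "While k P c"
  obtain ts1 where 1: "reach (frag c) (nst c) t1 (0, ts) (nst c, ts1)" "rep \<sigma>1 ts1" using WhileT by auto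
  obtain ts2 where 2: "reach (frag ?c) (nst ?c) t2 (0, ts1) (nst ?c, ts2)" "rep \<sigma>' ts2"
    using WhileT 1 by blast
  have "frag_step (frag ?c) (0, ts) = (1, ts)"
    using WhileT by (simp add: frag_step_def act_idle rep_heads)
  moreover have "reach (frag ?c) (nst ?c) t1 (1, ts) (0, ts1)"
    using reach_embed[OF 1(1), of "\<lambda>q. if q < nst c then Suc q else 0" "nst ?c" "frag ?c"]
    by simp
  ultimately show ?case using 2 reach_step[of "frag ?c" "nst ?c" "t1 + t2" 0 ts] reach_trans
    by (metis nst_pos)
qed

text \<open>The machine model starts in state 0 and halts in state 1, whereas a fragment ends in
  \<open>nst c\<close>. So the exit becomes 1 and the remaining states from 1 on move up by
  one.\<close>

definition compile :: "cmd \<Rightarrow> tm" where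
  "compile c = \<lparr> n_tapes = 6, n_states = Suc (nst c), n_syms = 3,
     delta = (\<lambda>q ss. if q = 1 then (1, idle ss)
        else apfst (\<lambda>q'. if q' = 0 then 0 else if q' = nst c then 1 else Suc q')
               (frag c (if q = 0 then 0 else q - 1) ss)) \<rparr>"

lemma wf_compile: "wf_cmd c \<Longrightarrow> wf_tm (compile c)"
proof -
  assume c: "wf_cmd c"
  have "q' < Suc (nst c) \<and> length as = 6 \<and> fst ` set as \<subseteq> {..<3}"
    if h: "q < Suc (nst c)" "length ss = 6" "set ss \<subseteq> {..<3}" "delta (compile c) q ss = (q', as)" for q ss q' as
  proof (cases "q = 1")
    case True
    then show ?thesis using h nst_pos[of c] by (auto simp: compile_def idle_def simp del: nst_pos)
  next
    case False
    let ?q = "if q = 0 then 0 else q - 1"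
    obtain q1 as1 where 1: "frag c ?q ss = (q1, as1)" by fastforce
    have "?q < nst c" using h(1) False by (auto simp: less_Suc_eq_0_disj)
    then have "q1 \<le> nst c \<and> length as1 = 6 \<and> fst ` set as1 \<subseteq> {..<3}"
      using frag_bounds[OF c _ h(3,2) 1] by blast
    then show ?thesis using h(4) False 1 nst_pos[of c]
      by (auto simp: compile_def simp del: nst_pos split: if_splits)
  qed
  then show ?thesis using nst_pos[of c] unfolding wf_tm_def by (auto simp: compile_def Suc_le_eq simp del: nst_pos)
qed

lemma reach_compile:
  assumes "reach (frag c) (nst c) t cf cf'"
  defines "\<rho> \<equiv> \<lambda>q. if q = 0 then 0 else if q = nst c then 1 else Suc q"
  shows "(step (compile c) ^^ t) (apfst \<rho> cf) = apfst \<rho> cf'"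
  using assms(1)
proof (induction rule: reach.induct)
  case (reach_0 cf)
  show ?case by simp
next
  case (reach_Suc cf t cf')
  obtain q ts where cf: "cf = (q, ts)" by fastforce
  have "\<rho> q \<noteq> 1" "(if \<rho> q = 0 then 0 else \<rho> q - 1) = q"
    using reach_Suc(1) by (auto simp: \<rho>_def cf)
  moreover from this have "delta (compile c) (\<rho> q) ss = apfst \<rho> (frag c q ss)" for ss
    unfolding compile_def tm.simps \<rho>_def[symmetric] by simp
  ultimately have "step (compile c) (apfst \<rho> cf) = apfst \<rho> (frag_step (frag c) cf)"
    by (simp add: cf frag_step_def heads_def split: prod.splits)
  then show ?case using reach_Suc(3) by (simp add: funpow_swap1)
qed

lemma content_lay: "content x = lay (map (\<lambda>b. if b then 2 else 1) x)"
  by (auto simp: content_def lay_def fun_eq_iff)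

lemma polytimeI:
  assumes "wf_cmd c"
    and "\<And>x. \<exists>\<sigma>'. \<exists>t\<le>poly p (length x).
        exec c ((\<lambda>_. [])(0 := map (\<lambda>b. if b then 2 else 1) x)) \<sigma>' t \<and>
        \<sigma>' 5 = map (\<lambda>b. if b then 2 else 1) (f x)"
  shows "polytime f"
  unfolding polytime_def
proof (intro exI conjI allI)
  show "wf_tm (compile c)" using assms(1) by (rule wf_compile)
  fix x
  let ?\<sigma> = "(\<lambda>_. [])(0 := map (\<lambda>b. if b then 2 else 1) x) :: nat \<Rightarrow> nat list"
  obtain \<sigma>' t where e: "t \<le> poly p (length x)" "exec c ?\<sigma> \<sigma>' t"
    "\<sigma>' 5 = map (\<lambda>b. if b then 2 else 1) (f x)" using assms(2) by blast
  let ?ts = "(content x, 0) # replicate 5 (content [], 0)"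
  have nil: "content [] = lay []" by (simp add: content_lay)
  have "rep_stack (?\<sigma> k) (?ts ! k)" if "k < 5" for k
    using that by (cases k) (auto simp: rep_stack_def content_lay)
  then have "rep ?\<sigma> ?ts" by (simp add: rep_def nil)
  then obtain ts' where r: "reach (frag c) (nst c) t (0, ?ts) (nst c, ts')" "rep \<sigma>' ts'"
    using exec_reach[OF e(2) assms(1)] by blast
  have ic: "init_config (compile c) x = (0, ?ts)" by (simp add: init_config_def compile_def)
  have "(step (compile c) ^^ t) (0, ?ts) = (1, ts')"
    using reach_compile[OF r(1)] nst_pos[of c] by (simp del: nst_pos)
  moreover have "fst (last ts') = content (f x)"
  proof -
    have "ts' \<noteq> []" using r(2) by (auto simp: rep_def)
    then show ?thesis using r(2) e(3) by (auto simp: rep_def content_lay last_conv_nth)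
  qed
  ultimately show "computes_within (compile c) x (f x) (poly p (length x))"
    unfolding computes_within_def ic using e(1) by blast
qed

section \<open>Executions with upper bounds on the running time\<close>

definition runs :: "cmd \<Rightarrow> (nat \<Rightarrow> nat list) \<Rightarrow> (nat \<Rightarrow> nat list) \<Rightarrow> nat \<Rightarrow> bool" where
  "runs c \<sigma> \<sigma>' T \<longleftrightarrow> (\<exists>t\<le>T. exec c \<sigma> \<sigma>' t)"

lemma runs_mono: "runs c \<sigma> \<sigma>' T \<Longrightarrow> T \<le> T' \<Longrightarrow> runs c \<sigma> \<sigma>' T'"
  unfolding runs_def using le_trans by blast

lemma runs_Seq: "runs c \<sigma> \<sigma>1 t1 \<Longrightarrow> runs d \<sigma>1 \<sigma>' t2 \<Longrightarrow> runs (c ;; d) \<sigma> \<sigma>' (t1 + t2)"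
  unfolding runs_def by (meson add_mono exec.Seq)

lemma runs_Push: "runs (Push k s) \<sigma> (\<sigma>(k := s # \<sigma> k)) 2"
  unfolding runs_def using exec.Push by blast

lemma runs_Pop: "runs (Pop k) \<sigma> (\<sigma>(k := tl (\<sigma> k))) 1"
  unfolding runs_def using exec.Pop by blast

lemma runs_Out: "runs (Out s) \<sigma> (\<sigma>(5 := \<sigma> 5 @ [s])) 1"
  unfolding runs_def using exec.Out by blast

lemma runs_If: "runs (if P (top (\<sigma> k)) then c else d) \<sigma> \<sigma>' T \<Longrightarrow> runs (If k P c d) \<sigma> \<sigma>' (Suc T)"
  unfolding runs_def by (metis exec.IfF exec.IfT not_less_eq_eq)

lemma runs_WhileF:
  "\<not> P (top (\<sigma> k)) \<Longrightarrow> \<sigma> = \<sigma>' \<Longrightarrow> 1 \<le> T \<Longrightarrow> runs (While k P c) \<sigma> \<sigma>' T"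
  unfolding runs_def using exec.WhileF by blast

lemma runs_WhileT:
  "P (top (\<sigma> k)) \<Longrightarrow> runs c \<sigma> \<sigma>1 t1 \<Longrightarrow> runs (While k P c) \<sigma>1 \<sigma>' t2 \<Longrightarrow>
    Suc (t1 + t2) \<le> T \<Longrightarrow> runs (While k P c) \<sigma> \<sigma>' T"
  unfolding runs_def by (smt (verit) Suc_le_mono add_mono exec.WhileT le_trans)

section \<open>Binary trees on the stack\<close>

datatype dat = Nl | Cs dat dat

text \<open>A prefix code: the end of a tree is recognised while reading it, so trees can lie on a
  stack on top of anything else. Symbol 0 never occurs and is left to signal the bottom of a
  stack.\<close>

primrec str :: "dat \<Rightarrow> nat list" where
  "str Nl = [1]"
| "str (Cs a b) = 2 # str a @ str b"

definition dsz :: "dat \<Rightarrow> nat" where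
  "dsz d = length (str d)"

lemma dsz_simps [simp]: "dsz Nl = 1" "dsz (Cs a b) = Suc (dsz a + dsz b)"
  by (simp_all add: dsz_def)

lemma dsz_pos [simp]: "0 < dsz d"
  by (induction d) auto

lemma set_str: "set (str d) \<subseteq> {1, 2}"
  by (induction d) auto

definition nop :: cmd where
  "nop = While 1 (\<lambda>_. False) (Pop 1)"

text \<open>Stack 4 counts in unary the subtrees that are still to be read: symbol 2 opens one more,
  symbol 1 closes one. The loop therefore stops after exactly one tree, which arrives reversed on
  stack \<open>j\<close>.\<close>

definition mv :: "nat \<Rightarrow> cmd" where
  "mv j = Push 4 1 ;; While 4 (\<lambda>s. s \<noteq> 0)
     (If 1 (\<lambda>s. s = 2) (Pop 1 ;; Push j 2 ;; Push 4 1) (Pop 1 ;; Push j 1 ;; Pop 4))"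

definition pour :: "nat \<Rightarrow> nat \<Rightarrow> cmd" where
  "pour i j = While i (\<lambda>s. s \<noteq> 0)
     (If i (\<lambda>s. s = 2) (Pop i ;; Push j 2) (Pop i ;; Push j 1))"

definition pour2 :: "nat \<Rightarrow> nat \<Rightarrow> nat \<Rightarrow> cmd" where
  "pour2 i j k = While i (\<lambda>s. s \<noteq> 0)
     (If i (\<lambda>s. s = 2) (Pop i ;; Push j 2 ;; Push k 2) (Pop i ;; Push j 1 ;; Push k 1))"

definition clr :: "nat \<Rightarrow> cmd" where
  "clr i = While i (\<lambda>s. s \<noteq> 0) (Pop i)"

lemma wf_macros [simp]:
  "wf_cmd nop" "j < 5 \<Longrightarrow> wf_cmd (mv j)" "i < 5 \<Longrightarrow> j < 5 \<Longrightarrow> wf_cmd (pour i j)"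
  "i < 5 \<Longrightarrow> j < 5 \<Longrightarrow> k < 5 \<Longrightarrow> wf_cmd (pour2 i j k)" "i < 5 \<Longrightarrow> wf_cmd (clr i)"
  by (simp_all add: nop_def mv_def pour_def pour2_def clr_def)

lemma runs_nop: "1 \<le> T \<Longrightarrow> runs nop \<sigma> \<sigma> T"
  unfolding nop_def by (rule runs_WhileF) simp_all

lemma runs_Pop': "\<sigma>(k := tl (\<sigma> k)) = \<sigma>' \<Longrightarrow> runs (Pop k) \<sigma> \<sigma>' 1"
  using runs_Pop[of k \<sigma>] by auto

lemma runs_Push': "\<sigma>(k := s # \<sigma> k) = \<sigma>' \<Longrightarrow> runs (Push k s) \<sigma> \<sigma>' 2"
  using runs_Push[of k s \<sigma>] by auto

text \<open>Stated with a continuation: a run of the loop from behind the tree extends to a run from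
  before it. In this form the induction hypotheses for the two subtrees chain directly, although
  both are consumed by the same loop.\<close>

lemma mv_loop:
  fixes j :: nat
  defines "W \<equiv> While 4 (\<lambda>s. s \<noteq> 0)
     (If 1 (\<lambda>s. s = 2) (Pop 1 ;; Push j 2 ;; Push 4 1) (Pop 1 ;; Push j 1 ;; Pop 4))"
  assumes "j = 2 \<or> j = 3"
  shows "\<sigma> 1 = str d @ r \<Longrightarrow> \<sigma> 4 = 1 # cs \<Longrightarrow>
    runs W (\<sigma>(1 := r, j := rev (str d) @ \<sigma> j, 4 := cs)) \<sigma>' T \<Longrightarrow> runs W \<sigma> \<sigma>' (T + 8 * dsz d)"
proof (induction d arbitrary: \<sigma> r cs \<sigma>' T)
  case Nl
  have "runs (Pop 1 ;; Push j 1 ;; Pop 4) \<sigma> (\<sigma>(1 := r, j := rev (str Nl) @ \<sigma> j, 4 := cs)) (1 + (2 + 1))"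
    using Nl assms(2) by (intro runs_Seq[OF runs_Pop] runs_Seq[OF runs_Push] runs_Pop') (auto simp: fun_eq_iff)
  then have "runs (If 1 (\<lambda>s. s = 2) (Pop 1 ;; Push j 2 ;; Push 4 1) (Pop 1 ;; Push j 1 ;; Pop 4)) \<sigma>
      (\<sigma>(1 := r, j := rev (str Nl) @ \<sigma> j, 4 := cs)) (Suc (1 + (2 + 1)))"
    using Nl by (intro runs_If) simp
  note 2 = this
  show ?case
    unfolding W_def by (rule runs_WhileT[OF _ 2 Nl(3)[unfolded W_def]]) (use Nl(2) in auto)
next
  case (Cs a b)
  let ?\<sigma> = "\<sigma>(1 := str a @ str b @ r, j := 2 # \<sigma> j, 4 := 1 # 1 # cs)"
  have "runs (Pop 1 ;; Push j 2 ;; Push 4 1) \<sigma> ?\<sigma> (1 + (2 + 2))"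
    using Cs.prems assms(2) by (intro runs_Seq[OF runs_Pop] runs_Seq[OF runs_Push] runs_Push') (auto simp: fun_eq_iff)
  then have 1: "runs (If 1 (\<lambda>s. s = 2) (Pop 1 ;; Push j 2 ;; Push 4 1) (Pop 1 ;; Push j 1 ;; Pop 4)) \<sigma>
      ?\<sigma> (Suc (1 + (2 + 2)))"
    using Cs.prems by (intro runs_If) simp
  let ?\<sigma>2 = "?\<sigma>(1 := str b @ r, j := rev (str a) @ ?\<sigma> j, 4 := 1 # cs)"
  have eq: "?\<sigma>2(1 := r, j := rev (str b) @ ?\<sigma>2 j, 4 := cs) = \<sigma>(1 := r, j := rev (str (Cs a b)) @ \<sigma> j, 4 := cs)"
    using assms(2) by (auto simp: fun_eq_iff)
  have "runs W ?\<sigma>2 \<sigma>' (T + 8 * dsz b)"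
  proof (rule Cs.IH(2))
    show "runs W (?\<sigma>2(1 := r, j := rev (str b) @ ?\<sigma>2 j, 4 := cs)) \<sigma>' T"
      unfolding eq by (rule Cs.prems)
  qed (use assms(2) in auto)
  then have "runs W ?\<sigma> \<sigma>' (T + 8 * dsz b + 8 * dsz a)"
    by (rule Cs.IH(1)[rotated 2]) (use assms(2) in auto)
  note 2 = this
  show ?case
    unfolding W_def by (rule runs_WhileT[OF _ 1 2[unfolded W_def]]) (use Cs.prems in auto)
qed

lemma runs_mv:
  assumes "j = 2 \<or> j = 3" "\<sigma> 1 = str d @ r" "\<sigma> 4 = []"
    "\<sigma>(1 := r, j := rev (str d) @ \<sigma> j) = \<sigma>'"
  shows "runs (mv j) \<sigma> \<sigma>' (3 + 8 * dsz d)"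
proof -
  let ?\<sigma> = "\<sigma>(4 := 1 # \<sigma> 4)"
  have "?\<sigma>(1 := r, j := rev (str d) @ ?\<sigma> j, 4 := []) = \<sigma>'"
    using assms(1,3) by (auto simp: assms(4)[symmetric] fun_eq_iff)
  then have "runs (mv j) \<sigma> \<sigma>' (2 + (1 + 8 * dsz d))"
    unfolding mv_def using assms
    by (intro runs_Seq[OF runs_Push] mv_loop[where r = r and cs = "[]"] runs_WhileF) auto
  then show ?thesis by (rule runs_mono) simp
qed

lemma runs_pour:
  assumes "i \<noteq> j" "set (\<sigma> i) \<subseteq> {1, 2}" "\<sigma>(i := [], j := rev (\<sigma> i) @ \<sigma> j) = \<sigma>'"
  shows "runs (pour i j) \<sigma> \<sigma>' (1 + 6 * length (\<sigma> i))"
  using assms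
proof (induction "\<sigma> i" arbitrary: \<sigma>)
  case Nil
  then have "\<sigma> = \<sigma>'" by auto
  then show ?case using Nil unfolding pour_def by (auto intro: runs_WhileF)
next
  case (Cons s x)
  let ?\<sigma> = "\<sigma>(i := x, j := s # \<sigma> j)"
  have "runs (Pop i ;; Push j s) \<sigma> ?\<sigma> (1 + 2)"
    using Cons.prems(1) Cons.hyps(2)[symmetric] by (intro runs_Seq[OF runs_Pop] runs_Push') auto
  then have 1: "runs (If i (\<lambda>s. s = 2) (Pop i ;; Push j 2) (Pop i ;; Push j 1)) \<sigma> ?\<sigma> (Suc (1 + 2))"
    using Cons.prems Cons.hyps(2)[symmetric] by (intro runs_If) auto
  have "runs (pour i j) ?\<sigma> \<sigma>' (1 + 6 * length (?\<sigma> i))"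
    using Cons.prems Cons.hyps(2)[symmetric] by (intro Cons.hyps(1)) (auto simp: fun_eq_iff)
  note 2 = this
  show ?case
    unfolding pour_def
    by (rule runs_WhileT[OF _ 1 2[unfolded pour_def]])
      (use Cons.prems Cons.hyps(2)[symmetric] in auto)
qed

lemma runs_pour2:
  assumes "i \<noteq> j" "i \<noteq> k" "j \<noteq> k" "set (\<sigma> i) \<subseteq> {1, 2}"
    "\<sigma>(i := [], j := rev (\<sigma> i) @ \<sigma> j, k := rev (\<sigma> i) @ \<sigma> k) = \<sigma>'"
  shows "runs (pour2 i j k) \<sigma> \<sigma>' (1 + 8 * length (\<sigma> i))"
  using assms
proof (induction "\<sigma> i" arbitrary: \<sigma>)
  case Nil
  then have "\<sigma> = \<sigma>'" by auto
  then show ?case using Nil unfolding pour2_def by (auto intro: runs_WhileF)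
next
  case (Cons s x)
  let ?\<sigma> = "\<sigma>(i := x, j := s # \<sigma> j, k := s # \<sigma> k)"
  have "runs (Pop i ;; Push j s ;; Push k s) \<sigma> ?\<sigma> (1 + (2 + 2))"
    using Cons.prems(1-3) Cons.hyps(2)[symmetric]
    by (intro runs_Seq[OF runs_Pop] runs_Seq[OF runs_Push] runs_Push') (auto simp: fun_eq_iff)
  then have 1: "runs (If i (\<lambda>s. s = 2) (Pop i ;; Push j 2 ;; Push k 2) (Pop i ;; Push j 1 ;; Push k 1))
      \<sigma> ?\<sigma> (Suc (1 + (2 + 2)))"
    using Cons.prems Cons.hyps(2)[symmetric] by (intro runs_If) auto
  have "runs (pour2 i j k) ?\<sigma> \<sigma>' (1 + 8 * length (?\<sigma> i))"
    using Cons.prems Cons.hyps(2)[symmetric] by (intro Cons.hyps(1)) (auto simp: fun_eq_iff)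
  note 2 = this
  show ?case
    unfolding pour2_def
    by (rule runs_WhileT[OF _ 1 2[unfolded pour2_def]])
      (use Cons.prems Cons.hyps(2)[symmetric] in auto)
qed

lemma runs_clr:
  assumes "0 \<notin> set (\<sigma> i)" "\<sigma>(i := []) = \<sigma>'"
  shows "runs (clr i) \<sigma> \<sigma>' (1 + 2 * length (\<sigma> i))"
  using assms
proof (induction "\<sigma> i" arbitrary: \<sigma>)
  case Nil
  then have "\<sigma> = \<sigma>'" by auto
  then show ?case using Nil unfolding clr_def by (auto intro: runs_WhileF)
next
  case (Cons s x)
  have 1: "runs (Pop i) \<sigma> (\<sigma>(i := x)) 1"
    using Cons.hyps(2)[symmetric] by (intro runs_Pop') auto
  have "runs (clr i) (\<sigma>(i := x)) \<sigma>' (1 + 2 * length ((\<sigma>(i := x)) i))"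
    using Cons.prems Cons.hyps(2)[symmetric] by (intro Cons.hyps(1)) (auto simp: fun_eq_iff)
  note 2 = this
  show ?case
    unfolding clr_def
    by (rule runs_WhileT[OF _ 1 2[unfolded clr_def]])
      (use Cons.prems Cons.hyps(2)[symmetric] in auto)
qed

definition stk :: "nat list \<Rightarrow> nat list \<Rightarrow> nat list \<Rightarrow> nat \<Rightarrow> nat list" where
  "stk s a b = (\<lambda>_. [])(1 := s, 2 := a, 3 := b)"

lemma stk_simps [simp]:
  "stk s a b 1 = s" "stk s a b (Suc 0) = s" "stk s a b 2 = a" "stk s a b 3 = b" "stk s a b 4 = []"
  "(stk s a b)(1 := s') = stk s' a b" "(stk s a b)(Suc 0 := s') = stk s' a b"
  "(stk s a b)(2 := a') = stk s a' b" "(stk s a b)(3 := b') = stk s a b'"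
  by (auto simp: stk_def fun_eq_iff)

definition drop1 :: cmd where "drop1 = mv 3 ;; clr 3"
text \<open>Every pour reverses. The double pour brings the reversed tree in order onto stacks 1 and
  3, and the copy needs two more pours to reach stack 1 in order.\<close>

definition dup :: cmd where "dup = mv 2 ;; pour2 2 1 3 ;; pour 3 2 ;; pour 2 1"
definition swap :: cmd where "swap = mv 2 ;; mv 3 ;; pour 2 1 ;; pour 3 1"

lemma wf_macros2 [simp]: "wf_cmd drop1" "wf_cmd dup" "wf_cmd swap"
  by (simp_all add: drop1_def dup_def swap_def)

lemma length_str [simp]: "length (str d) = dsz d"
  by (simp add: dsz_def)

lemma zero_notin_str [simp]: "0 \<notin> set (str d)"
  using set_str[of d] by auto

lemma runs_mv_stk:
  "runs (mv 2) (stk (str d @ r) a b) (stk r (rev (str d) @ a) b) (3 + 8 * dsz d)"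
  "runs (mv 3) (stk (str d @ r) a b) (stk r a (rev (str d) @ b)) (3 + 8 * dsz d)"
  by (rule runs_mv[where d = d and r = r]; simp)+

lemma runs_pour_stk:
  "runs (pour 2 1) (stk s (rev (str d)) b) (stk (str d @ s) [] b) (1 + 6 * dsz d)"
  "runs (pour 3 1) (stk s a (rev (str d))) (stk (str d @ s) a []) (1 + 6 * dsz d)"
  "runs (pour 3 2) (stk s [] (str d)) (stk s (rev (str d)) []) (1 + 6 * dsz d)"
  "runs (pour2 2 1 3) (stk s (rev (str d)) []) (stk (str d @ s) [] (str d)) (1 + 8 * dsz d)"
  using set_str[of d]
    runs_pour[of 2 1 "stk s (rev (str d)) b"] runs_pour[of 3 1 "stk s a (rev (str d))"]
    runs_pour[of 3 2 "stk s [] (str d)"] runs_pour2[of 2 1 3 "stk s (rev (str d)) []"]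
  by simp_all

lemma runs_clr_stk: "runs (clr 3) (stk s a (rev (str d))) (stk s a []) (1 + 2 * dsz d)"
  using runs_clr[of "stk s a (rev (str d))" 3] by simp

lemma runs_drop1: "runs drop1 (stk (str d @ r) a []) (stk r a []) (20 * dsz d)"
  unfolding drop1_def
  by (rule runs_mono, rule runs_Seq[OF runs_mv_stk(2)], unfold append_Nil2, rule runs_clr_stk)
    (use dsz_pos[of d] in linarith)

lemma runs_dup: "runs dup (stk (str d @ r) [] []) (stk (str d @ str d @ r) [] []) (50 * dsz d)"
  unfolding dup_def
  by (rule runs_mono, rule runs_Seq[OF runs_mv_stk(1)], unfold append_Nil2,
      rule runs_Seq[OF runs_pour_stk(4)], rule runs_Seq[OF runs_pour_stk(3)], rule runs_pour_stk(1))
    (use dsz_pos[of d] in linarith)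

lemma runs_swap:
  "runs swap (stk (str d @ str e @ r) [] []) (stk (str e @ str d @ r) [] []) (50 * dsz d + 50 * dsz e)"
  unfolding swap_def
  by (rule runs_mono, rule runs_Seq[OF runs_mv_stk(1)], rule runs_Seq[OF runs_mv_stk(2)],
      unfold append_Nil2, rule runs_Seq[OF runs_pour_stk(1)], rule runs_pour_stk(2))
    (use dsz_pos[of d] dsz_pos[of e] in linarith)

section \<open>Polynomial bounds\<close>

text \<open>The base is at least 2, so constants, sums and products are absorbed by a larger
  exponent, and a single exponent serves as normal form of a polynomial bound.\<close>

definition pb :: "'i set \<Rightarrow> ('i \<Rightarrow> nat) \<Rightarrow> ('i \<Rightarrow> nat) \<Rightarrow> bool" where
  "pb I m b \<longleftrightarrow> (\<exists>k. \<forall>i\<in>I. b i \<le> (m i + 2) ^ k)"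

lemma pb_mono: "pb I m b \<Longrightarrow> (\<And>i. i \<in> I \<Longrightarrow> b' i \<le> b i) \<Longrightarrow> pb I m b'"
  unfolding pb_def by (meson le_trans)

lemma pb_const: "pb I m (\<lambda>_. c)"
proof -
  have "c \<le> (m i + 2) ^ c" for i
    using less_exp[of c] power_mono[of 2 "m i + 2" c] by linarith
  then show ?thesis unfolding pb_def by blast
qed

lemma pb_id: "pb I m m"
  unfolding pb_def by (rule exI[of _ 1]) simp

lemma pb_add:
  assumes "pb I m a" "pb I m b"
  shows "pb I m (\<lambda>i. a i + b i)"
proof -
  obtain k l where k: "\<forall>i\<in>I. a i \<le> (m i + 2) ^ k" and l: "\<forall>i\<in>I. b i \<le> (m i + 2) ^ l"
    using assms unfolding pb_def by blast
  have "a i + b i \<le> (m i + 2) ^ (k + l + 1)" if "i \<in> I" for i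
  proof -
    let ?M = "(m i + 2) ^ (k + l)"
    have "(m i + 2) ^ k \<le> ?M" "(m i + 2) ^ l \<le> ?M" by (simp_all add: power_increasing)
    then have "a i \<le> ?M" "b i \<le> ?M" using k l that by (meson le_trans)+
    then have "a i + b i \<le> 2 * ?M" by simp
    also have "\<dots> \<le> (m i + 2) * ?M" by (intro mult_right_mono) auto
    finally show ?thesis by simp
  qed
  then show ?thesis unfolding pb_def by blast
qed

lemma pb_mult:
  assumes "pb I m a" "pb I m b"
  shows "pb I m (\<lambda>i. a i * b i)"
proof -
  obtain k l where k: "\<forall>i\<in>I. a i \<le> (m i + 2) ^ k" and l: "\<forall>i\<in>I. b i \<le> (m i + 2) ^ l"
    using assms unfolding pb_def by blast
  have "a i * b i \<le> (m i + 2) ^ (k + l)" if "i \<in> I" for i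
    using k l that by (auto simp: power_add intro: mult_mono)
  then show ?thesis unfolding pb_def by blast
qed

lemma pb_pow: "pb I m a \<Longrightarrow> pb I m (\<lambda>i. a i ^ k)"
  by (induction k) (auto intro: pb_mult pb_const)

lemma pb_Suc: "pb I m a \<Longrightarrow> pb I m (\<lambda>i. Suc (a i))"
  using pb_add[OF _ pb_const[of I m 1]] by simp

lemma pb_trans:
  assumes "pb I m m'" "pb I m' b"
  shows "pb I m b"
proof -
  obtain k where "\<forall>i\<in>I. b i \<le> (m' i + 2) ^ k" using assms(2) unfolding pb_def by blast
  moreover have "pb I m (\<lambda>i. (m' i + 2) ^ k)"
    by (intro pb_pow pb_add assms(1) pb_const)
  ultimately show ?thesis using pb_mono by fast
qed

lemma pb_reindex: "pb J m b \<Longrightarrow> (\<And>i. i \<in> I \<Longrightarrow> h i \<in> J) \<Longrightarrow> pb I (\<lambda>i. m (h i)) (\<lambda>i. b (h i))"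
  unfolding pb_def by blast

lemmas pb_intros = pb_const pb_add pb_mult pb_pow pb_Suc

section \<open>Polynomial-time transformations of families of trees\<close>

text \<open>Families over an index set rather than functions on trees: inside a branch of a
  conditional the set shrinks to the indices that take this branch, and correctness and time matter
  only there. The rest \<open>r\<close> of the stack is arbitrary, so values stored below the
  argument survive a subprogram.\<close>

definition fpr :: "'i set \<Rightarrow> ('i \<Rightarrow> dat) \<Rightarrow> ('i \<Rightarrow> dat) \<Rightarrow> bool" where
  "fpr I A B \<longleftrightarrow> (\<exists>c T. wf_cmd c \<and> pb I (\<lambda>i. dsz (A i)) T \<and> pb I (\<lambda>i. dsz (A i)) (\<lambda>i. dsz (B i)) \<and>
     (\<forall>i\<in>I. \<forall>r. runs c (stk (str (A i) @ r) [] []) (stk (str (B i) @ r) [] []) (T i)))"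

lemma fprI:
  assumes "wf_cmd c" "pb I (\<lambda>i. dsz (A i)) T" "pb I (\<lambda>i. dsz (A i)) (\<lambda>i. dsz (B i))"
    "\<And>i r. i \<in> I \<Longrightarrow> runs c (stk (str (A i) @ r) [] []) (stk (str (B i) @ r) [] []) (T i)"
  shows "fpr I A B"
  unfolding fpr_def using assms by blast

lemma fprE:
  assumes "fpr I A B"
  obtains c T where "wf_cmd c" "pb I (\<lambda>i. dsz (A i)) T" "pb I (\<lambda>i. dsz (A i)) (\<lambda>i. dsz (B i))"
    "\<And>i r. i \<in> I \<Longrightarrow> runs c (stk (str (A i) @ r) [] []) (stk (str (B i) @ r) [] []) (T i)"
  using assms unfolding fpr_def by blast

lemma fpr_size: "fpr I A B \<Longrightarrow> pb I (\<lambda>i. dsz (A i)) (\<lambda>i. dsz (B i))"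
  unfolding fpr_def by blast

lemma fpr_cong: "fpr I A B \<Longrightarrow> (\<And>i. i \<in> I \<Longrightarrow> A i = A' i) \<Longrightarrow> (\<And>i. i \<in> I \<Longrightarrow> B i = B' i) \<Longrightarrow> fpr I A' B'"
  unfolding fpr_def pb_def by (simp cong: ball_cong)

lemma fpr_subset: "fpr I A B \<Longrightarrow> J \<subseteq> I \<Longrightarrow> fpr J A B"
  unfolding fpr_def pb_def by (meson subsetD)

lemma fpr_reindex: "fpr J A B \<Longrightarrow> (\<And>i. i \<in> I \<Longrightarrow> h i \<in> J) \<Longrightarrow> fpr I (\<lambda>i. A (h i)) (\<lambda>i. B (h i))"
  by (erule fprE, rule fprI) (auto intro: pb_reindex)

lemma fpr_id: "fpr I A A"
  by (rule fprI[of nop _ _ "\<lambda>_. 1"]) (auto intro: pb_const pb_id runs_nop)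

lemma fpr_comp:
  assumes "fpr I A B" "fpr I B C"
  shows "fpr I A C"
  using assms(1)
proof (rule fprE)
  fix c T
  assume c: "wf_cmd c" "pb I (\<lambda>i. dsz (A i)) T" "pb I (\<lambda>i. dsz (A i)) (\<lambda>i. dsz (B i))"
    "\<And>i r. i \<in> I \<Longrightarrow> runs c (stk (str (A i) @ r) [] []) (stk (str (B i) @ r) [] []) (T i)"
  show ?thesis using assms(2)
  proof (rule fprE)
    fix d U
    assume d: "wf_cmd d" "pb I (\<lambda>i. dsz (B i)) U" "pb I (\<lambda>i. dsz (B i)) (\<lambda>i. dsz (C i))"
      "\<And>i r. i \<in> I \<Longrightarrow> runs d (stk (str (B i) @ r) [] []) (stk (str (C i) @ r) [] []) (U i)"
    show ?thesis
      by (rule fprI[of "c ;; d" _ _ "\<lambda>i. T i + U i"])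
        (use c d in \<open>auto intro: pb_add pb_trans runs_Seq[OF c(4) d(4)]\<close>)
  qed
qed

lemma fpr_Cs:
  assumes "fpr I A B" "fpr I A C"
  shows "fpr I A (\<lambda>i. Cs (B i) (C i))"
  using assms(1)
proof (rule fprE)
  fix c T
  assume c: "wf_cmd c" "pb I (\<lambda>i. dsz (A i)) T" "pb I (\<lambda>i. dsz (A i)) (\<lambda>i. dsz (B i))"
    "\<And>i r. i \<in> I \<Longrightarrow> runs c (stk (str (A i) @ r) [] []) (stk (str (B i) @ r) [] []) (T i)"
  show ?thesis using assms(2)
  proof (rule fprE)
    fix d U
    assume d: "wf_cmd d" "pb I (\<lambda>i. dsz (A i)) U" "pb I (\<lambda>i. dsz (A i)) (\<lambda>i. dsz (C i))"
      "\<And>i r. i \<in> I \<Longrightarrow> runs d (stk (str (A i) @ r) [] []) (stk (str (C i) @ r) [] []) (U i)"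
    \<comment> \<open>The tail is computed first, on a copy of the argument, so that it ends up
      below the head; the node symbol 2 on top completes the code of the pair.\<close>
    have "runs (dup ;; d ;; swap ;; c ;; Push 1 2) (stk (str (A i) @ r) [] [])
        (stk (str (Cs (B i) (C i)) @ r) [] []) (50 * dsz (A i) + (U i + (50 * dsz (C i) + 50 * dsz (A i) + (T i + 2))))"
      if i: "i \<in> I" for i r
      by (rule runs_Seq[OF runs_dup] runs_Seq[OF d(4)[OF i]] runs_Seq[OF runs_swap] runs_Seq[OF c(4)[OF i]]
        runs_Push')+ simp
    then show ?thesis
      by (intro fprI[of "dup ;; d ;; swap ;; c ;; Push 1 2" _ _
            "\<lambda>i. 50 * dsz (A i) + (U i + (50 * dsz (C i) + 50 * dsz (A i) + (T i + 2)))"])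
        (use c d in \<open>auto intro!: pb_intros pb_id\<close>)
  qed
qed

lemma fpr_const_aux: "\<exists>c T. wf_cmd c \<and> (\<forall>r. runs c (stk r [] []) (stk (str d @ r) [] []) T)"
proof (induction d)
  case Nl
  have "runs (Push 1 1) (stk r [] []) (stk (str Nl @ r) [] []) 2" for r
    by (rule runs_Push') simp
  then show ?case by (intro exI[of _ "Push 1 1"] exI[of _ 2]) simp
next
  case (Cs a b)
  then obtain c T d U where c: "wf_cmd c" "\<And>r. runs c (stk r [] []) (stk (str a @ r) [] []) T"
    and d: "wf_cmd d" "\<And>r. runs d (stk r [] []) (stk (str b @ r) [] []) U" by blast
  have "runs (d ;; c ;; Push 1 2) (stk r [] []) (stk (str (Cs a b) @ r) [] []) (U + (T + 2))" for r
    by (rule runs_Seq[OF d(2)] runs_Seq[OF c(2)] runs_Push')+ simp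
  then show ?case using c(1) d(1) by (intro exI[of _ "d ;; c ;; Push 1 2"] exI[of _ "U + (T + 2)"]) simp
qed

lemma fpr_const: "fpr I A (\<lambda>_. d)"
proof -
  obtain c T where c: "wf_cmd c" "\<And>r. runs c (stk r [] []) (stk (str d @ r) [] []) T"
    using fpr_const_aux by blast
  show ?thesis
    by (rule fprI[of "drop1 ;; c" _ _ "\<lambda>i. 20 * dsz (A i) + T"])
      (auto intro!: pb_intros pb_id c runs_Seq[OF runs_drop1 c(2)])
qed

fun hdD :: "dat \<Rightarrow> dat" where
  "hdD Nl = Nl"
| "hdD (Cs a b) = a"

fun tlD :: "dat \<Rightarrow> dat" where
  "tlD Nl = Nl"
| "tlD (Cs a b) = b"

lemma fpr_hd:
  assumes "fpr I A B"
  shows "fpr I A (\<lambda>i. hdD (B i))"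
proof (rule fpr_comp[OF assms], rule fprI[where T = "\<lambda>i. 50 * dsz (B i)"])
  let ?c = "If 1 (\<lambda>s. s = 2) (Pop 1 ;; mv 2 ;; drop1 ;; pour 2 1) nop"
  show "wf_cmd ?c" by simp
  show "pb I (\<lambda>i. dsz (B i)) (\<lambda>i. dsz (hdD (B i)))"
    by (rule pb_mono[OF pb_id], case_tac "B i") auto
  show "pb I (\<lambda>i. dsz (B i)) (\<lambda>i. 50 * dsz (B i))"
    by (intro pb_intros pb_id)
  show "runs ?c (stk (str (B i) @ r) [] []) (stk (str (hdD (B i)) @ r) [] []) (50 * dsz (B i))" for i r
  proof (cases "B i")
    case Nl
    have "runs ?c (stk (str (B i) @ r) [] []) (stk (str (hdD (B i)) @ r) [] []) (Suc 1)"
      using Nl by (intro runs_If) (simp add: runs_nop)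
    then show ?thesis by (rule runs_mono) (simp add: Nl)
  next
    case (Cs a b)
    have "runs (Pop 1 ;; mv 2 ;; drop1 ;; pour 2 1) (stk (str (B i) @ r) [] []) (stk (str a @ r) [] [])
        (1 + ((3 + 8 * dsz a) + (20 * dsz b + (1 + 6 * dsz a))))"
      by (rule runs_Seq[OF runs_Pop'], simp add: Cs, rule runs_Seq[OF runs_mv_stk(1)],
          rule runs_Seq[OF runs_drop1], unfold append_Nil2, rule runs_pour_stk(1))
    then have "runs ?c (stk (str (B i) @ r) [] []) (stk (str a @ r) [] [])
        (Suc (1 + ((3 + 8 * dsz a) + (20 * dsz b + (1 + 6 * dsz a)))))"
      using Cs by (intro runs_If) simp
    then show ?thesis unfolding Cs hdD.simps dsz_simps by (rule runs_mono) simp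
  qed
qed

lemma fpr_tl:
  assumes "fpr I A B"
  shows "fpr I A (\<lambda>i. tlD (B i))"
proof (rule fpr_comp[OF assms], rule fprI[where T = "\<lambda>i. 50 * dsz (B i)"])
  let ?c = "If 1 (\<lambda>s. s = 2) (Pop 1 ;; drop1) nop"
  show "wf_cmd ?c" by simp
  show "pb I (\<lambda>i. dsz (B i)) (\<lambda>i. dsz (tlD (B i)))"
    by (rule pb_mono[OF pb_id], case_tac "B i") auto
  show "pb I (\<lambda>i. dsz (B i)) (\<lambda>i. 50 * dsz (B i))"
    by (intro pb_intros pb_id)
  show "runs ?c (stk (str (B i) @ r) [] []) (stk (str (tlD (B i)) @ r) [] []) (50 * dsz (B i))" for i r
  proof (cases "B i")
    case Nl
    have "runs ?c (stk (str (B i) @ r) [] []) (stk (str (tlD (B i)) @ r) [] []) (Suc 1)"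
      using Nl by (intro runs_If) (simp add: runs_nop)
    then show ?thesis by (rule runs_mono) (simp add: Nl)
  next
    case (Cs a b)
    have "runs (Pop 1 ;; drop1) (stk (str (B i) @ r) [] []) (stk (str b @ r) [] []) (1 + 20 * dsz a)"
      by (rule runs_Seq[OF runs_Pop'], simp add: Cs, rule runs_drop1)
    then have "runs ?c (stk (str (B i) @ r) [] []) (stk (str b @ r) [] []) (Suc (1 + 20 * dsz a))"
      using Cs by (intro runs_If) simp
    then show ?thesis unfolding Cs tlD.simps dsz_simps by (rule runs_mono) simp
  qed
qed

lemma fpr_if:
  assumes P: "fpr I A P" and B: "fpr {i\<in>I. P i = Nl} A B" and C: "fpr {i\<in>I. P i \<noteq> Nl} A C"
  shows "fpr I A (\<lambda>i. if P i = Nl then B i else C i)"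
proof -
  obtain p Tp where p: "wf_cmd p" "pb I (\<lambda>i. dsz (A i)) Tp" "pb I (\<lambda>i. dsz (A i)) (\<lambda>i. dsz (P i))"
    "\<And>i r. i \<in> I \<Longrightarrow> runs p (stk (str (A i) @ r) [] []) (stk (str (P i) @ r) [] []) (Tp i)"
    using P by (rule fprE) blast
  obtain b Tb where b: "wf_cmd b" "pb {i\<in>I. P i = Nl} (\<lambda>i. dsz (A i)) Tb"
    "pb {i\<in>I. P i = Nl} (\<lambda>i. dsz (A i)) (\<lambda>i. dsz (B i))"
    "\<And>i r. i \<in> {i\<in>I. P i = Nl} \<Longrightarrow> runs b (stk (str (A i) @ r) [] []) (stk (str (B i) @ r) [] []) (Tb i)"
    using B by (rule fprE) blast
  obtain c Tc where c: "wf_cmd c" "pb {i\<in>I. P i \<noteq> Nl} (\<lambda>i. dsz (A i)) Tc"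
    "pb {i\<in>I. P i \<noteq> Nl} (\<lambda>i. dsz (A i)) (\<lambda>i. dsz (C i))"
    "\<And>i r. i \<in> {i\<in>I. P i \<noteq> Nl} \<Longrightarrow> runs c (stk (str (A i) @ r) [] []) (stk (str (C i) @ r) [] []) (Tc i)"
    using C by (rule fprE) blast
  \<comment> \<open>A branch has a bound only on its own indices; each bound is extended by 0 to the
    other indices, and the two are added.\<close>
  have split: "pb I m (\<lambda>i. if P i = Nl then f i else g i)"
    if "pb {i\<in>I. P i = Nl} m f" "pb {i\<in>I. P i \<noteq> Nl} m g" for m f g
  proof -
    have "pb I m (\<lambda>i. if P i = Nl then f i else 0)" "pb I m (\<lambda>i. if P i = Nl then 0 else g i)"
      using that unfolding pb_def by force+
    from pb_add[OF this] show ?thesis by (rule pb_mono) auto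
  qed
  let ?e = "dup ;; p ;; If 1 (\<lambda>s. s = 1) (Pop 1 ;; b) (drop1 ;; c)"
  let ?T = "\<lambda>i. if P i = Nl then Tb i else Tc i"
  show ?thesis
  proof (rule fprI[of ?e _ _ "\<lambda>i. 50 * dsz (A i) + (Tp i + Suc (20 * dsz (P i) + ?T i))"])
    show "wf_cmd ?e" using p b c by simp
    show "pb I (\<lambda>i. dsz (A i)) (\<lambda>i. 50 * dsz (A i) + (Tp i + Suc (20 * dsz (P i) + ?T i)))"
      using p b c by (intro pb_intros pb_id split)
    show "pb I (\<lambda>i. dsz (A i)) (\<lambda>i. dsz (if P i = Nl then B i else C i))"
      using split[OF b(3) c(3)] by (rule pb_mono) auto
    fix i r assume i: "i \<in> I"
    let ?s = "stk (str (P i) @ str (A i) @ r) [] []"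
    let ?s' = "stk (str (if P i = Nl then B i else C i) @ r) [] []"
    have "runs (If 1 (\<lambda>s. s = 1) (Pop 1 ;; b) (drop1 ;; c)) ?s ?s' (Suc (20 * dsz (P i) + ?T i))"
    proof (cases "P i")
      case Nl
      have "runs (Pop 1 ;; b) ?s ?s' (1 + Tb i)"
        using b(4)[of i r] i Nl by (intro runs_Seq[OF runs_Pop']) auto
      then show ?thesis using Nl by (intro runs_If) (auto elim: runs_mono)
    next
      case (Cs x y)
      have "runs (drop1 ;; c) ?s ?s' (20 * dsz (P i) + Tc i)"
        using c(4)[of i r] i Cs by (intro runs_Seq[OF runs_drop1]) auto
      then show ?thesis using Cs by (intro runs_If) (auto elim: runs_mono)
    qed
    then show "runs ?e (stk (str (A i) @ r) [] []) ?s' (50 * dsz (A i) + (Tp i + Suc (20 * dsz (P i) + ?T i)))"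
      using runs_Seq[OF runs_dup runs_Seq[OF p(4)[OF i]]] by blast
  qed
qed

primrec rlen :: "dat \<Rightarrow> nat" where
  "rlen Nl = 0"
| "rlen (Cs a b) = Suc (rlen b)"

lemma rlen_le: "rlen n \<le> dsz n"
  by (induction n) auto

text \<open>The counter \<open>n\<close> lies above the state and loses one cell of its right spine
  per round; the state is swapped to the top for the body and back below the counter
  afterwards.\<close>

lemma runs_loop:
  fixes S :: "'s \<Rightarrow> dat"
  defines "W c \<equiv> While 1 (\<lambda>s. s = 2) (Pop 1 ;; drop1 ;; swap ;; c ;; swap)"
  assumes c: "\<And>i r. i \<in> J \<Longrightarrow> runs c (stk (str (S i) @ r) [] []) (stk (str (S (f i)) @ r) [] []) (T i)"
    and N: "dsz n \<le> N"
    and "\<And>j. j < rlen n \<Longrightarrow> (f ^^ j) x \<in> J"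
    and "\<And>j. j \<le> rlen n \<Longrightarrow> dsz (S ((f ^^ j) x)) \<le> K"
    and "\<And>j. j < rlen n \<Longrightarrow> T ((f ^^ j) x) \<le> U"
  shows "runs (W c) (stk (str n @ str (S x) @ r) [] []) (stk (str Nl @ str (S ((f ^^ rlen n) x)) @ r) [] [])
    (1 + rlen n * (120 * N + 100 * K + U + 2))"
  using assms(3-)
proof (induction n arbitrary: x)
  case Nl
  then show ?case unfolding W_def by (intro runs_WhileF) auto
next
  case (Cs h n)
  let ?s = "stk (str (Cs h n) @ str (S x) @ r) [] []"
  let ?b = "Pop 1 ;; drop1 ;; swap ;; c ;; swap"
  have x: "x \<in> J" using Cs.prems(2)[of 0] by simp
  have "runs ?b ?s (stk (str n @ str (S (f x)) @ r) [] []) (1 + (20 * dsz h +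
      ((50 * dsz n + 50 * dsz (S x)) + (T x + (50 * dsz (S (f x)) + 50 * dsz n)))))"
    by (rule runs_Seq[OF runs_Pop'], simp, rule runs_Seq[OF runs_drop1], rule runs_Seq[OF runs_swap],
        rule runs_Seq[OF c[OF x]], rule runs_swap)
  moreover have "dsz (S x) \<le> K" "dsz (S (f x)) \<le> K" "T x \<le> U" "dsz h \<le> N" "dsz n \<le> N"
    using Cs.prems(1) Cs.prems(3)[of 0] Cs.prems(3)[of 1] Cs.prems(4)[of 0] by auto
  ultimately have 1: "runs ?b ?s (stk (str n @ str (S (f x)) @ r) [] []) (1 + 120 * N + 100 * K + U)"
    by (elim runs_mono) linarith
  have 2: "runs (W c) (stk (str n @ str (S (f x)) @ r) [] [])
     (stk (str Nl @ str (S ((f ^^ rlen n) (f x))) @ r) [] []) (1 + rlen n * (120 * N + 100 * K + U + 2))"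
  proof (rule Cs.IH)
    show "dsz n \<le> N" using Cs.prems(1) by simp
    show "(f ^^ j) (f x) \<in> J" if "j < rlen n" for j
      using Cs.prems(2)[of "Suc j"] that by (simp add: funpow_swap1)
    show "dsz (S ((f ^^ j) (f x))) \<le> K" if "j \<le> rlen n" for j
      using Cs.prems(3)[of "Suc j"] that by (simp add: funpow_swap1)
    show "T ((f ^^ j) (f x)) \<le> U" if "j < rlen n" for j
      using Cs.prems(4)[of "Suc j"] that by (simp add: funpow_swap1)
  qed
  have "(f ^^ rlen (Cs h n)) x = (f ^^ rlen n) (f x)" by (simp add: funpow_swap1)
  then show ?case unfolding W_def
    by (simp only:) (rule runs_WhileT[OF _ 1 2[unfolded W_def]]; simp)
qed

text \<open>One round is polynomial in the current size only, and composing such bounds as often as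
  there are rounds need not be polynomial. The bound \<open>b\<close> on every intermediate state
  keeps each round polynomial in the initial size.\<close>

lemma fpr_iter:
  assumes f: "fpr J S (\<lambda>s. S (f s))"
    and J: "\<And>i j. i \<in> I \<Longrightarrow> j < rlen (n i) \<Longrightarrow> (f ^^ j) (x i) \<in> J"
    and b: "pb I (\<lambda>i. dsz (n i) + dsz (S (x i))) b"
      "\<And>i j. i \<in> I \<Longrightarrow> j \<le> rlen (n i) \<Longrightarrow> dsz (S ((f ^^ j) (x i))) \<le> b i"
  shows "fpr I (\<lambda>i. Cs (n i) (S (x i))) (\<lambda>i. S ((f ^^ rlen (n i)) (x i)))"
  using f
proof (rule fprE)
  fix c T
  assume c: "wf_cmd c" "pb J (\<lambda>i. dsz (S i)) T" "pb J (\<lambda>i. dsz (S i)) (\<lambda>i. dsz (S (f i)))"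
    "\<And>i r. i \<in> J \<Longrightarrow> runs c (stk (str (S i) @ r) [] []) (stk (str (S (f i)) @ r) [] []) (T i)"
  obtain k where k: "\<And>i. i \<in> J \<Longrightarrow> T i \<le> (dsz (S i) + 2) ^ k" using c(2) unfolding pb_def by blast
  let ?W = "While 1 (\<lambda>s. s = 2) (Pop 1 ;; drop1 ;; swap ;; c ;; swap)"
  let ?U = "\<lambda>i. 1 + dsz (n i) * (120 * dsz (n i) + 100 * b i + (b i + 2) ^ k + 2)"
  have m: "pb I (\<lambda>i. dsz (Cs (n i) (S (x i)))) (\<lambda>i. dsz (n i) + dsz (S (x i)))"
    by (rule pb_mono[OF pb_id]) auto
  have n: "pb I (\<lambda>i. dsz (Cs (n i) (S (x i)))) (\<lambda>i. dsz (n i))"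
    by (rule pb_mono[OF pb_id]) auto
  have b': "pb I (\<lambda>i. dsz (Cs (n i) (S (x i)))) b"
    by (rule pb_trans[OF m b(1)])
  show ?thesis
  proof (rule fprI[of "Pop 1 ;; ?W ;; Pop 1" _ _ "\<lambda>i. 1 + (?U i + 1)"])
    show "wf_cmd (Pop 1 ;; ?W ;; Pop 1)" using c by simp
    show "pb I (\<lambda>i. dsz (Cs (n i) (S (x i)))) (\<lambda>i. 1 + (?U i + 1))"
      by (intro pb_intros n b')
    show "pb I (\<lambda>i. dsz (Cs (n i) (S (x i)))) (\<lambda>i. dsz (S ((f ^^ rlen (n i)) (x i))))"
      by (rule pb_mono[OF b']) (simp add: b(2))
    fix i r assume i: "i \<in> I"
    let ?s = "stk (str Nl @ str (S ((f ^^ rlen (n i)) (x i))) @ r) [] []"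
    have "T ((f ^^ j) (x i)) \<le> (b i + 2) ^ k" if "j < rlen (n i)" for j
      using k[OF J[OF i that]] power_mono[of "dsz (S ((f ^^ j) (x i))) + 2" "b i + 2" k] b(2)[OF i, of j] that
      by (simp add: le_trans)
    then have "runs ?W (stk (str (n i) @ str (S (x i)) @ r) [] []) ?s
        (1 + rlen (n i) * (120 * dsz (n i) + 100 * b i + (b i + 2) ^ k + 2))"
      using J b(2) i by (intro runs_loop[where J = J and T = T] c(4)) auto
    moreover have "rlen (n i) * (120 * dsz (n i) + 100 * b i + (b i + 2) ^ k + 2)
        \<le> dsz (n i) * (120 * dsz (n i) + 100 * b i + (b i + 2) ^ k + 2)"
      using rlen_le by (intro mult_right_mono) auto
    ultimately have 1: "runs ?W (stk (str (n i) @ str (S (x i)) @ r) [] []) ?s (?U i)"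
      by (elim runs_mono) simp
    show "runs (Pop 1 ;; ?W ;; Pop 1) (stk (str (Cs (n i) (S (x i))) @ r) [] [])
        (stk (str (S ((f ^^ rlen (n i)) (x i))) @ r) [] []) (1 + (?U i + 1))"
      by (rule runs_Seq[OF runs_Pop'], simp, rule runs_Seq[OF 1], rule runs_Pop') simp
  qed
qed

section \<open>Polynomial-time functions on encodable types\<close>

class coded =
  fixes cod :: "'a \<Rightarrow> dat"
  assumes cod_inject: "cod x = cod y \<Longrightarrow> x = y"

lemma cod_eq_iff [simp]: "cod x = cod y \<longleftrightarrow> x = y"
  using cod_inject by blast

instantiation unit :: coded
begin
definition cod_unit :: "unit \<Rightarrow> dat" where "cod_unit _ = Nl"
instance by standard simp
end

instantiation bool :: coded
begin
definition cod_bool :: "bool \<Rightarrow> dat" where "cod_bool b = (if b then Cs Nl Nl else Nl)"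
instance by standard (auto simp: cod_bool_def split: if_splits)
end

instantiation nat :: coded
begin
primrec cod_nat :: "nat \<Rightarrow> dat" where "cod_nat 0 = Nl" | "cod_nat (Suc n) = Cs Nl (cod_nat n)"
instance
proof
  show "cod m = cod n \<Longrightarrow> m = n" for m n :: nat
    by (induction m arbitrary: n) (case_tac n; auto)+
qed
end

instantiation prod :: (coded, coded) coded
begin
definition cod_prod :: "'a \<times> 'b \<Rightarrow> dat" where "cod_prod p = Cs (cod (fst p)) (cod (snd p))"
instance by standard (auto simp: cod_prod_def prod_eq_iff dest: cod_inject)
end

instantiation option :: (coded) coded
begin
definition cod_option :: "'a option \<Rightarrow> dat" where
  "cod_option z = (case z of None \<Rightarrow> Nl | Some x \<Rightarrow> Cs (cod x) Nl)"
instance by standard (auto simp: cod_option_def split: option.splits dest: cod_inject)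
end

instantiation list :: (coded) coded
begin
primrec cod_list :: "'a list \<Rightarrow> dat" where "cod_list [] = Nl" | "cod_list (x # xs) = Cs (cod x) (cod_list xs)"
instance
proof
  show "cod xs = cod ys \<Longrightarrow> xs = ys" for xs ys :: "'a list"
    by (induction xs arbitrary: ys) (case_tac ys; auto dest: cod_inject)+
qed
end

section \<open>Sizes of encoded values\<close>

definition esz :: "'a::coded \<Rightarrow> nat" where
  "esz x = dsz (cod x)"

lemma esz_simps [simp]:
  "esz (a, b) = Suc (esz a + esz b)" "esz [] = 1" "esz (x # xs) = Suc (esz x + esz xs)"
  "esz None = 1" "esz (Some x) = esz x + 2" "esz (0::nat) = 1"
  "esz True = 3" "esz False = 1" "esz () = 1" "esz (Suc n) = esz n + 2"
  by (auto simp: esz_def cod_prod_def cod_option_def cod_bool_def cod_unit_def)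

lemma esz_pos [simp]: "0 < esz x"
  by (simp add: esz_def)

lemma esz_nat: "esz (n::nat) = 2 * n + 1"
  by (induction n) auto

lemma esz_append: "esz (xs @ ys) + 1 = esz xs + esz ys"
  by (induction xs) auto

lemma esz_rev [simp]: "esz (rev xs) = esz xs"
proof (induction xs)
  case (Cons x xs)
  then show ?case using esz_append[of "rev xs" "[x]"] by simp
qed simp

lemma esz_le_concat: "esz (concat xss) \<le> esz xss"
proof (induction xss)
  case (Cons xs xss)
  then show ?case using esz_append[of xs "concat xss"] by simp
qed simp

lemma esz_take: "esz (take j xs) \<le> esz xs"
  using esz_append[of "take j xs" "drop j xs"] esz_pos[of "drop j xs"] by (simp del: esz_pos)

lemma esz_drop: "esz (drop j xs) \<le> esz xs"
  using esz_append[of "take j xs" "drop j xs"] esz_pos[of "take j xs"] by (simp del: esz_pos)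

lemma length_le_esz: "length xs \<le> esz xs"
  by (induction xs) auto

lemma esz_mem: "x \<in> set xs \<Longrightarrow> esz x \<le> esz xs"
  by (induction xs) auto

lemma esz_list_bound: "(\<And>x. x \<in> set xs \<Longrightarrow> esz x \<le> c) \<Longrightarrow> esz xs \<le> 1 + length xs * (c + 1)"
  by (induction xs) (auto, fastforce)

section \<open>Closure properties of polynomial-time functions\<close>

definition fp :: "('a::coded \<Rightarrow> 'b::coded) \<Rightarrow> bool" where
  "fp f \<longleftrightarrow> fpr UNIV cod (\<lambda>x. cod (f x))"

named_theorems fpi

lemma fp_size: "fp f \<Longrightarrow> pb UNIV esz (\<lambda>x. esz (f x))"
  unfolding fp_def esz_def using fpr_size by blast

text \<open>The codes of different types overlap on purpose: a list cell is coded like a pair, a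
  number like a list of units, \<open>Some x\<close> like \<open>(x, ())\<close>. Closure properties
  of one type thereby carry over to another at no cost.\<close>

lemma fp_coerce: "fp f \<Longrightarrow> (\<And>x. cod (g x) = cod (f x)) \<Longrightarrow> fp g"
  unfolding fp_def by simp

lemma fp_const [fpi]: "fp (\<lambda>x. c)"
  unfolding fp_def by (rule fpr_const)

lemma fp_id [fpi]: "fp (\<lambda>x. x)"
  unfolding fp_def by (rule fpr_id)

lemma fp_comp: "fp g \<Longrightarrow> fp f \<Longrightarrow> fp (\<lambda>x. g (f x))"
  unfolding fp_def by (rule fpr_comp) (auto intro: fpr_reindex)

lemma fp_pair [fpi]: "fp f \<Longrightarrow> fp g \<Longrightarrow> fp (\<lambda>x. (f x, g x))"
  unfolding fp_def by (drule (1) fpr_Cs) (simp add: cod_prod_def)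

lemma fp_fst [fpi]: "fp f \<Longrightarrow> fp (\<lambda>x. fst (f x))"
  unfolding fp_def by (drule fpr_hd) (simp add: cod_prod_def)

lemma fp_fst_comp: "fp g \<Longrightarrow> fp (\<lambda>p. g (fst p))"
  by (rule fp_comp[OF _ fp_fst[OF fp_id]])

lemma fp_snd [fpi]: "fp f \<Longrightarrow> fp (\<lambda>x. snd (f x))"
  unfolding fp_def by (drule fpr_tl) (simp add: cod_prod_def)

lemma fp_Cons [fpi]: "fp f \<Longrightarrow> fp g \<Longrightarrow> fp (\<lambda>x. f x # g x)"
  by (drule (1) fp_pair, erule fp_coerce) (simp add: cod_prod_def)

lemma fp_Some [fpi]: "fp f \<Longrightarrow> fp (\<lambda>x. Some (f x))"
  by (drule fp_pair[OF _ fp_const[of "()"]], erule fp_coerce) (simp add: cod_prod_def cod_option_def cod_unit_def)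

lemma fp_Suc [fpi]: "fp f \<Longrightarrow> fp (\<lambda>x. Suc (f x))"
  by (drule fp_pair[OF fp_const[of "()"]], erule fp_coerce) (simp add: cod_prod_def cod_unit_def)

lemma fp_if [fpi]:
  assumes "fp P" "fp f" "fp g"
  shows "fp (\<lambda>x. if P x then f x else g x)"
proof -
  have "fpr UNIV cod (\<lambda>x. if cod (P x) = Nl then cod (g x) else cod (f x))"
    using assms unfolding fp_def by (intro fpr_if) (auto intro: fpr_subset)
  then show ?thesis unfolding fp_def
    by (rule fpr_cong) (auto simp: cod_bool_def)
qed

lemma fp_not [fpi]: "fp P \<Longrightarrow> fp (\<lambda>x. \<not> P x)"
  using fp_if[OF _ fp_const[of False] fp_const[of True], of P] by (rule fp_coerce) auto

lemma fp_conj [fpi]: "fp P \<Longrightarrow> fp Q \<Longrightarrow> fp (\<lambda>x. P x \<and> Q x)"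
  by (rule fp_coerce[OF fp_if[of P Q "\<lambda>_. False"]]) (auto intro: fp_const)

lemma fp_disj [fpi]: "fp P \<Longrightarrow> fp Q \<Longrightarrow> fp (\<lambda>x. P x \<or> Q x)"
  by (rule fp_coerce[OF fp_if[of P "\<lambda>_. True" Q]]) (auto intro: fp_const)

lemma fp_imp [fpi]: "fp P \<Longrightarrow> fp Q \<Longrightarrow> fp (\<lambda>x. P x \<longrightarrow> Q x)"
  by (rule fp_coerce[OF fp_disj[of "\<lambda>x. \<not> P x" Q]]) (auto intro: fp_not)

text \<open>A nonempty list has the same code as the pair of its head and tail, so the argument of
  the second branch arises by pairing alone. The test is \<open>fpr_if\<close> on the code, since
  exactly the empty list is coded by \<open>Nl\<close>.\<close>

lemma fp_case_list [fpi]: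
  assumes "fp l" "fp f" "fp (\<lambda>p. g (fst p) (fst (snd p)) (snd (snd p)))"
  shows "fp (\<lambda>x. case l x of [] \<Rightarrow> f x | y # ys \<Rightarrow> g x y ys)"
proof -
  let ?I = "{x. cod (l x) \<noteq> Nl}"
  have "fpr ?I cod (\<lambda>x. Cs (cod x) (cod (l x)))"
    using fpr_Cs[OF fpr_id assms(1)[unfolded fp_def]] by (rule fpr_subset) simp
  moreover have "fpr ?I (\<lambda>x. cod (x, hd (l x), tl (l x))) (\<lambda>x. cod (g x (hd (l x)) (tl (l x))))"
    using fpr_reindex[OF assms(3)[unfolded fp_def], of ?I "\<lambda>x. (x, hd (l x), tl (l x))"] by simp
  moreover have "cod (x, hd (l x), tl (l x)) = Cs (cod x) (cod (l x))" if "x \<in> ?I" for x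
    using that by (cases "l x") (auto simp: cod_prod_def)
  ultimately have "fpr ?I cod (\<lambda>x. cod (g x (hd (l x)) (tl (l x))))"
    using fpr_comp fpr_cong by (smt (verit, ccfv_SIG))
  then have "fpr UNIV cod (\<lambda>x. if cod (l x) = Nl then cod (f x) else cod (g x (hd (l x)) (tl (l x))))"
    using assms(1,2) unfolding fp_def by (intro fpr_if) (auto intro: fpr_subset)
  then show ?thesis unfolding fp_def
    by (rule fpr_cong) (auto split: list.splits)
qed

lemma fp_case_option [fpi]:
  assumes "fp z" "fp f" "fp (\<lambda>p. g (fst p) (snd p))"
  shows "fp (\<lambda>x. case z x of None \<Rightarrow> f x | Some y \<Rightarrow> g x y)"
proof -
  have "fp (\<lambda>x. case z x of None \<Rightarrow> [] | Some y \<Rightarrow> [y])"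
    using assms(1) by (rule fp_coerce) (auto simp: cod_option_def split: option.splits)
  moreover have "fp (\<lambda>p. g (fst p) (fst (snd p)))"
    by (rule fp_comp[OF assms(3), of "\<lambda>p. (fst p, fst (snd p))", simplified]) (intro fpi)
  ultimately have "fp (\<lambda>x. case (case z x of None \<Rightarrow> [] | Some y \<Rightarrow> [y]) of [] \<Rightarrow> f x | y # ys \<Rightarrow> g x y)"
    using assms(2) by (intro fp_case_list) auto
  then show ?thesis by (rule fp_coerce) (auto split: option.splits)
qed

text \<open>The code of the constant is fixed, so by induction on it the comparison unfolds into a
  fixed nest of conditionals.\<close>

lemma fp_eq_const [fpi]:
  assumes "fp f"
  shows "fp (\<lambda>x. f x = c)"
proof -
  have "fpr UNIV A (\<lambda>i. cod (B i = d))" if "fpr UNIV A B" for A B :: "'a \<Rightarrow> dat" and d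
    using that
  proof (induction d arbitrary: B)
    case Nl
    have "fpr UNIV A (\<lambda>i. if B i = Nl then cod True else cod False)"
      using Nl by (intro fpr_if) (auto intro: fpr_const)
    then show ?case by (rule fpr_cong) auto
  next
    case (Cs a b)
    have 1: "fpr UNIV A (\<lambda>i. if cod (hdD (B i) = a) = Nl then cod False else cod (tlD (B i) = b))"
      using Cs.IH(1)[OF fpr_hd[OF Cs.prems]] Cs.IH(2)[OF fpr_tl[OF Cs.prems]]
      by (intro fpr_if) (auto intro: fpr_const fpr_subset)
    have "fpr UNIV A (\<lambda>i. if B i = Nl then cod False
       else if cod (hdD (B i) = a) = Nl then cod False else cod (tlD (B i) = b))"
      by (rule fpr_if[OF Cs.prems fpr_const fpr_subset[OF 1]]) simp
    then show ?case
      by (rule fpr_cong) (case_tac "B i"; auto simp: cod_bool_def)+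
  qed
  from this[OF assms[unfolded fp_def], of "cod c"] show ?thesis
    unfolding fp_def by (rule fpr_cong) (auto dest: cod_inject)
qed

lemma rlen_cod [simp]: "rlen (cod (xs::'a::coded list)) = length xs" "rlen (cod (n::nat)) = n"
  by (induction xs) (auto, induction n, auto)

text \<open>The iterated state consists of the argument, the unread part of the list and the
  accumulator. The first stays constant and the second shrinks, so only the accumulator needs an
  assumed bound.\<close>

lemma fp_fold:
  assumes l: "fp l" and a: "fp a" and g: "fp (\<lambda>p. g (fst p) (fst (snd p)) (snd (snd p)))"
    and b: "pb UNIV esz b"
      "\<And>x j. j \<le> length (l x) \<Longrightarrow> esz (fold (g x) (take j (l x)) (a x)) \<le> b x"
  shows "fp (\<lambda>x. fold (g x) (l x) (a x))"
proof -
  define s where "s = (\<lambda>p. case fst (snd p) of [] \<Rightarrow> p | y # ys \<Rightarrow> (fst p, ys, g (fst p) y (snd (snd p))))"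
  have s: "fp s"
    unfolding s_def
    by (intro fpi fp_comp[OF g, of "\<lambda>p. (fst (fst p), fst (snd p), snd (snd (fst p)))", simplified])
  have sj: "(s ^^ j) (x, ys, z) = (x, drop j ys, fold (g x) (take j ys) z)" for j x ys z
  proof (induction j arbitrary: ys z)
    case (Suc j)
    have "(s ^^ Suc j) (x, ys, z) = (s ^^ j) (s (x, ys, z))" by (simp add: funpow_swap1)
    then show ?case using Suc by (cases ys) (auto simp: s_def)
  qed simp
  have esz_l: "pb UNIV esz (\<lambda>x. esz (l x))" using l by (rule fp_size)
  have m: "esz x \<le> dsz (cod (l x)) + dsz (cod (x, l x, a x))" for x
    by (simp add: esz_def cod_prod_def)
  have "fpr UNIV cod (\<lambda>x. Cs (cod (l x)) (cod (x, l x, a x)))"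
    using fpr_Cs l fp_pair[OF fp_id fp_pair[OF l a]] unfolding fp_def by blast
  moreover have "fpr UNIV (\<lambda>x. Cs (cod (l x)) (cod (x, l x, a x)))
      (\<lambda>x. cod ((s ^^ rlen (cod (l x))) (x, l x, a x)))"
  proof (rule fpr_iter[where J = UNIV and b = "\<lambda>x. 2 + esz x + esz (l x) + b x"])
    show "fpr UNIV cod (\<lambda>y. cod (s y))" using s unfolding fp_def .
    have "pb UNIV esz (\<lambda>x. 2 + esz x + esz (l x) + b x)"
      by (intro pb_intros pb_id esz_l b)
    then show "pb UNIV (\<lambda>x. dsz (cod (l x)) + dsz (cod (x, l x, a x))) (\<lambda>x. 2 + esz x + esz (l x) + b x)"
      by (rule pb_trans[rotated]) (rule pb_mono[OF pb_id], rule m)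
    show "dsz (cod ((s ^^ j) (x, l x, a x))) \<le> 2 + esz x + esz (l x) + b x" if "j \<le> rlen (cod (l x))" for x j
      using b(2)[of j x] esz_drop[of j "l x"] that unfolding sj esz_def[symmetric] by simp
  qed auto
  ultimately have "fp (\<lambda>x. (x, drop (length (l x)) (l x), fold (g x) (take (length (l x)) (l x)) (a x)))"
    unfolding fp_def sj[symmetric] using fpr_comp by fastforce
  from fp_snd[OF fp_snd[OF this]] show ?thesis by simp
qed

lemma fp_rev [fpi]: "fp l \<Longrightarrow> fp (\<lambda>x. rev (l x))"
proof -
  assume l: "fp l"
  have "fp (\<lambda>x. fold (\<lambda>y a. y # a) (l x) [])"
    by (rule fp_fold[where b = "\<lambda>x. esz (l x)"])
      (use l in \<open>auto intro!: fpi fp_size simp: fold_Cons_rev esz_take\<close>)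
  then show ?thesis by (simp add: fold_Cons_rev)
qed

lemma fp_append [fpi]: "fp f \<Longrightarrow> fp g \<Longrightarrow> fp (\<lambda>x. f x @ g x)"
proof -
  assume f: "fp f" and g: "fp g"
  have "fp (\<lambda>x. fold (\<lambda>y a. y # a) (rev (f x)) (g x))"
  proof (rule fp_fold[where b = "\<lambda>x. esz (f x) + esz (g x)"])
    show "esz (fold (\<lambda>y a. y # a) (take j (rev (f x))) (g x)) \<le> esz (f x) + esz (g x)" for j x
      using esz_append[of "rev (take j (rev (f x)))" "g x"] esz_take[of j "rev (f x)"]
      by (simp add: fold_Cons_rev)
  qed (use f g in \<open>auto intro!: fpi fp_size pb_intros\<close>)
  then show ?thesis by (simp add: fold_Cons_rev)
qed

lemma fold_append_concat: "fold (\<lambda>xs a. a @ xs) xss ys = ys @ concat xss"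
  by (induction xss arbitrary: ys) auto

lemma fp_concat [fpi]: "fp l \<Longrightarrow> fp (\<lambda>x. concat (l x))"
proof -
  assume l: "fp l"
  have "fp (\<lambda>x. fold (\<lambda>xs a. a @ xs) (l x) [])"
  proof (rule fp_fold[where b = "\<lambda>x. esz (l x)"])
    show "esz (fold (\<lambda>xs a. a @ xs) (take j (l x)) []) \<le> esz (l x)" for j x
      using esz_le_concat[of "take j (l x)"] esz_take[of j "l x"] by (simp add: fold_append_concat)
  qed (use l in \<open>auto intro!: fpi fp_size\<close>)
  then show ?thesis by (simp add: fold_append_concat)
qed

lemma fold_map_rev: "fold (\<lambda>y a. g y # a) ys a = rev (map g ys) @ a"
  by (induction ys arbitrary: a) auto

lemma fp_map [fpi]:
  assumes "fp l" "fp (\<lambda>p. g (fst p) (snd p))"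
  shows "fp (\<lambda>x. map (\<lambda>y. g x y) (l x))"
proof -
  obtain k where k: "\<And>p. esz (g (fst p) (snd p)) \<le> (esz p + 2) ^ k"
    using fp_size[OF assms(2)] unfolding pb_def by (metis UNIV_I)
  have "fp (\<lambda>x. fold (\<lambda>y a. g x y # a) (l x) [])"
  proof (rule fp_fold[where b = "\<lambda>x. 1 + esz (l x) * ((esz x + esz (l x) + 3) ^ k + 1)"])
    show "fp (\<lambda>p. g (fst p) (fst (snd p)) # snd (snd p))"
      by (intro fpi fp_comp[OF assms(2), of "\<lambda>p. (fst p, fst (snd p))", simplified])
    show "pb UNIV esz (\<lambda>x. 1 + esz (l x) * ((esz x + esz (l x) + 3) ^ k + 1))"
      by (intro pb_intros pb_id fp_size assms)
    show "esz (fold (\<lambda>y a. g x y # a) (take j (l x)) []) \<le> 1 + esz (l x) * ((esz x + esz (l x) + 3) ^ k + 1)"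
      for x j
    proof -
      have "esz (g x y) \<le> (esz x + esz (l x) + 3) ^ k" if "y \<in> set (take j (l x))" for y
      proof -
        have "esz y \<le> esz (l x)" using that by (meson esz_mem in_set_takeD)
        then have "(esz (x, y) + 2) ^ k \<le> (esz x + esz (l x) + 3) ^ k" by (intro power_mono) auto
        then show ?thesis using k[of "(x, y)"] by simp
      qed
      then have "esz (map (g x) (take j (l x))) \<le> 1 + length (take j (l x)) * ((esz x + esz (l x) + 3) ^ k + 1)"
        using esz_list_bound[of "map (g x) (take j (l x))"] by auto
      also have "\<dots> \<le> 1 + esz (l x) * ((esz x + esz (l x) + 3) ^ k + 1)"
        using length_le_esz[of "l x"] by (intro add_mono mult_right_mono) auto
      finally show ?thesis by (simp add: fold_map_rev)
    qed
  qed (use assms in \<open>auto intro: fpi\<close>)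
  from fp_rev[OF this] show ?thesis by (simp add: fold_map_rev)
qed

lemma fp_filter [fpi]:
  assumes "fp l" "fp (\<lambda>p. P (fst p) (snd p))"
  shows "fp (\<lambda>x. filter (\<lambda>y. P x y) (l x))"
proof -
  have "fp (\<lambda>x. concat (map (\<lambda>y. if P x y then [y] else []) (l x)))"
    by (intro fpi assms)
  moreover have "concat (map (\<lambda>y. if P y then [y] else []) ys) = filter P ys" for P :: "'b \<Rightarrow> bool" and ys
    by (induction ys) auto
  ultimately show ?thesis by simp
qed

lemma fp_Ball [fpi]:
  assumes "fp l" "fp (\<lambda>p. P (fst p) (snd p))"
  shows "fp (\<lambda>x. \<forall>y\<in>set (l x). P x y)"
proof -
  have "fp (\<lambda>x. filter (\<lambda>y. \<not> P x y) (l x) = [])"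
    by (intro fpi assms)
  then show ?thesis by (simp add: filter_empty_conv)
qed

lemma fp_Bex [fpi]:
  assumes "fp l" "fp (\<lambda>p. P (fst p) (snd p))"
  shows "fp (\<lambda>x. \<exists>y\<in>set (l x). P x y)"
proof -
  have "fp (\<lambda>x. \<not> (\<forall>y\<in>set (l x). \<not> P x y))"
    by (intro fpi assms)
  then show ?thesis by simp
qed

text \<open>Because numbers are coded as lists of units, arithmetic reduces to lists: sums to
  appending, differences to dropping, comparisons to emptiness of a difference.\<close>

lemma cod_units: "cod (replicate n ()) = cod n" "cod (map (\<lambda>_. ()) xs) = cod (length xs)"
  by (induction n) (auto simp: cod_unit_def, induction xs, auto simp: cod_unit_def)

lemma fp_length [fpi]: "fp l \<Longrightarrow> fp (\<lambda>x. length (l x))"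
  by (rule fp_coerce[OF fp_map[of l "\<lambda>_ _. ()"]]) (auto intro: fp_const simp: cod_units)

lemma fp_units: "fp n \<Longrightarrow> fp (\<lambda>x. replicate (n x) ())"
  by (erule fp_coerce) (simp add: cod_units)

lemma fp_funpow:
  fixes s :: "'a::coded \<Rightarrow> 'b::coded \<Rightarrow> 'b"
  assumes s: "fp (\<lambda>p. s (fst p) (snd p))" and n: "fp n" and a: "fp a" and b: "pb UNIV esz b"
    "\<And>x j. j \<le> n x \<Longrightarrow> esz ((s x ^^ j) (a x)) \<le> b x"
  shows "fp (\<lambda>x. (s x ^^ n x) (a x))"
proof -
  have *: "fold (\<lambda>_. f) xs y = (f ^^ length xs) y" for f :: "'b \<Rightarrow> 'b" and xs :: "unit list" and y
    by (induction xs arbitrary: y) (auto simp: funpow_swap1)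
  have "fp (\<lambda>x. fold (\<lambda>_. s x) (replicate (n x) ()) (a x))"
    by (rule fp_fold[where b = b])
      (use a b fp_units[OF n] fp_comp[OF s fp_pair[OF fp_fst[OF fp_id] fp_snd[OF fp_snd[OF fp_id]]]] in \<open>auto simp: *\<close>)
  then show ?thesis by (simp add: *)
qed

lemma fp_replicate [fpi]: "fp n \<Longrightarrow> fp f \<Longrightarrow> fp (\<lambda>x. replicate (n x) (f x))"
  using fp_map[OF fp_units, of n "\<lambda>x _. f x"] fp_fst_comp[of f] by simp

lemma fp_plus [fpi]: "fp f \<Longrightarrow> fp g \<Longrightarrow> fp (\<lambda>x. f x + g x :: nat)"
  using fp_length[OF fp_append[OF fp_units fp_units], of f g] by simp

lemma fp_mult [fpi]:
  assumes "fp f" "fp g"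
  shows "fp (\<lambda>x. f x * g x :: nat)"
proof -
  have "fp (\<lambda>x. length (concat (map (\<lambda>_. replicate (g x) ()) (replicate (f x) ()))))"
    by (intro fpi fp_units assms fp_fst_comp[OF assms(2)])
  then show ?thesis by (simp add: length_concat sum_list_replicate)
qed

lemma fp_tl [fpi]: "fp l \<Longrightarrow> fp (\<lambda>x. tl (l x))"
  unfolding tl_def by (intro fpi)

lemma funpow_tl: "(tl ^^ n) xs = drop n xs"
  by (induction n) (auto simp: drop_Suc tl_drop)

lemma fp_drop [fpi]: "fp n \<Longrightarrow> fp l \<Longrightarrow> fp (\<lambda>x. drop (n x) (l x))"
  using fp_funpow[of "\<lambda>_. tl" n l "\<lambda>x. esz (l x)"]
  by (simp add: funpow_tl esz_drop fp_size fp_tl fp_snd fp_id)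

lemma fp_take [fpi]:
  assumes "fp n" "fp l"
  shows "fp (\<lambda>x. take (n x) (l x))"
proof -
  have "fp (\<lambda>x. rev (drop (length (drop (n x) (l x))) (rev (l x))))"
    using assms by (intro fpi)
  moreover have "rev (drop (length (drop n l)) (rev l)) = take n l" for n and l :: "'b list"
    by (cases "n \<le> length l") (auto simp: drop_rev)
  ultimately show ?thesis by simp
qed

lemma fp_minus [fpi]: "fp f \<Longrightarrow> fp g \<Longrightarrow> fp (\<lambda>x. f x - g x :: nat)"
  using fp_length[OF fp_drop[OF _ fp_units], of g f] by simp

lemma fp_le [fpi]: "fp f \<Longrightarrow> fp g \<Longrightarrow> fp (\<lambda>x. (f x :: nat) \<le> g x)"
  using fp_eq_const[OF fp_minus, of f g 0] by simp

lemma fp_less [fpi]: "fp f \<Longrightarrow> fp g \<Longrightarrow> fp (\<lambda>x. (f x :: nat) < g x)"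
  using fp_not[OF fp_le, of g f] by (simp add: not_le)

lemma fp_eq_nat [fpi]: "fp f \<Longrightarrow> fp g \<Longrightarrow> fp (\<lambda>x. (f x :: nat) = g x)"
  using fp_conj[OF fp_le fp_le, of f g g f] by (simp add: eq_iff)

lemma fp_eq_bool [fpi]: "fp f \<Longrightarrow> fp g \<Longrightarrow> fp (\<lambda>x. (f x :: bool) = g x)"
  using fp_conj[OF fp_imp fp_imp, of f g g f] by (simp add: iff_conv_conj_imp)

lemma funpow_upt: "((\<lambda>a. length a # a) ^^ n) [] = rev [0..<n]"
  by (induction n) auto

lemma fp_upt [fpi]:
  assumes "fp m" "fp n"
  shows "fp (\<lambda>x. [m x..<n x])"
proof -
  have *: "fp (\<lambda>x. [0..<n x])" if n: "fp n" for n :: "'a \<Rightarrow> nat"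
  proof -
    have "fp (\<lambda>x. ((\<lambda>a. length a # a) ^^ n x) [])"
    proof (rule fp_funpow[where b = "\<lambda>x. 1 + esz (n x) * (esz (n x) + 1)"])
      show "pb UNIV esz (\<lambda>x. 1 + esz (n x) * (esz (n x) + 1))"
        by (intro pb_intros fp_size n)
      show "esz (((\<lambda>a. length a # a) ^^ j) []) \<le> 1 + esz (n x) * (esz (n x) + 1)" if "j \<le> n x" for j x
      proof -
        have "esz [0..<j] \<le> 1 + length [0..<j] * (esz (n x) + 1)"
          using that by (intro esz_list_bound) (auto simp: esz_nat)
        also have "\<dots> \<le> 1 + esz (n x) * (esz (n x) + 1)"
          using that by (intro add_mono mult_right_mono) (auto simp: esz_nat)
        finally show ?thesis by (simp add: funpow_upt)
      qed
    qed (intro fpi n)+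
    from fp_rev[OF this] show ?thesis by (simp add: funpow_upt)
  qed
  have "fp (\<lambda>x. map (\<lambda>i. i + m x) [0..<n x - m x])"
    by (intro fpi * assms fp_fst_comp[OF assms(1)])
  moreover have "map (\<lambda>i. i + m) [0..<n - m] = [m..<n]" for m n
    by (cases "m \<le> n") (auto simp: map_add_upt)
  ultimately show ?thesis by simp
qed

text \<open>Access made total: \<open>xs ! i\<close> is unspecified beyond the end, whereas a
  computed function needs a definite value on every argument.\<close>

definition nthd :: "'a \<Rightarrow> 'a list \<Rightarrow> nat \<Rightarrow> 'a" where
  "nthd d xs i = (if i < length xs then xs ! i else d)"

lemma fp_nthd [fpi]:
  assumes "fp l" "fp n"
  shows "fp (\<lambda>x. nthd d (l x) (n x))"
proof -
  have "fp (\<lambda>x. case drop (n x) (l x) of [] \<Rightarrow> d | y # ys \<Rightarrow> y)"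
    using assms by (intro fpi)
  moreover have "(case drop n l of [] \<Rightarrow> d | y # ys \<Rightarrow> y) = nthd d l n" for n l
    by (auto simp: nthd_def split: list.splits)
      (metis drop_eq_Nil hd_drop_conv_nth leI list.sel(1) not_Cons_self2)
  ultimately show ?thesis by simp
qed

lemma fp_sum_list [fpi]: "fp l \<Longrightarrow> fp (\<lambda>x. sum_list (l x) :: nat)"
proof -
  assume "fp l"
  then have "fp (\<lambda>x. length (concat (map (\<lambda>n. replicate n ()) (l x))))"
    by (intro fpi fp_units)
  moreover have "length (concat (map (\<lambda>n. replicate n ()) ns)) = sum_list ns" for ns
    by (induction ns) auto
  ultimately show ?thesis by simp
qed

lemma fp_poly [fpi]: "fp f \<Longrightarrow> fp (\<lambda>x. poly p (f x) :: nat)"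
  by (induction p) (auto intro!: fpi)

lemma fp_map_const: "(\<And>v. v \<in> set V \<Longrightarrow> fp (g v)) \<Longrightarrow> fp (\<lambda>x. map (\<lambda>v. g v x) V)"
  by (induction V) (auto intro!: fpi)

lemma fp_distinct [fpi]:
  assumes "fp l"
  shows "fp (\<lambda>x. distinct (l x :: nat list))"
proof -
  have "fp (\<lambda>x. \<forall>a\<in>set (l x). length (filter (\<lambda>y. y = a) (l x)) \<le> 1)"
    by (intro fpi assms fp_fst_comp[OF assms])
  moreover have "(\<forall>a\<in>set xs. length (filter (\<lambda>y. y = a) xs) \<le> 1) = distinct xs" for xs :: "nat list"
  proof (induction xs)
    case (Cons a xs)
    have "length (filter (\<lambda>y. y = a) (a # xs)) \<le> 1 \<longleftrightarrow> a \<notin> set xs"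
      by (auto simp: filter_empty_conv)
    then show ?case using Cons by (auto split: if_splits) 
  qed simp
  ultimately show ?thesis by simp
qed

section \<open>From encodable types to Turing machines\<close>

abbreviation bit_sym :: "bool \<Rightarrow> nat" where
  "bit_sym b \<equiv> if b then 2 else 1"

text \<open>The code of a list is built from its end, and pouring the input to stack 2 first
  presents the bits in this order. Symbol 1 is the empty list; the pushes spell, from the back,
  \<open>2 2 1 1\<close> for a cell with \<open>True\<close> and \<open>2 1\<close> for a cell with
  \<open>False\<close>.\<close>

definition load :: cmd where
  "load = pour 0 2 ;; Push 1 1 ;; While 2 (\<lambda>s. s \<noteq> 0)
     (If 2 (\<lambda>s. s = 2) (Pop 2 ;; Push 1 1 ;; Push 1 1 ;; Push 1 2 ;; Push 1 2)
                       (Pop 2 ;; Push 1 1 ;; Push 1 2))"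

definition unload :: cmd where
  "unload = While 1 (\<lambda>s. s = 2)
     (Pop 1 ;; If 1 (\<lambda>s. s = 2) (Pop 1 ;; Pop 1 ;; Pop 1 ;; Out 2) (Pop 1 ;; Out 1))"

lemma str_cod_bool: "str (cod b) = (if b then [2, 1, 1] else [1])"
  by (simp add: cod_bool_def)

lemma runs_load:
  "runs load ((\<lambda>_. [])(0 := map bit_sym x)) (stk (str (cod x)) [] []) (5 + 17 * length x)"
proof -
  let ?c = "If 2 (\<lambda>s. s = 2) (Pop 2 ;; Push 1 1 ;; Push 1 1 ;; Push 1 2 ;; Push 1 2)
                       (Pop 2 ;; Push 1 1 ;; Push 1 2)"
  have *: "runs (While 2 (\<lambda>s. s \<noteq> 0) ?c) (stk (str (cod ys)) (map bit_sym xs) [])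
      (stk (str (cod (rev xs @ ys))) [] []) (1 + 11 * length xs)" for xs ys
  proof (induction xs arbitrary: ys)
    case Nil
    show ?case by (rule runs_WhileF) auto
  next
    case (Cons b xs)
    let ?s = "stk (str (cod ys)) (map bit_sym (b # xs)) []"
    let ?s' = "stk (str (cod (b # ys))) (map bit_sym xs) []"
    have "runs (if b then Pop 2 ;; Push 1 1 ;; Push 1 1 ;; Push 1 2 ;; Push 1 2 else Pop 2 ;; Push 1 1 ;; Push 1 2)
       ?s ?s' 9"
    proof (cases b)
      case True
      have "runs (Pop 2 ;; Push 1 1 ;; Push 1 1 ;; Push 1 2 ;; Push 1 2) ?s ?s' (1 + (2 + (2 + (2 + 2))))"
        using True by (intro runs_Seq[OF runs_Pop] runs_Seq[OF runs_Push] runs_Push') (simp add: str_cod_bool)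
      then show ?thesis using True by simp
    next
      case False
      have "runs (Pop 2 ;; Push 1 1 ;; Push 1 2) ?s ?s' (1 + (2 + 2))"
        using False by (intro runs_Seq[OF runs_Pop] runs_Seq[OF runs_Push] runs_Push') (simp add: str_cod_bool)
      from runs_mono[OF this, of 9] show ?thesis using False by simp
    qed
    then have 1: "runs ?c ?s ?s' (Suc 9)" by (intro runs_If) (cases b; simp)
    have eq: "rev (b # xs) @ ys = rev xs @ b # ys" by simp
    show ?case unfolding eq by (rule runs_WhileT[OF _ 1 Cons.IH]) (cases b; simp)+
  qed
  let ?\<sigma> = "(\<lambda>_. [])(0 := map bit_sym x) :: nat \<Rightarrow> nat list"
  have 1: "runs (pour 0 2) ?\<sigma> (stk [] (rev (map bit_sym x)) []) (1 + 6 * length (?\<sigma> 0))"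
    by (rule runs_pour) (auto simp: stk_def fun_eq_iff)
  have 2: "runs (Push 1 1) (stk [] (rev (map bit_sym x)) []) (stk (str (cod ([] :: bool list))) (map bit_sym (rev x)) []) 2"
    by (rule runs_Push') (simp add: rev_map)
  show ?thesis unfolding load_def
    using runs_mono[OF runs_Seq[OF 1 runs_Seq[OF 2 *[of "[]" "rev x"]]], of "5 + 17 * length x"] by simp
qed

lemma runs_unload:
  "\<sigma> 1 = str (cod ys) \<Longrightarrow> \<sigma> 5 = os \<Longrightarrow>
    runs unload \<sigma> (\<sigma>(1 := [1], 5 := os @ map bit_sym ys)) (1 + 7 * length ys)"
proof (induction ys arbitrary: \<sigma> os)
  case Nil
  then show ?case unfolding unload_def by (intro runs_WhileF) (auto simp: fun_eq_iff)
next
  case (Cons b ys)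
  let ?c = "If 1 (\<lambda>s. s = 2) (Pop 1 ;; Pop 1 ;; Pop 1 ;; Out 2) (Pop 1 ;; Out 1)"
  let ?\<sigma> = "\<sigma>(1 := str (cod ys), 5 := os @ [bit_sym b])"
  let ?\<sigma>1 = "\<sigma>(1 := str (cod b) @ str (cod ys))"
  have out: "runs (Out s) \<tau> \<tau>' 1" if "\<tau>(5 := \<tau> 5 @ [s]) = \<tau>'" for s \<tau> \<tau>'
    using runs_Out[of s \<tau>] that by simp
  have "runs ?c ?\<sigma>1 ?\<sigma> (Suc 4)"
  proof (rule runs_If, cases b)
    case True
    have "runs (Pop 1 ;; Pop 1 ;; Pop 1 ;; Out 2) ?\<sigma>1 ?\<sigma> (1 + (1 + (1 + 1)))"
      using True Cons.prems by (intro runs_Seq[OF runs_Pop] out) (auto simp: str_cod_bool fun_eq_iff)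
    from runs_mono[OF this, of 4] show "runs (if top (?\<sigma>1 1) = 2 then Pop 1 ;; Pop 1 ;; Pop 1 ;; Out 2 else Pop 1 ;; Out 1) ?\<sigma>1 ?\<sigma> 4"
      using True by (simp add: str_cod_bool)
  next
    case False
    have "runs (Pop 1 ;; Out 1) ?\<sigma>1 ?\<sigma> (1 + 1)"
      using False Cons.prems by (intro runs_Seq[OF runs_Pop] out) (auto simp: str_cod_bool fun_eq_iff)
    from runs_mono[OF this, of 4] show "runs (if top (?\<sigma>1 1) = 2 then Pop 1 ;; Pop 1 ;; Pop 1 ;; Out 2 else Pop 1 ;; Out 1) ?\<sigma>1 ?\<sigma> 4"
      using False by (simp add: str_cod_bool)
  qed
  moreover have "runs (Pop 1) \<sigma> ?\<sigma>1 1"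
    using Cons.prems by (intro runs_Pop') simp
  ultimately have 1: "runs (Pop 1 ;; ?c) \<sigma> ?\<sigma> (1 + Suc 4)" by (rule runs_Seq[rotated])
  have eq: "?\<sigma>(1 := [1], 5 := (os @ [bit_sym b]) @ map bit_sym ys) = \<sigma>(1 := [1], 5 := os @ map bit_sym (b # ys))"
    by (auto simp: fun_eq_iff)
  have 2: "runs unload ?\<sigma> (\<sigma>(1 := [1], 5 := os @ map bit_sym (b # ys))) (1 + 7 * length ys)"
    unfolding eq[symmetric] by (rule Cons.IH) auto
  show ?case unfolding unload_def
    by (rule runs_WhileT[OF _ 1 2[unfolded unload_def]]) (use Cons.prems in auto)
qed

lemma esz_bools: "esz (x :: bool list) \<le> 1 + 4 * length x"
proof (induction x)
  case (Cons b x)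
  then show ?case by (cases b) auto
qed simp

lemma fp_polytime:
  fixes f :: "bool list \<Rightarrow> bool list"
  assumes "fp f"
  shows "polytime f"
proof -
  obtain c T where c: "wf_cmd c" "pb UNIV esz T"
    "\<And>x r. runs c (stk (str (cod x) @ r) [] []) (stk (str (cod (f x)) @ r) [] []) (T x)"
    using assms unfolding fp_def esz_def by (rule fprE) auto
  let ?T = "\<lambda>x. (5 + 17 * length x) + (T x + (1 + 7 * length (f x)))"
  have len: "pb UNIV esz (\<lambda>x. length (x :: bool list))" "pb UNIV esz (\<lambda>x. length (f x))"
    using fp_size[OF fp_id] fp_size[OF assms] length_le_esz by (blast intro: pb_mono)+
  have "pb UNIV esz ?T" by (intro pb_intros c(2) len)
  then obtain k where k: "\<And>x. ?T x \<le> (esz x + 2) ^ k" unfolding pb_def by blast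
  \<comment> \<open>A bit contributes at most 4 symbols to the code and the end of the list 1, hence
    \<open>esz x + 2 \<le> 3 + 4 * length x\<close>.\<close>
  have p: "?T x \<le> poly ([:3, 4:] ^ k) (length x)" for x
  proof -
    have "?T x \<le> (esz x + 2) ^ k" by (rule k)
    also have "\<dots> \<le> (3 + 4 * length x) ^ k"
      using esz_bools[of x] by (intro power_mono) auto
    also have "\<dots> = poly ([:3, 4:] ^ k) (length x)"
      by (simp add: mult.commute)
    finally show ?thesis .
  qed
  show ?thesis
  proof (rule polytimeI[of "load ;; c ;; unload"])
    show "wf_cmd (load ;; c ;; unload)" using c(1) by (simp add: load_def unload_def)
    fix x
    let ?s = "stk (str (cod (f x))) [] []"
    have r: "runs (load ;; c ;; unload) ((\<lambda>_. [])(0 := map bit_sym x)) (?s(1 := [1], 5 := map bit_sym (f x))) (?T x)"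
    proof (rule runs_Seq[OF runs_load runs_Seq])
      show "runs c (stk (str (cod x)) [] []) ?s (T x)" using c(3)[of x "[]"] by simp
      show "runs unload ?s (?s(1 := [1], 5 := map bit_sym (f x))) (1 + 7 * length (f x))"
        using runs_unload[of ?s "f x" "[]"] by (simp add: stk_def)
    qed
    show "\<exists>\<sigma>'. \<exists>t\<le>poly ([:3, 4:] ^ k) (length x).
        exec (load ;; c ;; unload) ((\<lambda>_. [])(0 := map bit_sym x)) \<sigma>' t \<and> \<sigma>' 5 = map bit_sym (f x)"
    proof -
      from r obtain t where "t \<le> ?T x"
        "exec (load ;; c ;; unload) ((\<lambda>_. [])(0 := map bit_sym x)) (?s(1 := [1], 5 := map bit_sym (f x))) t"
        unfolding runs_def by blast
      then show ?thesis
        using le_trans[OF _ p] by (intro exI[of _ "?s(1 := [1], 5 := map bit_sym (f x))"] exI[of _ t]) auto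
    qed
  qed
qed

lemma fp_PTIME: "fp (\<lambda>x. x \<in> A) \<Longrightarrow> A \<in> PTIME"
  unfolding PTIME_def by (simp add: fp_polytime fp_Cons fp_const)

section \<open>Parsing the input\<close>

text \<open>An entry is the path to a node together with the label of the node if it is a leaf.\<close>

type_synonym entry = "(nat \<times> bool) list \<times> bool option"

primrec entries :: "(nat \<times> bool) list \<Rightarrow> dtree \<Rightarrow> entry list" where
  "entries p (Leaf b) = [(p, Some b)]"
| "entries p (Branch i t0 t1) = (p, None) # entries (p @ [(i, False)]) t0 @ entries (p @ [(i, True)]) t1"

fun leaf_label :: "dtree \<Rightarrow> bool option" where
  "leaf_label (Leaf b) = Some b"
| "leaf_label (Branch i t0 t1) = None"

lemma leaf_label_Some [simp]: "leaf_label u = Some b \<longleftrightarrow> u = Leaf b"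
  by (cases u) auto

lemma entries_iff:
  "(q, k) \<in> set (entries p t) \<longleftrightarrow> (\<exists>ps u. q = p @ ps \<and> path_to t ps u \<and> leaf_label u = k)"
proof (induction t arbitrary: p)
  case (Leaf b)
  have "path_to (Leaf b) ps u \<longleftrightarrow> ps = [] \<and> u = Leaf b" for ps u
    by (subst path_to.simps) auto
  then show ?case by auto
next
  case (Branch i t0 t1)
  have "path_to (Branch i t0 t1) ps u \<longleftrightarrow> ps = [] \<and> u = Branch i t0 t1 \<or>
      (\<exists>qs. ps = (i, False) # qs \<and> path_to t0 qs u) \<or> (\<exists>qs. ps = (i, True) # qs \<and> path_to t1 qs u)" for ps u
    by (subst path_to.simps) auto
  then show ?case using Branch by fastforce
qed

type_synonym parse_state = "bool list \<times> (nat \<times> bool) list list \<times> entry list"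

text \<open>
  A parser state consists of the remaining input, the paths to the nodes whose subtrees are still
  to be read, and the entries found so far.  Every step reads one node.
\<close>

definition tree_step :: "parse_state \<Rightarrow> parse_state" where
  "tree_step z = (case fst (snd z) of [] \<Rightarrow> z | p # ps \<Rightarrow>
     (case fst z of [] \<Rightarrow> z | c # r \<Rightarrow>
        if c then (drop (Suc (length (takeWhile id r))) r,
          (p @ [(length (takeWhile id r), False)]) # (p @ [(length (takeWhile id r), True)]) # ps,
          snd (snd z) @ [(p, None)])
        else (case r of [] \<Rightarrow> z | b # r' \<Rightarrow> (r', ps, snd (snd z) @ [(p, Some b)]))))"

lemma takeWhile_unary: "takeWhile id (replicate k True @ False # r) = replicate k True"
  by (induction k) auto

lemma tree_step_Leaf: "tree_step (enc_tree (Leaf b) @ r, p # ps, out) = (r, ps, out @ [(p, Some b)])"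
  by (simp add: tree_step_def)

lemma tree_step_Branch:
  "tree_step (enc_tree (Branch i t0 t1) @ r, p # ps, out) =
    (enc_tree t0 @ enc_tree t1 @ r, (p @ [(i, False)]) # (p @ [(i, True)]) # ps, out @ [(p, None)])"
  by (simp add: tree_step_def enc_nat_def takeWhile_unary)

lemma tree_step_done: "(tree_step ^^ m) (r, [], out) = (r, [], out)"
  by (induction m) (auto simp: tree_step_def)

primrec tsize :: "dtree \<Rightarrow> nat" where
  "tsize (Leaf b) = 1"
| "tsize (Branch i t0 t1) = Suc (tsize t0 + tsize t1)"

lemma tsize_le: "tsize t \<le> length (enc_tree t)"
  by (induction t) auto

lemma tree_steps:
  "(tree_step ^^ tsize t) (enc_tree t @ r, p # ps, out) = (r, ps, out @ entries p t)"
proof (induction t arbitrary: r p ps out)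
  case (Leaf b)
  then show ?case using tree_step_Leaf[of b r p ps out] by simp
next
  case (Branch i t0 t1)
  have "tsize (Branch i t0 t1) = Suc (tsize t1 + tsize t0)" by simp
  then show ?case
    by (simp only: funpow_Suc_right funpow_add o_apply tree_step_Branch Branch entries.simps
        append_assoc append_Cons append_Nil)
qed

text \<open>Arbitrary pending lists are needed because a branch node trades one pending path for
  two. A parser that is stuck idles with a nonempty pending list, so reaching the empty list
  certifies a well-formed prefix.\<close>

lemma tree_steps_sound:
  "(tree_step ^^ m) (r, pend, out) = (r', [], out') \<Longrightarrow>
    \<exists>ts. length ts = length pend \<and> r = concat (map enc_tree ts) @ r' \<and>
      out' = out @ concat (map2 entries pend ts)"
proof (induction m arbitrary: r pend out)
  case 0
  then show ?case by simp
next
  case (Suc m)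
  have *: "(tree_step ^^ m) (tree_step (r, pend, out)) = (r', [], out')"
    using Suc.prems by (simp add: funpow_swap1)
  show ?case
  proof (cases "tree_step (r, pend, out) = (r, pend, out)")
    case True
    then show ?thesis using * Suc.IH by simp
  next
    case False
    then obtain p ps c r1 where r: "pend = p # ps" "r = c # r1"
      by (auto simp: tree_step_def split: list.splits)
    show ?thesis
    proof (cases c)
      case True
      define k where "k = length (takeWhile id r1)"
      have "(tree_step ^^ m) (drop (Suc k) r1, (p @ [(k, False)]) # (p @ [(k, True)]) # ps, out @ [(p, None)]) = (r', [], out')"
        using * True by (simp add: r tree_step_def k_def)
      from Suc.IH[OF this] obtain t0 t1 ts where ts: "length ts = length ps"
        "drop (Suc k) r1 = concat (map enc_tree (t0 # t1 # ts)) @ r'"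
        "out' = out @ [(p, None)] @ entries (p @ [(k, False)]) t0 @ entries (p @ [(k, True)]) t1 @ concat (map2 entries ps ts)"
        by (auto simp: length_Suc_conv)
      \<comment> \<open>A unary number without terminator would use up the input, but two subtrees
        are still to be read and their codes are nonempty.\<close>
      have "enc_tree t0 \<noteq> []" by (cases t0) auto
      then have "drop (Suc k) r1 \<noteq> []" using ts(2) by auto
      then have k: "k < length r1" by (auto simp: not_le)
      then have "r1 = takeWhile id r1 @ r1 ! k # drop (Suc k) r1"
        unfolding k_def by (metis Cons_nth_drop_Suc takeWhile_dropWhile_id dropWhile_eq_drop)
      moreover have "takeWhile id r1 = replicate k True"
        unfolding k_def by (metis (full_types) replicate_length_same set_takeWhileD id_apply)
      moreover have "\<not> r1 ! k" using k nth_length_takeWhile[of id r1] by (simp add: k_def)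
      ultimately have "r = enc_tree (Branch k t0 t1) @ concat (map enc_tree ts) @ r'"
        using ts(2) True r(2) by (simp add: enc_nat_def)
      then show ?thesis using ts r
        by (intro exI[of _ "Branch k t0 t1 # ts"]) simp
    next
      case c: False
      then obtain b r2 where r1: "r1 = b # r2" using False r by (auto simp: tree_step_def split: list.splits)
      have "(tree_step ^^ m) (r2, ps, out @ [(p, Some b)]) = (r', [], out')"
        using * c by (simp add: r r1 tree_step_def)
      from Suc.IH[OF this] obtain ts where "length ts = length ps" "r2 = concat (map enc_tree ts) @ r'"
        "out' = out @ [(p, Some b)] @ concat (map2 entries ps ts)" by auto
      then show ?thesis using r r1 c by (intro exI[of _ "Leaf b # ts"]) simp
    qed
  qed
qed

text \<open>Turns the search for the first failure into a filter over positions with a bounded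
  quantifier, both of which are covered by the closure properties.\<close>

lemma takeWhile_length_filter:
  "length (takeWhile P xs) = length (filter (\<lambda>i. \<forall>y\<in>set (take (Suc i) xs). P y) [0..<length xs])"
proof (induction xs)
  case (Cons x xs)
  have "[0..<length (x # xs)] = 0 # map Suc [0..<length xs]"
    by (simp add: map_Suc_upt upt_conv_Cons del: upt_Suc)
  then show ?case using Cons by (auto simp: filter_map o_def)
qed simp

lemma fp_takeWhile_length [fpi]:
  assumes "fp l"
  shows "fp (\<lambda>x. length (takeWhile id (l x)))"
  unfolding takeWhile_length_filter id_apply
  by (intro fpi assms fp_fst_comp[OF assms])

lemma fp_tree_step: "fp tree_step"
proof -
  have "fp (\<lambda>z. tree_step z)" unfolding tree_step_def by (intro fpi)
  then show ?thesis by simp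
qed

text \<open>The invariant behind the size bound of the parser: per step a path gains at most one
  entry and the pending list at most one path, and a feature read in unary never exceeds the input
  length \<open>L\<close>.\<close>

definition state_bound :: "nat \<Rightarrow> nat \<Rightarrow> parse_state \<Rightarrow> bool" where
  "state_bound L j z \<longleftrightarrow> length (fst z) \<le> L \<and> length (fst (snd z)) \<le> Suc j \<and> length (snd (snd z)) \<le> j \<and>
     (\<forall>p\<in>set (fst (snd z)) \<union> fst ` set (snd (snd z)). length p \<le> j \<and> (\<forall>q\<in>set p. fst q \<le> L))"

lemma state_bound_step: "state_bound L j z \<Longrightarrow> state_bound L (Suc j) (tree_step z)"
proof -
  assume z: "state_bound L j z"
  have "length (takeWhile id r) \<le> L" if "fst z = c # r" for c r
    using z that length_takeWhile_le[of id r] by (auto simp: state_bound_def)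
  then show ?thesis using z
    unfolding tree_step_def state_bound_def
    by (auto split: list.splits simp: le_SucI)
qed

lemma esz_bool: "esz (b :: bool) \<le> 3"
  by (cases b) auto

lemma esz_option_bool: "esz (v :: bool option) \<le> 5"
  by (cases v) (auto simp: esz_bool[THEN le_trans])

lemma esz_state:
  assumes "state_bound L j z"
  shows "esz z \<le> 2 + (1 + L * 4) + (1 + Suc j * (2 + j * (2 * L + 6))) + (1 + j * (8 + j * (2 * L + 6)))"
proof -
  have path: "esz p \<le> 1 + j * (2 * L + 6)" if "p \<in> set (fst (snd z)) \<union> fst ` set (snd (snd z))" for p
  proof -
    have "esz q \<le> 2 * L + 5" if q: "q \<in> set p" for q
    proof -
      have "fst q \<le> L" using assms \<open>p \<in> _\<close> q by (auto simp: state_bound_def)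
      then show ?thesis using esz_bool[of "snd q"] by (cases q) (simp add: esz_nat)
    qed
    then have "esz p \<le> 1 + length p * (2 * L + 5 + 1)" by (rule esz_list_bound)
    also have "\<dots> \<le> 1 + j * (2 * L + 5 + 1)"
      using that assms by (intro add_mono mult_right_mono) (auto simp: state_bound_def)
    also have "\<dots> = 1 + j * (2 * L + 6)" by simp
    finally show ?thesis .
  qed
  have "esz (fst z) \<le> 1 + length (fst z) * (3 + 1)" by (rule esz_list_bound) (rule esz_bool)
  also have "\<dots> \<le> 1 + L * 4" using assms by (simp add: state_bound_def)
  finally have 1: "esz (fst z) \<le> 1 + L * 4" .
  have "esz (fst (snd z)) \<le> 1 + length (fst (snd z)) * (1 + j * (2 * L + 6) + 1)"
    by (rule esz_list_bound) (use path in blast)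
  also have "\<dots> \<le> 1 + Suc j * (1 + j * (2 * L + 6) + 1)"
    using assms by (intro add_mono mult_right_mono) (auto simp: state_bound_def)
  finally have 2: "esz (fst (snd z)) \<le> 1 + Suc j * (2 + j * (2 * L + 6))" by simp
  have "esz (snd (snd z)) \<le> 1 + length (snd (snd z)) * (7 + j * (2 * L + 6) + 1)"
  proof (rule esz_list_bound)
    fix e assume "e \<in> set (snd (snd z))"
    then have "esz (fst e) \<le> 1 + j * (2 * L + 6)" by (intro path) blast
    then show "esz e \<le> 7 + j * (2 * L + 6)"
      using esz_option_bool[of "snd e"] by (cases e) simp
  qed
  also have "\<dots> \<le> 1 + j * (7 + j * (2 * L + 6) + 1)"
    using assms by (intro add_mono mult_right_mono) (auto simp: state_bound_def)
  finally have 3: "esz (snd (snd z)) \<le> 1 + j * (8 + j * (2 * L + 6))" by simp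
  have "esz z = 2 + esz (fst z) + esz (fst (snd z)) + esz (snd (snd z))"
    by (cases z) auto
  then show ?thesis using 1 2 3 by linarith
qed

lemma fp_tree_steps:
  assumes "fp r"
  shows "fp (\<lambda>x. (tree_step ^^ length (r x)) (r x, [[]], []))"
proof (rule fp_funpow)
  show "fp (\<lambda>p. tree_step (snd p))" by (rule fp_comp[OF fp_tree_step]) (intro fpi)
  have sb: "state_bound (length (r x)) j ((tree_step ^^ j) (r x, [[]], []))" for x j
    by (induction j) (auto simp: state_bound_step, simp add: state_bound_def)
  let ?b = "\<lambda>L. 2 + (1 + L * 4) + (1 + Suc L * (2 + L * (2 * L + 6))) + (1 + L * (8 + L * (2 * L + 6)))"
  show "pb UNIV esz (\<lambda>x. ?b (length (r x)))"
    by (intro pb_intros pb_mono[OF fp_size[OF assms] length_le_esz])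
  show "esz ((tree_step ^^ j) (r x, [[]], [])) \<le> ?b (length (r x))" if "j \<le> length (r x)" for x j
  proof (rule le_trans[OF esz_state[OF sb]])
    show "2 + (1 + length (r x) * 4) + (1 + Suc j * (2 + j * (2 * length (r x) + 6))) +
        (1 + j * (8 + j * (2 * length (r x) + 6))) \<le> ?b (length (r x))"
      using that by (intro add_mono mult_mono order.refl) auto
  qed
qed (intro fpi assms)+

section \<open>Reading the values of the partial instances\<close>

definition val_step :: "bool \<Rightarrow> bool \<times> bool option list \<Rightarrow> bool \<times> bool option list" where
  "val_step c z = (if fst z then (False, snd z @ [Some c])
     else if c then (True, snd z) else (False, snd z @ [None]))"

lemma val_step_simps:
  "val_step c (True, a) = (False, a @ [Some c])"
  "val_step c (False, a) = (if c then (True, a) else (False, a @ [None]))"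
  by (simp_all add: val_step_def)

lemma val_steps: "fold val_step (concat (map enc_val vs)) (False, a) = (False, a @ vs)"
proof (induction vs arbitrary: a)
  case (Cons v vs)
  then show ?case by (cases v) (auto simp: val_step_simps)
qed simp

text \<open>The flag is set exactly between the two bits of a defined value, so ending with a
  cleared flag means that only complete values were read. A value may take two bits, hence the
  induction on the length.\<close>

lemma val_steps_sound:
  "fold val_step r (False, a) = (False, a') \<Longrightarrow> \<exists>vs. r = concat (map enc_val vs) \<and> a' = a @ vs"
proof (induction r arbitrary: a rule: length_induct)
  case (1 r)
  show ?case
  proof (cases r)
    case Nil
    then show ?thesis using 1 by (intro exI[of _ "[]"]) simp
  next
    case (Cons c s)
    show ?thesis
    proof (cases c)
      case False
      then have "fold val_step s (False, a @ [None]) = (False, a')" "length s < length r"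
        using 1(2) Cons by (auto simp: val_step_simps)
      then obtain vs where "s = concat (map enc_val vs)" "a' = (a @ [None]) @ vs"
        using 1(1) by blast
      then show ?thesis using Cons False by (intro exI[of _ "None # vs"]) simp
    next
      case True
      then obtain b s' where s: "s = b # s'" using 1 Cons by (cases s) (auto simp: val_step_simps)
      then have "fold val_step s' (False, a @ [Some b]) = (False, a')" "length s' < length r"
        using 1(2) Cons True by (auto simp: val_step_simps)
      then obtain vs where "s' = concat (map enc_val vs)" "a' = (a @ [Some b]) @ vs"
        using 1(1) by blast
      then show ?thesis using Cons True s by (intro exI[of _ "Some b # vs"]) simp
    qed
  qed
qed

lemma fp_val_steps:
  assumes "fp r"
  shows "fp (\<lambda>x. fold val_step (r x) (False, []))"
proof (rule fp_fold)
  show "fp (\<lambda>p. val_step (fst (snd p)) (snd (snd p)))" unfolding val_step_def by (intro fpi)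
  show "pb UNIV esz (\<lambda>x. 5 + 6 * length (r x))"
    by (intro pb_intros pb_mono[OF fp_size[OF assms] length_le_esz])
  have "length (snd (fold val_step s z)) \<le> length (snd z) + length s" for s z
  proof (induction s arbitrary: z)
    case (Cons c s)
    have "length (snd (val_step c z)) \<le> Suc (length (snd z))" by (simp add: val_step_def)
    then show ?case using Cons[of "val_step c z"] by simp
  qed simp
  then have *: "length (snd (fold val_step s (False, []))) \<le> length s" for s
    by (metis add_0 list.size(3) snd_conv)
  show "esz (fold val_step (take j (r x)) (False, [])) \<le> 5 + 6 * length (r x)" if "j \<le> length (r x)" for j x
  proof -
    let ?z = "fold val_step (take j (r x)) (False, [])"
    have "esz (snd ?z) \<le> 1 + length (snd ?z) * (5 + 1)"
      by (rule esz_list_bound) (rule esz_option_bool)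
    also have "\<dots> \<le> 1 + length (r x) * 6"
      using *[of "take j (r x)"] that by simp
    finally show ?thesis using esz_bool[of "fst ?z"] by (cases ?z) auto
  qed
qed (intro fpi assms)+

text \<open>The result of parsing: dimension, entries of the tree, concatenated instances, and validity.\<close>

definition parse :: "nat \<Rightarrow> bool list \<Rightarrow> nat \<times> entry list \<times> bool option list \<times> bool" where
  "parse m x = (let n = length (takeWhile id x); r = drop (Suc n) x;
      z = (tree_step ^^ length r) (r, [[]], []); v = fold val_step (fst z) (False, []) in
    (n, snd (snd z), snd v, n < length x \<and> fst (snd z) = [] \<and> \<not> fst v \<and> length (snd v) = m * n \<and>
      (\<forall>e\<in>set (snd (snd z)). snd e = None \<or>
         distinct (map fst (fst e)) \<and> (\<forall>q\<in>set (fst e). fst q < n))))"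

definition valid_input :: "nat \<Rightarrow> nat \<Rightarrow> dtree \<Rightarrow> pinst list \<Rightarrow> bool" where
  "valid_input m n t es \<longleftrightarrow> decision_tree n t \<and> length es = m \<and> (\<forall>e\<in>set es. length e = n)"

lemma decision_tree_entries:
  "decision_tree n t \<longleftrightarrow> (\<forall>e\<in>set (entries [] t). snd e = None \<or>
     distinct (map fst (fst e)) \<and> (\<forall>q\<in>set (fst e). fst q < n))"
  unfolding decision_tree_def
proof (intro iffI ballI allI impI)
  fix e assume "\<forall>ps b. path_to t ps (Leaf b) \<longrightarrow> distinct (map fst ps) \<and> fst ` set ps \<subseteq> {..<n}"
    "e \<in> set (entries [] t)"
  then show "snd e = None \<or> distinct (map fst (fst e)) \<and> (\<forall>q\<in>set (fst e). fst q < n)"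
    using entries_iff[of "fst e" "snd e" "[]" t] by (cases e; cases "snd e") auto
next
  fix ps b assume "\<forall>e\<in>set (entries [] t). snd e = None \<or>
     distinct (map fst (fst e)) \<and> (\<forall>q\<in>set (fst e). fst q < n)" "path_to t ps (Leaf b)"
  then show "distinct (map fst ps) \<and> fst ` set ps \<subseteq> {..<n}"
    using entries_iff[of ps "Some b" "[]" t] by fastforce
qed

lemma concat_enc_inst: "concat (map enc_inst es) = concat (map enc_val (concat es))"
  by (induction es) (auto simp: enc_inst_def)

lemma length_concat_blocks: "(\<forall>e\<in>set es. length e = n) \<Longrightarrow> length (concat es) = length es * n"
  by (induction es) auto

lemma parse_enc_input:
  assumes "valid_input m n t es"
  shows "parse m (enc_input n t es) = (n, entries [] t, concat es, True)"
proof -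
  let ?x = "enc_input n t es"
  let ?r = "enc_tree t @ concat (map enc_inst es)"
  have x: "?x = replicate n True @ False # ?r" by (simp add: enc_input_def enc_nat_def)
  have n: "length (takeWhile id ?x) = n" unfolding x takeWhile_unary by simp
  have r: "drop (Suc n) ?x = ?r" unfolding x by simp
  \<comment> \<open>Each node occupies at least one symbol, so \<open>length ?r\<close> rounds
    suffice; the \<open>k\<close> surplus rounds are idle.\<close>
  obtain k where k: "length ?r = k + tsize t"
    using tsize_le[of t] by (metis le_add1 le_add2 le_trans length_append ordered_cancel_comm_monoid_diff_class.diff_add)
  have z: "(tree_step ^^ length ?r) (?r, [[]], []) = (concat (map enc_inst es), [], entries [] t)"
    unfolding k funpow_add o_apply tree_steps by (simp add: tree_step_done)
  have v: "fold val_step (concat (map enc_inst es)) (False, []) = (False, concat es)"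
    unfolding concat_enc_inst val_steps by simp
  have "n < length ?x" unfolding x by simp
  then show ?thesis
    using assms length_concat_blocks[of es n] unfolding parse_def Let_def n r z
    by (simp add: v valid_input_def decision_tree_entries length_concat_blocks)
qed

lemma split_blocks:
  "length vs = m * n \<Longrightarrow> \<exists>es. length es = m \<and> (\<forall>e\<in>set es. length e = n) \<and> concat es = vs"
proof (induction m arbitrary: vs)
  case (Suc m)
  have "length (drop n vs) = m * n" using Suc.prems by simp
  from Suc.IH[OF this] obtain es where "length es = m" "\<forall>e\<in>set es. length e = n" "concat es = drop n vs" by blast
  then show ?case using Suc.prems by (intro exI[of _ "take n vs # es"]) auto
qed simp

text \<open>Guarantees that verifiers built on \<open>parse\<close> reject strings that encode no
  input, on which the formula would have no meaning.\<close>

lemma parse_sound: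
  assumes "snd (snd (snd (parse m x)))"
  shows "\<exists>n t es. x = enc_input n t es \<and> valid_input m n t es"
proof -
  define n where "n = length (takeWhile id x)"
  define r where "r = drop (Suc n) x"
  obtain r' out where z: "(tree_step ^^ length r) (r, [[]], []) = (r', [], out)"
    using assms by (cases "(tree_step ^^ length r) (r, [[]], [])") (auto simp: parse_def Let_def n_def r_def)
  obtain vs where v: "fold val_step r' (False, []) = (False, vs)"
    using assms z by (cases "fold val_step r' (False, [])") (auto simp: parse_def Let_def n_def r_def)
  have ok: "n < length x" "length vs = m * n"
    "\<forall>e\<in>set out. snd e = None \<or> distinct (map fst (fst e)) \<and> (\<forall>q\<in>set (fst e). fst q < n)"
    using assms unfolding parse_def Let_def n_def[symmetric] r_def[symmetric] z by (auto simp: v)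
  obtain t where t: "r = enc_tree t @ r'" "out = entries [] t"
    using tree_steps_sound[OF z] by (auto simp: length_Suc_conv)
  have r': "r' = concat (map enc_val vs)" using val_steps_sound[OF v] by auto
  obtain es where es: "length es = m" "\<forall>e\<in>set es. length e = n" "concat es = vs"
    using split_blocks[OF ok(2)] by blast
  have "x = takeWhile id x @ x ! n # drop (Suc n) x"
    using ok(1) unfolding n_def by (metis Cons_nth_drop_Suc takeWhile_dropWhile_id dropWhile_eq_drop)
  moreover have "takeWhile id x = replicate n True"
    unfolding n_def by (metis (full_types) replicate_length_same set_takeWhileD id_apply)
  moreover have "\<not> x ! n" using ok(1) nth_length_takeWhile[of id x] by (simp add: n_def)
  ultimately have "x = enc_input n t es"
    using t(1) r' es(3) unfolding r_def
    by (simp add: enc_input_def enc_nat_def concat_enc_inst)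
  then show ?thesis using es ok(3) t(2) by (auto simp: valid_input_def decision_tree_entries)
qed

lemma fp_parse: "fp (parse m)"
proof -
  have "fp (\<lambda>x. parse m x)"
    unfolding parse_def Let_def
    by (intro fpi fp_val_steps fp_tree_steps fp_comp[OF fp_takeWhile_length[OF fp_id]])
  then show ?thesis by simp
qed

section \<open>Evaluating DT-FOIL formulas\<close>

subsection \<open>Invariance of the order formulas under permutations of the features\<close>

lemma bij_card:
  assumes "bij_betw \<pi> {..<n} {..<n::nat}" "\<And>i. i < n \<Longrightarrow> P i = Q (\<pi> i)"
  shows "card {i. i < n \<and> P i} = card {i. i < n \<and> Q i}"
proof (rule bij_betw_same_card)
  show "bij_betw \<pi> {i. i < n \<and> P i} {i. i < n \<and> Q i}"
    using assms unfolding bij_betw_def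
    by (auto simp: inj_on_def image_iff set_eq_iff) (metis lessThan_iff)+
qed

lemma bij_All:
  assumes "bij_betw \<pi> {..<n} {..<n::nat}" "\<And>i. i < n \<Longrightarrow> P i = Q (\<pi> i)"
  shows "(\<forall>i<n. P i) = (\<forall>i<n. Q i)"
  using assms unfolding bij_betw_def by (auto simp: image_iff set_eq_iff) (metis lessThan_iff)+

lemma permuted_instances:
  assumes "bij_betw \<pi> {..<n} {..<n::nat}" "length (e :: pinst) = n"
  shows "\<exists>e' :: pinst. length e' = n \<and> (\<forall>i<n. e' ! i = e ! \<pi> i)"
    "\<exists>e' :: pinst. length e' = n \<and> (\<forall>i<n. e ! i = e' ! \<pi> i)"
proof -
  show "\<exists>e' :: pinst. length e' = n \<and> (\<forall>i<n. e' ! i = e ! \<pi> i)"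
    by (intro exI[of _ "map (\<lambda>i. e ! \<pi> i) [0..<n]"]) simp
  have "inv_into {..<n} \<pi> (\<pi> i) = i" "\<pi> i < n" if "i < n" for i
    using that assms(1) by (auto simp: bij_betw_def inv_into_f_f)
  then show "\<exists>e' :: pinst. length e' = n \<and> (\<forall>i<n. e ! i = e' ! \<pi> i)"
    by (intro exI[of _ "map (\<lambda>i. e ! inv_into {..<n} \<pi> i) [0..<n]"]) simp
qed

text \<open>The atoms compare instances feature by feature or count features, so permuting the
  features of all arguments simultaneously changes nothing. At a quantifier the witness is permuted
  along, which is possible in both directions.\<close>

lemma sat_permute:
  assumes "order_fm \<phi>" "bij_betw \<pi> {..<n} {..<n}"
    and "\<And>v. v \<in> fv \<phi> \<Longrightarrow> length (\<sigma> v) = n \<and> length (\<sigma>' v) = n \<and> (\<forall>i<n. \<sigma>' v ! i = \<sigma> v ! \<pi> i)"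
  shows "sat n t \<sigma>' \<phi> = sat n t \<sigma> \<phi>"
  using assms(1,3)
proof (induction \<phi> arbitrary: \<sigma> \<sigma>')
  case (Sub x y)
  show ?case using Sub.prems(2)[of x] Sub.prems(2)[of y]
    by (auto simp: subsumed_def intro!: bij_All[OF assms(2)])
next
  case (Prec x y)
  have "card (undef_feats (\<sigma>' v)) = card (undef_feats (\<sigma> v))" if "v \<in> {x, y}" for v
    using Prec.prems(2)[of v] that unfolding undef_feats_def
    by (auto intro!: bij_card[OF assms(2)])
  then show ?case by (simp add: less_defined_def)
next
  case (Equal x y)
  have "\<sigma>' x = \<sigma>' y \<longleftrightarrow> (\<forall>i<n. \<sigma>' x ! i = \<sigma>' y ! i)" "\<sigma> x = \<sigma> y \<longleftrightarrow> (\<forall>i<n. \<sigma> x ! i = \<sigma> y ! i)"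
    using Equal.prems(2)[of x] Equal.prems(2)[of y] by (auto simp: list_eq_iff_nth_eq)
  then show ?case using Equal.prems(2)[of x] Equal.prems(2)[of y]
    by (auto intro!: bij_All[OF assms(2)])
next
  case (Exists x \<phi>)
  have "sat n t (\<sigma>'(x := e')) \<phi> = sat n t (\<sigma>(x := e)) \<phi>"
    if "length e = n" "length e' = n" "\<forall>i<n. e' ! i = e ! \<pi> i" for e e' :: pinst
    using Exists.prems that by (intro Exists.IH) auto
  then show ?case unfolding sat.simps using permuted_instances[OF assms(2)] by metis
next
  case (Forall x \<phi>)
  have "sat n t (\<sigma>'(x := e')) \<phi> = sat n t (\<sigma>(x := e)) \<phi>"
    if "length e = n" "length e' = n" "\<forall>i<n. e' ! i = e ! \<pi> i" for e e' :: pinst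
    using Forall.prems that by (intro Forall.IH) auto
  then show ?case unfolding sat.simps using permuted_instances[OF assms(2)] by metis
next
  case (Conj \<phi> \<psi>)
  have "sat n t \<sigma>' \<phi> = sat n t \<sigma> \<phi>" "sat n t \<sigma>' \<psi> = sat n t \<sigma> \<psi>"
    using Conj.prems by (intro Conj.IH; simp)+
  then show ?case by simp
next
  case (Disj \<phi> \<psi>)
  have "sat n t \<sigma>' \<phi> = sat n t \<sigma> \<phi>" "sat n t \<sigma>' \<psi> = sat n t \<sigma> \<psi>"
    using Disj.prems by (intro Disj.IH; simp)+
  then show ?case by simp
next
  case (Impl \<phi> \<psi>)
  have "sat n t \<sigma>' \<phi> = sat n t \<sigma> \<phi>" "sat n t \<sigma>' \<psi> = sat n t \<sigma> \<psi>"
    using Impl.prems by (intro Impl.IH; simp)+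
  then show ?case by simp
next
  case (Neg \<phi>)
  have "sat n t \<sigma>' \<phi> = sat n t \<sigma> \<phi>"
    using Neg.prems by (intro Neg.IH; simp)
  then show ?case by simp
qed auto

text \<open>Fibres over the same value have equal size, and the bijections between them glue
  together because the fibres partition the features.\<close>

lemma equal_counts_bij:
  fixes f g :: "nat \<Rightarrow> 'c"
  assumes "\<And>c. card {i. i < n \<and> f i = c} = card {i. i < n \<and> g i = c}"
  shows "\<exists>\<pi>. bij_betw \<pi> {..<n} {..<n} \<and> (\<forall>i<n. g i = f (\<pi> i))"
proof -
  have "\<exists>h. bij_betw h {i. i < n \<and> g i = c} {i. i < n \<and> f i = c}" for c
    using assms by (intro finite_same_card_bij) auto
  then obtain h where h: "\<And>c. bij_betw (h c) {i. i < n \<and> g i = c} {i. i < n \<and> f i = c}" by metis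
  define \<pi> where "\<pi> i = h (g i) i" for i
  have \<pi>: "\<pi> i < n \<and> f (\<pi> i) = g i" if "i < n" for i
    using bij_betwE[OF h[of "g i"]] that by (auto simp: \<pi>_def)
  have "inj_on \<pi> {..<n}"
  proof (rule inj_onI)
    fix i j assume ij: "i \<in> {..<n}" "j \<in> {..<n}" "\<pi> i = \<pi> j"
    then have "g i = g j" using \<pi>[of i] \<pi>[of j] by auto
    then show "i = j" using h[of "g i"] ij unfolding \<pi>_def bij_betw_def inj_on_def by auto
  qed
  moreover have "\<pi> ` {..<n} \<subseteq> {..<n}" using \<pi> by auto
  ultimately have "bij_betw \<pi> {..<n} {..<n}"
    by (simp add: bij_betw_def endo_inj_surj)
  then show ?thesis using \<pi> by metis
qed

subsection \<open>Polynomially many candidates for a quantified instance\<close>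

definition thr :: "nat \<Rightarrow> nat \<Rightarrow> nat \<Rightarrow> bool option" where
  "thr a b i = (if i < a then None else Some (b \<le> i))"

lemma initial_segment_card:
  assumes "C \<subseteq> {..<n::nat}" "k \<le> card C"
  shows "\<exists>a\<le>n. card {i\<in>C. i < a} = k"
  using assms
proof (induction n arbitrary: C)
  case (Suc n)
  have fin: "finite C" using Suc.prems finite_subset by blast
  show ?case
  proof (cases "k = card C")
    case True
    have "{i \<in> C. i < Suc n} = C" using Suc.prems by auto
    then show ?thesis using True by (intro exI[of _ "Suc n"]) simp
  next
    case False
    have sub: "C - {n} \<subseteq> {..<n}" using Suc.prems(1) by auto
    have le: "k \<le> card (C - {n})" using False Suc.prems(2) fin by (auto simp: card_Diff_singleton_if)
    from Suc.IH[OF sub le]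
    obtain a where a: "a \<le> n" "card {i \<in> C - {n}. i < a} = k" by blast
    have eq: "{i \<in> C - {n}. i < a} = {i \<in> C. i < a}" using a(1) by auto
    show ?thesis using a unfolding eq by (intro exI[of _ a]) simp
  qed
qed auto

text \<open>The threshold \<open>a\<close> cuts off as many elements of \<open>C\<close> as are
  undefined under \<open>e\<close>, and \<open>b\<close> as many as are undefined or 0. The count of
  1 then agrees as well, because the three counts add up to \<open>card C\<close>.\<close>

lemma thr_counts:
  assumes "C \<subseteq> {..<n::nat}"
  shows "\<exists>a\<le>n. \<exists>b\<le>n. \<forall>v. card {i\<in>C. thr a b i = v} = card {i\<in>C. e i = v}"
proof -
  have fin: "finite C" using assms finite_subset by blast
  let ?N = "\<lambda>v. card {i\<in>C. e i = v}"
  have split: "C = {i\<in>C. f i = None} \<union> ({i\<in>C. f i = Some False} \<union> {i\<in>C. f i = Some True})" for f :: "nat \<Rightarrow> bool option"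
  proof -
    have "f i = None \<or> f i = Some False \<or> f i = Some True" for i
      by (metis (full_types) not_None_eq)
    then show ?thesis by blast
  qed
  have card_C: "card C = card {i\<in>C. f i = None} + (card {i\<in>C. f i = Some False} + card {i\<in>C. f i = Some True})"
    for f :: "nat \<Rightarrow> bool option"
  proof -
    have "card C = card ({i\<in>C. f i = None} \<union> ({i\<in>C. f i = Some False} \<union> {i\<in>C. f i = Some True}))"
      by (rule arg_cong[OF split])
    also have "\<dots> = card {i\<in>C. f i = None} + card ({i\<in>C. f i = Some False} \<union> {i\<in>C. f i = Some True})"
      by (rule card_Un_disjoint) (use fin in auto)
    also have "card ({i\<in>C. f i = Some False} \<union> {i\<in>C. f i = Some True}) =
        card {i\<in>C. f i = Some False} + card {i\<in>C. f i = Some True}"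
      by (rule card_Un_disjoint) (use fin in auto)
    finally show ?thesis .
  qed
  obtain a where a: "a \<le> n" "card {i\<in>C. i < a} = ?N None"
    using initial_segment_card[OF assms, of "?N None"] card_C[of e] by auto
  obtain b where b: "b \<le> n" "card {i\<in>C. i < b} = ?N None + ?N (Some False)"
    using initial_segment_card[OF assms, of "?N None + ?N (Some False)"] card_C[of e] by auto
  have N: "card {i\<in>C. thr a b i = None} = ?N None" 
  proof -
    have "{i\<in>C. thr a b i = None} = {i\<in>C. i < a}" by (auto simp: thr_def split: if_splits)
    then show ?thesis using a(2) by simp
  qed
  \<comment> \<open>The thresholds are chosen independently, so \<open>b < a\<close> can occur, but
    only if \<open>e\<close> never takes the value 0 on \<open>C\<close>.\<close>
  have F: "card {i\<in>C. thr a b i = Some False} = ?N (Some False)"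
  proof (cases "a \<le> b")
    case True
    have "{i\<in>C. i < b} = {i\<in>C. i < a} \<union> {i\<in>C. thr a b i = Some False}"
      using True by (auto simp: thr_def)
    then have "card {i\<in>C. i < b} = card {i\<in>C. i < a} + card {i\<in>C. thr a b i = Some False}"
      using fin by (simp, subst card_Un_disjoint) (auto simp: thr_def)
    then show ?thesis using a b by simp
  next
    case False
    then have "{i\<in>C. i < b} \<subseteq> {i\<in>C. i < a}" by auto
    then have "card {i\<in>C. i < b} \<le> card {i\<in>C. i < a}" using fin by (intro card_mono) auto
    then have N0: "?N (Some False) = 0" using a(2) b(2) by simp
    have E: "{i\<in>C. thr a b i = Some False} = {}" using False by (auto simp: thr_def)
    show ?thesis unfolding E N0 by simp
  qed
  have T: "card {i\<in>C. thr a b i = Some True} = ?N (Some True)"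
    using card_C[of e] card_C[of "thr a b"] N F by simp
  have "card {i\<in>C. thr a b i = v} = ?N v" for v
  proof (cases v)
    case None
    then show ?thesis using N by (simp only:)
  next
    case (Some w)
    then show ?thesis using F T by (cases w) (simp_all only:)
  qed
  then show ?thesis using a(1) b(1) by blast
qed

type_synonym valuation = "(nat \<times> pinst) list"

definition lookup :: "valuation \<Rightarrow> nat \<Rightarrow> pinst" where
  "lookup al x = (case map_of al x of None \<Rightarrow> [] | Some e \<Rightarrow> e)"

lemma lookup_Cons [simp]: "lookup ((x, e) # al) = (lookup al)(x := e)"
  by (auto simp: lookup_def fun_eq_iff)

definition column :: "nat list \<Rightarrow> valuation \<Rightarrow> nat \<Rightarrow> bool option list" where
  "column W al i = map (\<lambda>v. nthd None (lookup al v) i) W"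

text \<open>
  Within every class of features with the same column over \<open>W\<close>, a candidate takes the values
  undefined, 0 and 1 in this order of the features, so that it is determined by two thresholds
  per class.
\<close>

primrec candidates :: "nat list \<Rightarrow> bool option list list \<Rightarrow> nat \<times> valuation \<Rightarrow> pinst list" where
  "candidates W [] z = [replicate (fst z) None]"
| "candidates W (\<tau> # \<tau>s) z = concat (map (\<lambda>e. concat (map (\<lambda>a. map (\<lambda>b.
     map (\<lambda>i. if column W (snd z) i = \<tau> then thr a b i else nthd None e i) [0..<fst z])
     [0..<Suc (fst z)]) [0..<Suc (fst z)])) (candidates W \<tau>s z))"

lemma fp_map_of:
  fixes k :: "'a::coded \<Rightarrow> nat" and l :: "'a \<Rightarrow> (nat \<times> 'b::coded) list"
  assumes "fp l" "fp k"
  shows "fp (\<lambda>x. map_of (l x) (k x))"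
proof -
  have "fp (\<lambda>x. case filter (\<lambda>p. fst p = k x) (l x) of [] \<Rightarrow> None | p # ps \<Rightarrow> Some (snd p))"
    by (intro fpi assms fp_fst_comp[OF assms(2)])
  moreover have "(case filter (\<lambda>p. fst p = k) l of [] \<Rightarrow> None | p # ps \<Rightarrow> Some (snd p)) = map_of l k"
    for k :: nat and l :: "(nat \<times> 'b) list"
    by (induction l) auto
  ultimately show ?thesis by simp
qed

lemma fp_lookup [fpi]: "fp al \<Longrightarrow> fp v \<Longrightarrow> fp (\<lambda>x. lookup (al x) (v x))"
  unfolding lookup_def by (intro fpi fp_map_of)

lemma fp_thr [fpi]: "fp a \<Longrightarrow> fp b \<Longrightarrow> fp i \<Longrightarrow> fp (\<lambda>x. thr (a x) (b x) (i x))"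
  unfolding thr_def by (intro fpi)

lemma fp_column [fpi]: "fp al \<Longrightarrow> fp i \<Longrightarrow> fp (\<lambda>x. column W (al x) (i x))"
  unfolding column_def by (intro fp_map_const fpi)

lemma fp_candidates: "fp (candidates W \<tau>s)"
proof (induction \<tau>s)
  case Nil
  have "fp (\<lambda>z :: nat \<times> valuation. [replicate (fst z) (None :: bool option)])" by (intro fpi)
  then show ?case by simp
next
  case (Cons \<tau> \<tau>s)
  have "fp (\<lambda>z. concat (map (\<lambda>e. concat (map (\<lambda>a. map (\<lambda>b.
     map (\<lambda>i. if column W (snd z) i = \<tau> then thr a b i else nthd None e i) [0..<fst z])
     [0..<Suc (fst z)]) [0..<Suc (fst z)])) (candidates W \<tau>s z)))"
    by (intro fpi Cons)
  then show ?case by simp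
qed

lemma length_candidates: "e \<in> set (candidates W \<tau>s z) \<Longrightarrow> length e = fst z"
  by (cases \<tau>s) auto

lemma set_concat2_I:
  "e \<in> set L \<Longrightarrow> a \<in> set A \<Longrightarrow> b \<in> set B \<Longrightarrow>
    F e a b \<in> set (concat (map (\<lambda>e. concat (map (\<lambda>a. map (F e a) B) A)) L))"
  by auto

lemma thr_in_candidates:
  assumes "\<And>\<tau>. A \<tau> \<le> n" "\<And>\<tau>. B \<tau> \<le> n"
  shows "map (\<lambda>i. let \<tau> = column W al i in if \<tau> \<in> set \<tau>s then thr (A \<tau>) (B \<tau>) i else None) [0..<n]
    \<in> set (candidates W \<tau>s (n, al))" (is "?e \<tau>s \<in> _")
proof (induction \<tau>s)
  case Nil
  have "?e [] = replicate n None" by (simp add: map_replicate_const)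
  then show ?case by simp
next
  case (Cons \<tau> \<tau>s)
  let ?F = "\<lambda>e a b. map (\<lambda>i. if column W al i = \<tau> then thr a b i else nthd None e i) [0..<n]"
  have eq: "?e (\<tau> # \<tau>s) = ?F (?e \<tau>s) (A \<tau>) (B \<tau>)"
    by (auto simp: nthd_def Let_def)
  have mem: "A \<tau> \<in> set [0..<Suc n]" "B \<tau> \<in> set [0..<Suc n]"
    using assms by (auto simp: less_Suc_eq_le simp del: upt_Suc)
  show ?case unfolding candidates.simps fst_conv snd_conv eq
    by (rule set_concat2_I[where F = ?F, OF Cons mem])
qed

text \<open>There are \<open>3 ^ length W\<close> possible columns, a constant of the formula; with
  two thresholds per column the list has \<open>(n + 1) ^ (2 * 3 ^ length W)\<close> entries,
  polynomial in \<open>n\<close>.\<close>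

definition all_candidates :: "nat list \<Rightarrow> nat \<times> valuation \<Rightarrow> pinst list" where
  "all_candidates W = candidates W (List.n_lists (length W) [None, Some False, Some True])"

text \<open>Colour each feature by its column together with its value. Thresholds chosen separately
  for every column make all colour counts of \<open>e\<close> and of the candidate agree, so the two
  colourings differ by a permutation, which then preserves columns.\<close>

lemma candidate_exists:
  assumes "length e = n"
  shows "\<exists>e'\<in>set (all_candidates W (n, al)). \<exists>\<pi>. bij_betw \<pi> {..<n} {..<n} \<and>
    (\<forall>i<n. column W al i = column W al (\<pi> i) \<and> e' ! i = e ! \<pi> i)"
proof -
  let ?C = "\<lambda>\<tau>. {i. i < n \<and> column W al i = \<tau>}"
  have "\<forall>\<tau>. \<exists>p. fst p \<le> n \<and> snd p \<le> n \<and>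
      (\<forall>v. card {i\<in>?C \<tau>. thr (fst p) (snd p) i = v} = card {i\<in>?C \<tau>. e ! i = v})"
  proof
    fix \<tau>
    obtain a b where "a \<le> n" "b \<le> n" "\<forall>v. card {i\<in>?C \<tau>. thr a b i = v} = card {i\<in>?C \<tau>. e ! i = v}"
      using thr_counts[of "?C \<tau>" n "(!) e"] by blast
    then show "\<exists>p. fst p \<le> n \<and> snd p \<le> n \<and>
      (\<forall>v. card {i\<in>?C \<tau>. thr (fst p) (snd p) i = v} = card {i\<in>?C \<tau>. e ! i = v})"
      by (intro exI[of _ "(a, b)"]) (simp only: fst_conv snd_conv simp_thms)
  qed
  from choice[OF this] obtain P where P: "\<forall>\<tau>. fst (P \<tau>) \<le> n \<and> snd (P \<tau>) \<le> n \<and>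
      (\<forall>v. card {i\<in>?C \<tau>. thr (fst (P \<tau>)) (snd (P \<tau>)) i = v} = card {i\<in>?C \<tau>. e ! i = v})"
    by (rule exE)
  define A B where "A = fst \<circ> P" and "B = snd \<circ> P"
  have AB: "\<And>\<tau>. A \<tau> \<le> n" "\<And>\<tau>. B \<tau> \<le> n"
    "\<And>\<tau> v. card {i\<in>?C \<tau>. thr (A \<tau>) (B \<tau>) i = v} = card {i\<in>?C \<tau>. e ! i = v}"
    using P unfolding A_def B_def o_apply by blast+
  define e' where "e' = map (\<lambda>i. let \<tau> = column W al i in
    if \<tau> \<in> set (List.n_lists (length W) [None, Some False, Some True]) then thr (A \<tau>) (B \<tau>) i else None) [0..<n]"
  have v: "set vs \<subseteq> set [None, Some False, Some True]" for vs :: "bool option list"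
  proof
    show "v \<in> set [None, Some False, Some True]" for v :: "bool option" by (cases v) auto
  qed
  have "column W al i \<in> set (List.n_lists (length W) [None, Some False, Some True])" for i
    unfolding set_n_lists mem_Collect_eq using v[of "column W al i"] by (simp add: column_def)
  then have e'_nth: "e' ! i = thr (A (column W al i)) (B (column W al i)) i" if "i < n" for i
    using that by (simp add: e'_def Let_def)
  have "e' \<in> set (all_candidates W (n, al))"
    unfolding all_candidates_def e'_def by (rule thr_in_candidates) (use AB in auto)
  moreover have "\<exists>\<pi>. bij_betw \<pi> {..<n} {..<n} \<and>
      (\<forall>i<n. (column W al i, e' ! i) = (column W al (\<pi> i), e ! \<pi> i))"
  proof (rule equal_counts_bij)
    fix c :: "bool option list \<times> bool option"
    obtain \<tau> v where c: "c = (\<tau>, v)" by fastforce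
    have "{i. i < n \<and> (column W al i, e' ! i) = c} = {i\<in>?C \<tau>. thr (A \<tau>) (B \<tau>) i = v}"
      using c e'_nth by auto
    moreover have "{i. i < n \<and> (column W al i, e ! i) = c} = {i\<in>?C \<tau>. e ! i = v}"
      using c by auto
    ultimately show "card {i. i < n \<and> (column W al i, e ! i) = c} = card {i. i < n \<and> (column W al i, e' ! i) = c}"
      using AB(3)[of \<tau> v] by simp
  qed
  ultimately show ?thesis by auto
qed

text \<open>The permutation preserves columns over \<open>W\<close>, so it leaves the instances of
  all other free variables as they are while it carries the witness to a candidate.\<close>

lemma sat_Exists_candidates:
  assumes "order_fm \<phi>" "set W = fv \<phi> - {x}" "\<And>v. v \<in> fv \<phi> - {x} \<Longrightarrow> length (lookup al v) = n"
  shows "sat n t (lookup al) (Exists x \<phi>) \<longleftrightarrow>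
    (\<exists>e\<in>set (all_candidates W (n, al)). sat n t (lookup ((x, e) # al)) \<phi>)"
proof
  assume "sat n t (lookup al) (Exists x \<phi>)"
  then obtain e where e: "length e = n" "sat n t ((lookup al)(x := e)) \<phi>" by auto
  obtain e' \<pi> where e': "e' \<in> set (all_candidates W (n, al))" "bij_betw \<pi> {..<n} {..<n}"
    "\<And>i. i < n \<Longrightarrow> column W al i = column W al (\<pi> i) \<and> e' ! i = e ! \<pi> i"
    using candidate_exists[OF e(1), of W al] by blast
  have len: "length e' = n" using e'(1) by (auto simp: all_candidates_def dest: length_candidates)
  have "lookup al v ! i = lookup al v ! \<pi> i" if "v \<in> set W" "i < n" for v i
  proof -
    have "\<pi> i < n" using e'(2) that(2) by (auto simp: bij_betw_def)
    moreover have "nthd None (lookup al v) i = nthd None (lookup al v) (\<pi> i)"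
      using e'(3)[OF that(2)] that(1) by (auto simp: column_def)
    ultimately show ?thesis using assms(2,3) that by (auto simp: nthd_def)
  qed
  then have "sat n t ((lookup al)(x := e')) \<phi> = sat n t ((lookup al)(x := e)) \<phi>"
    using assms e(1) len e'(3) by (intro sat_permute[OF assms(1) e'(2)]) auto
  then show "\<exists>e\<in>set (all_candidates W (n, al)). sat n t (lookup ((x, e) # al)) \<phi>"
    using e'(1) e(2) by auto
next
  assume "\<exists>e\<in>set (all_candidates W (n, al)). sat n t (lookup ((x, e) # al)) \<phi>"
  then obtain e where "e \<in> set (all_candidates W (n, al))" "sat n t ((lookup al)(x := e)) \<phi>" by auto
  moreover from this have "length e = n" by (auto simp: all_candidates_def dest: length_candidates)
  ultimately show "sat n t (lookup al) (Exists x \<phi>)" by auto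
qed

subsection \<open>Deciding DT-FOIL formulas\<close>

definition node_list :: "nat \<Rightarrow> entry list \<Rightarrow> pinst list" where
  "node_list n es = map (\<lambda>e. map (map_of (fst e)) [0..<n]) es"

definition pos_list :: "nat \<Rightarrow> entry list \<Rightarrow> pinst list" where
  "pos_list n es = node_list n (filter (\<lambda>e. snd e = Some True) es)"

lemma node_list_iff: "e \<in> set (node_list n (entries [] t)) \<longleftrightarrow> is_node n t e"
  using entries_iff[of _ _ "[]" t] unfolding node_list_def is_node_def path_inst_def
  by (auto simp: image_iff Bex_def)

lemma pos_list_iff: "e \<in> set (pos_list n (entries [] t)) \<longleftrightarrow> is_pos_leaf n t e"
  using entries_iff[of _ _ "[]" t] unfolding pos_list_def node_list_def is_pos_leaf_def path_inst_def
  by (auto simp: image_iff Bex_def)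

lemma fp_node_list [fpi]: "fp n \<Longrightarrow> fp es \<Longrightarrow> fp (\<lambda>x. node_list (n x) (es x))"
  unfolding node_list_def by (intro fpi fp_map_of fp_fst_comp)

lemma fp_pos_list [fpi]: "fp n \<Longrightarrow> fp es \<Longrightarrow> fp (\<lambda>x. pos_list (n x) (es x))"
  unfolding pos_list_def by (intro fpi)

lemma length_node: "is_node n t e \<Longrightarrow> length e = n"
  by (auto simp: is_node_def path_inst_def)

lemma length_pos_leaf: "is_pos_leaf n t e \<Longrightarrow> length e = n"
  by (auto simp: is_pos_leaf_def path_inst_def)

text \<open>The dimension, the nodes, the positive leaves, and the assignment.\<close>

type_synonym env = "nat \<times> pinst list \<times> pinst list \<times> valuation"

abbreviation env_of :: "nat \<Rightarrow> dtree \<Rightarrow> valuation \<Rightarrow> env" where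
  "env_of n t al \<equiv> (n, node_list n (entries [] t), pos_list n (entries [] t), al)"

text \<open>The restriction on lengths excludes in particular unassigned variables, for which
  \<open>lookup\<close> falls back to the empty list.\<close>

definition decides :: "(env \<Rightarrow> bool) \<Rightarrow> fm \<Rightarrow> bool" where
  "decides g \<phi> \<longleftrightarrow> (\<forall>n t al. (\<forall>v\<in>fv \<phi>. length (lookup al v) = n) \<longrightarrow>
     g (env_of n t al) = sat n t (lookup al) \<phi>)"

definition decidable :: "fm \<Rightarrow> bool" where
  "decidable \<phi> \<longleftrightarrow> (\<exists>g. fp g \<and> decides g \<phi>)"

lemma decidableI: "fp g \<Longrightarrow> decides g \<phi> \<Longrightarrow> decidable \<phi>"
  unfolding decidable_def by blast

lemma decidableE:
  assumes "decidable \<phi>"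
  obtains g where "fp g" "decides g \<phi>"
  using assms unfolding decidable_def by blast

lemma fp_eq_option_bool [fpi]: "fp f \<Longrightarrow> fp g \<Longrightarrow> fp (\<lambda>x. (f x :: bool option) = g x)"
proof -
  assume f: "fp f" and g: "fp g"
  have "fp (\<lambda>x. (f x = None \<and> g x = None) \<or> (f x = Some True \<and> g x = Some True) \<or>
      (f x = Some False \<and> g x = Some False))"
    using f g by (intro fpi)
  moreover have "(a = None \<and> b = None \<or> a = Some True \<and> b = Some True \<or> a = Some False \<and> b = Some False) = (a = b)"
    for a b :: "bool option" by (metis (full_types) not_None_eq)
  ultimately show ?thesis by simp
qed

lemma subsumed_code:
  "length e = length e' \<Longrightarrow> subsumed e e' \<longleftrightarrow>
    (\<forall>i\<in>set [0..<length e]. nthd None e i = None \<or> nthd None e i = nthd None e' i)"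
  by (auto simp: subsumed_def nthd_def Ball_def)

lemma subsumed_antisym: "length e = length e' \<Longrightarrow> subsumed e e' \<Longrightarrow> subsumed e' e \<Longrightarrow> e = e'"
  unfolding subsumed_def by (metis list_eq_iff_nth_eq)

lemma subsumed_refl: "subsumed e e"
  by (simp add: subsumed_def)

lemma decidable_Sub: "decidable (Sub x y)"
proof (rule decidableI)
  let ?g = "\<lambda>z :: env. \<forall>i\<in>set [0..<length (lookup (snd (snd (snd z))) x)].
      nthd None (lookup (snd (snd (snd z))) x) i = None \<or>
      nthd None (lookup (snd (snd (snd z))) x) i = nthd None (lookup (snd (snd (snd z))) y) i"
  show "fp ?g" by (intro fpi)
  show "decides ?g (Sub x y)"
    unfolding decides_def using subsumed_code[of "lookup _ x" "lookup _ y"] by simp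
qed

lemma decidable_Conj:
  assumes "decidable \<phi>" "decidable \<psi>"
  shows "decidable (Conj \<phi> \<psi>)"
proof -
  obtain g h where "fp g" "decides g \<phi>" "fp h" "decides h \<psi>"
    using assms by (meson decidableE)
  then show ?thesis
    by (intro decidableI[OF fp_conj[of g h]]) (auto simp: decides_def ball_Un)
qed

lemma decidable_Neg: "decidable \<phi> \<Longrightarrow> decidable (Neg \<phi>)"
  by (elim decidableE, rule decidableI[OF fp_not]) (auto simp: decides_def)

lemma decidable_cong:
  "decidable \<phi> \<Longrightarrow> fv \<phi> = fv \<psi> \<Longrightarrow> (\<And>n t \<sigma>. sat n t \<sigma> \<phi> = sat n t \<sigma> \<psi>) \<Longrightarrow> decidable \<psi>"
  unfolding decidable_def decides_def by simp

lemma decidable_Disj: "decidable \<phi> \<Longrightarrow> decidable \<psi> \<Longrightarrow> decidable (Disj \<phi> \<psi>)"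
  by (rule decidable_cong[OF decidable_Neg[OF decidable_Conj[OF decidable_Neg decidable_Neg]]]) auto

lemma decidable_Impl: "decidable \<phi> \<Longrightarrow> decidable \<psi> \<Longrightarrow> decidable (Impl \<phi> \<psi>)"
  by (rule decidable_cong[OF decidable_Disj[OF decidable_Neg]]) auto

lemma decidable_Equal: "decidable (Equal x y)"
proof -
  obtain g where g: "fp g" "decides g (Conj (Sub x y) (Sub y x))"
    using decidable_Conj[OF decidable_Sub decidable_Sub] by (rule decidableE)
  have "decides g (Equal x y)"
    unfolding decides_def
  proof (intro allI impI)
    fix n t al assume len: "\<forall>v\<in>fv (Equal x y). length (lookup al v) = n"
    then have "subsumed (lookup al x) (lookup al y) \<and> subsumed (lookup al y) (lookup al x)
        \<longleftrightarrow> lookup al x = lookup al y"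
      using subsumed_antisym[of "lookup al x" "lookup al y"] subsumed_refl by auto
    moreover have "g (env_of n t al) =
        sat n t (lookup al) (Conj (Sub x y) (Sub y x))"
      by (rule g(2)[unfolded decides_def, rule_format]) (use len in auto)
    ultimately show "g (env_of n t al) = sat n t (lookup al) (Equal x y)"
      by (simp only: sat.simps)
  qed
  then show ?thesis using g(1) by (rule decidableI[rotated])
qed

lemma decidable_Prec: "decidable (Prec x y)"
proof (rule decidableI)
  let ?u = "\<lambda>v (z :: env). length (filter (\<lambda>i. nthd None (lookup (snd (snd (snd z))) v) i = None)
      [0..<length (lookup (snd (snd (snd z))) v)])"
  show "fp (\<lambda>z. ?u y z \<le> ?u x z)" by (intro fpi)
  have "length (filter (\<lambda>i. nthd None e i = None) [0..<length e]) = card (undef_feats e)" for e :: pinst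
  proof -
    have "undef_feats e = set (filter (\<lambda>i. nthd None e i = None) [0..<length e])"
      by (auto simp: undef_feats_def nthd_def)
    then show ?thesis by (simp only: distinct_card distinct_filter distinct_upt)
  qed
  then show "decides (\<lambda>z. ?u y z \<le> ?u x z) (Prec x y)"
    by (simp add: decides_def less_defined_def)
qed

lemma fp_env_update:
  assumes "fp (g :: env \<Rightarrow> bool)"
  shows "fp (\<lambda>p. g (fst (fst p), fst (snd (fst p)), fst (snd (snd (fst p))), (x, snd p) # snd (snd (snd (fst p)))))"
  by (rule fp_comp[OF assms]) (intro fpi)

lemma decidable_Exists_order:
  assumes "order_fm \<phi>" "decidable \<phi>"
  shows "decidable (Exists x \<phi>)"
proof -
  obtain g where g: "fp g" "decides g \<phi>" using assms(2) by (rule decidableE)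
  have "finite (fv \<phi>)" by (induction \<phi>) auto
  then obtain W where W: "set W = fv \<phi> - {x}" using finite_list[of "fv \<phi> - {x}"] by auto
  let ?h = "\<lambda>z. \<exists>e\<in>set (all_candidates W (fst z, snd (snd (snd z)))).
    g (fst z, fst (snd z), fst (snd (snd z)), (x, e) # snd (snd (snd z)))"
  have "fp ?h"
    unfolding all_candidates_def
    by (intro fpi fp_comp[OF fp_candidates] fp_env_update g)
  moreover have "decides ?h (Exists x \<phi>)"
    unfolding decides_def
  proof (intro allI impI)
    fix n t al assume len: "\<forall>v\<in>fv (Exists x \<phi>). length (lookup al v) = n"
    have "g (env_of n t ((x, e) # al)) =
        sat n t (lookup ((x, e) # al)) \<phi>" if "e \<in> set (all_candidates W (n, al))" for e
      using g(2) len length_candidates[OF that[unfolded all_candidates_def]]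
      unfolding decides_def by auto
    then show "?h (env_of n t al) = sat n t (lookup al) (Exists x \<phi>)"
      using sat_Exists_candidates[OF assms(1) W, of al n t] len by simp
  qed
  ultimately show ?thesis by (rule decidableI)
qed

lemma decidable_order_fm: "order_fm \<phi> \<Longrightarrow> decidable \<phi>"
proof (induction \<phi>)
  case (Forall x \<phi>)
  have "decidable (Neg (Exists x (Neg \<phi>)))"
    using Forall by (intro decidable_Neg decidable_Exists_order) auto
  then show ?case by (rule decidable_cong) auto
qed (auto intro: decidable_Sub decidable_Prec decidable_Equal decidable_Neg decidable_Conj
    decidable_Disj decidable_Impl decidable_Exists_order)

text \<open>In DT-FOIL the tree predicates occur only as guards. A guard confines the witness to a
  list that is part of the environment, and the search through it replaces the symmetry
  argument.\<close>

lemma decidable_guarded: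
  assumes "decidable \<phi>"
  shows "decidable (Exists x (Conj (Node x) \<phi>))" "decidable (Exists x (Conj (PosLeaf x) \<phi>))"
proof -
  obtain g where g: "fp g" "decides g \<phi>" using assms by (rule decidableE)
  let ?u = "\<lambda>z e. (fst z, fst (snd z), fst (snd (snd z)), (x, e) # snd (snd (snd z)))"
  have upd: "g (env_of n t ((x, e) # al)) = sat n t ((lookup al)(x := e)) \<phi>"
    if "\<forall>v\<in>fv \<phi> - {x}. length (lookup al v) = n" "length e = n" for n t al e
    using g(2) that unfolding decides_def by auto
  have "fp (\<lambda>z. \<exists>e\<in>set (fst (snd z)). g (?u z e))" "fp (\<lambda>z. \<exists>e\<in>set (fst (snd (snd z))). g (?u z e))"
    by (intro fpi fp_env_update g)+
  moreover have "decides (\<lambda>z. \<exists>e\<in>set (fst (snd z)). g (?u z e)) (Exists x (Conj (Node x) \<phi>))"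
    unfolding decides_def
  proof (intro allI impI)
    fix n t al assume "\<forall>v\<in>fv (Exists x (Conj (Node x) \<phi>)). length (lookup al v) = n"
    then have "\<forall>v\<in>fv \<phi> - {x}. length (lookup al v) = n" by auto
    from upd[OF this] show "(\<exists>e\<in>set (fst (snd (env_of n t al))). g (?u (env_of n t al) e)) =
        sat n t (lookup al) (Exists x (Conj (Node x) \<phi>))"
      unfolding node_list_iff Bex_def fst_conv snd_conv sat.simps fun_upd_same using length_node by metis
  qed
  moreover have "decides (\<lambda>z. \<exists>e\<in>set (fst (snd (snd z))). g (?u z e)) (Exists x (Conj (PosLeaf x) \<phi>))"
    unfolding decides_def
  proof (intro allI impI)
    fix n t al assume "\<forall>v\<in>fv (Exists x (Conj (PosLeaf x) \<phi>)). length (lookup al v) = n"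
    then have "\<forall>v\<in>fv \<phi> - {x}. length (lookup al v) = n" by auto
    from upd[OF this] show "(\<exists>e\<in>set (fst (snd (snd (env_of n t al)))). g (?u (env_of n t al) e)) =
        sat n t (lookup al) (Exists x (Conj (PosLeaf x) \<phi>))"
      unfolding pos_list_iff Bex_def fst_conv snd_conv sat.simps fun_upd_same using length_pos_leaf by metis
  qed
  ultimately show "decidable (Exists x (Conj (Node x) \<phi>))" "decidable (Exists x (Conj (PosLeaf x) \<phi>))"
    by (blast intro: decidableI)+
qed

lemma decidable_dt_foil: "dt_foil \<phi> \<Longrightarrow> decidable \<phi>"
proof (induction rule: dt_foil.induct)
  case (7 \<phi> x)
  have "decidable (Neg (Exists x (Conj (Node x) (Neg \<phi>))))"
    using 7 by (intro decidable_Neg decidable_guarded)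
  then show ?case by (rule decidable_cong) auto
next
  case (9 \<phi> x)
  have "decidable (Neg (Exists x (Conj (PosLeaf x) (Neg \<phi>))))"
    using 9 by (intro decidable_Neg decidable_guarded)
  then show ?case by (rule decidable_cong) auto
qed (auto intro: decidable_order_fm decidable_Neg decidable_Conj decidable_Disj decidable_Impl decidable_guarded)

section \<open>Certificates\<close>

text \<open>Soundness is required of certificates of any length, so that closure under unions and
  intersections needs no check of the length.\<close>

definition certifiable :: "lang \<Rightarrow> bool" where
  "certifiable A \<longleftrightarrow> (\<exists>g b. fp (g :: bool list \<times> bool list \<Rightarrow> bool) \<and> pb UNIV length b \<and> (\<forall>x u. g (x, u) \<longrightarrow> x \<in> A) \<and>
     (\<forall>x\<in>A. \<exists>u. length u \<le> b x \<and> g (x, u)))"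

text \<open>Counts the doubled bits in front of the first unequal pair, which is the separator if
  the string is a pairing. The two defaults differ, so a pair beyond the end counts as unequal
  too.\<close>

definition pair_len :: "bool list \<Rightarrow> nat" where
  "pair_len w = length (filter (\<lambda>i. \<forall>j\<in>set [0..<Suc i]. nthd False w (2 * j) = nthd True w (2 * j + 1)) [0..<length w])"

definition unpair1 :: "bool list \<Rightarrow> bool list" where
  "unpair1 w = map (\<lambda>i. nthd False w (2 * i)) [0..<pair_len w]"

definition unpair2 :: "bool list \<Rightarrow> bool list" where
  "unpair2 w = drop (2 * pair_len w + 2) w"

lemma fp_pair_len [fpi]:
  assumes "fp w"
  shows "fp (\<lambda>x. pair_len (w x))"
  unfolding pair_len_def by (intro fpi assms fp_fst_comp[OF fp_fst_comp[OF assms]] fp_fst_comp[OF assms])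

lemma length_doubled [simp]: "length (concat (map (\<lambda>b. [b, b]) x)) = 2 * length x"
  by (induction x) auto

lemma nth_doubled:
  "j < length x \<Longrightarrow> concat (map (\<lambda>b. [b, b]) x) ! (2 * j) = x ! j \<and> concat (map (\<lambda>b. [b, b]) x) ! (2 * j + 1) = x ! j"
proof (induction x arbitrary: j)
  case (Cons b x)
  then show ?case by (cases j) auto
qed simp

lemma length_pair_str: "length (pair_str x u) = 2 * length x + 2 + length u"
  by (simp add: pair_str_def)

lemma nthd_pair_str:
  "j < length x \<Longrightarrow> nthd d (pair_str x u) (2 * j) = x ! j"
  "j < length x \<Longrightarrow> nthd d (pair_str x u) (2 * j + 1) = x ! j"
  "nthd d (pair_str x u) (2 * length x) = False" "nthd d (pair_str x u) (2 * length x + 1) = True"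
  using nth_doubled[of j x] by (auto simp: nthd_def pair_str_def nth_append)

lemma pair_len_pair_str [simp]: "pair_len (pair_str x u) = length x"
proof -
  have *: "(\<forall>j\<in>set [0..<Suc i]. nthd False (pair_str x u) (2 * j) = nthd True (pair_str x u) (2 * j + 1)) \<longleftrightarrow> i < length x" for i
  proof
    assume all: "\<forall>j\<in>set [0..<Suc i]. nthd False (pair_str x u) (2 * j) = nthd True (pair_str x u) (2 * j + 1)"
    show "i < length x"
    proof (rule ccontr)
      assume "\<not> i < length x"
      then have "length x \<in> set [0..<Suc i]" by auto
      with all have "nthd False (pair_str x u) (2 * length x) = nthd True (pair_str x u) (2 * length x + 1)" by blast
      then show False using nthd_pair_str(3,4) by blast
    qed
  next
    assume "i < length x"
    then show "\<forall>j\<in>set [0..<Suc i]. nthd False (pair_str x u) (2 * j) = nthd True (pair_str x u) (2 * j + 1)"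
      using nthd_pair_str(1,2)[of _ x] by (auto simp del: upt_Suc)
  qed
  have "length (filter (\<lambda>i. i < m) [0..<k]) = m" if "m \<le> k" for m k :: nat
  proof -
    have "filter (\<lambda>i. i < m) [0..<k] = [0..<m]" using that
    proof (induction k)
      case (Suc k)
      then show ?case by (cases "m = Suc k") auto
    qed simp
    then show ?thesis by simp
  qed
  then show ?thesis unfolding pair_len_def * by (simp add: length_pair_str)
qed

lemma unpair1_pair_str [simp]: "unpair1 (pair_str x u) = x"
  using nthd_pair_str(1)[of _ x] by (auto simp: unpair1_def intro!: nth_equalityI)

lemma unpair2_pair_str [simp]: "unpair2 (pair_str x u) = u"
  unfolding unpair2_def pair_len_pair_str by (simp add: pair_str_def)

lemma fp_unpair1 [fpi]:
  assumes "fp w"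
  shows "fp (\<lambda>x. unpair1 (w x))"
  unfolding unpair1_def by (intro fpi assms fp_fst_comp[OF assms])

lemma fp_unpair2 [fpi]: "fp w \<Longrightarrow> fp (\<lambda>x. unpair2 (w x))"
  unfolding unpair2_def by (intro fpi)

lemma fp_eq_bools [fpi]:
  fixes f g :: "'a::coded \<Rightarrow> bool list"
  assumes "fp f" "fp g"
  shows "fp (\<lambda>x. f x = g x)"
proof -
  have "fp (\<lambda>x. length (f x) = length (g x) \<and> (\<forall>i\<in>set [0..<length (f x)]. nthd False (f x) i = nthd False (g x) i))"
    by (intro fpi assms fp_fst_comp[OF assms(1)] fp_fst_comp[OF assms(2)])
  moreover have "(length x = length y \<and> (\<forall>i\<in>set [0..<length x]. nthd False x i = nthd False y i)) = (x = y)"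
    for x y :: "bool list"
  proof (intro iffI; (elim conjE)?)
    assume l: "length x = length y" and n: "\<forall>i\<in>set [0..<length x]. nthd False x i = nthd False y i"
    show "x = y"
      using l n by (intro nth_equalityI) (auto simp: nthd_def Ball_def)
  qed simp
  ultimately show ?thesis by simp
qed

lemma fp_pair_str [fpi]: "fp f \<Longrightarrow> fp g \<Longrightarrow> fp (\<lambda>x. pair_str (f x) (g x))"
  unfolding pair_str_def by (intro fpi)

lemma pb_length_poly:
  assumes "pb UNIV length b"
  shows "\<exists>p :: nat poly. \<forall>x. b x \<le> poly p (length x)"
proof -
  obtain k where "\<And>x. b x \<le> (length x + 2) ^ k" using assms unfolding pb_def by blast
  then have "b x \<le> poly ([:2, 1:] ^ k) (length x)" for x by (simp add: add.commute)
  then show ?thesis by blast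
qed

lemma certifiable_NP:
  assumes "certifiable A"
  shows "A \<in> NP"
proof -
  obtain g b where g: "fp (g :: bool list \<times> bool list \<Rightarrow> bool)" "pb UNIV length b" "\<forall>x u. g (x, u) \<longrightarrow> x \<in> A"
    "\<forall>x\<in>A. \<exists>u. length u \<le> b x \<and> g (x, u)"
    using assms unfolding certifiable_def by blast
  \<comment> \<open>The projections are total, so strings that are no pairings are filtered out by
    comparing \<open>w\<close> with its reassembled components.\<close>
  define V where "V = {w. w = pair_str (unpair1 w) (unpair2 w) \<and> g (unpair1 w, unpair2 w)}"
  have "fp (\<lambda>w. w \<in> V)"
    unfolding V_def mem_Collect_eq by (intro fpi fp_comp[OF g(1)])
  then have "V \<in> PTIME" by (rule fp_PTIME)
  moreover obtain p :: "nat poly" where p: "\<And>x. b x \<le> poly p (length x)"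
    using pb_length_poly[OF g(2)] by blast
  moreover have "pair_str x u \<in> V \<longleftrightarrow> g (x, u)" for x u
    by (simp add: V_def)
  moreover have "x \<in> A \<longleftrightarrow> (\<exists>u. length u \<le> poly p (length x) \<and> g (x, u))" for x
    using g(3,4) p[of x] le_trans by blast
  ultimately show ?thesis
    unfolding NP_def mem_Collect_eq by (intro bexI[of _ V] exI[of _ p]) simp_all
qed

lemma certifiable_fp: "fp (\<lambda>x. x \<in> A) \<Longrightarrow> certifiable A"
  unfolding certifiable_def
  by (intro exI[of _ "\<lambda>p. fst p \<in> A"] exI[of _ "\<lambda>_. 0"])
    (auto intro: fp_fst_comp pb_const)

lemma certifiable_Un:
  assumes "certifiable A" "certifiable B"
  shows "certifiable (A \<union> B)"
proof -
  obtain g b where g: "fp (g :: bool list \<times> bool list \<Rightarrow> bool)" "pb UNIV length b" "\<forall>x u. g (x, u) \<longrightarrow> x \<in> A"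
    "\<forall>x\<in>A. \<exists>u. length u \<le> b x \<and> g (x, u)"
    using assms(1) unfolding certifiable_def by blast
  obtain h c where h: "fp (h :: bool list \<times> bool list \<Rightarrow> bool)" "pb UNIV length c" "\<forall>x u. h (x, u) \<longrightarrow> x \<in> B"
    "\<forall>x\<in>B. \<exists>u. length u \<le> c x \<and> h (x, u)"
    using assms(2) unfolding certifiable_def by blast
  show ?thesis unfolding certifiable_def
  proof (intro exI conjI)
    show "fp (\<lambda>p. g p \<or> h p)" by (intro fpi g h)
    show "pb UNIV length (\<lambda>x. b x + c x)" by (intro pb_intros g h)
  qed (use g(3,4) h(3,4) in \<open>auto, (meson trans_le_add1 trans_le_add2)+\<close>)
qed

lemma certifiable_Int:
  assumes "certifiable A" "certifiable B"
  shows "certifiable (A \<inter> B)"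
proof -
  obtain g b where g: "fp (g :: bool list \<times> bool list \<Rightarrow> bool)" "pb UNIV length b" "\<forall>x u. g (x, u) \<longrightarrow> x \<in> A"
    "\<forall>x\<in>A. \<exists>u. length u \<le> b x \<and> g (x, u)"
    using assms(1) unfolding certifiable_def by blast
  obtain h c where h: "fp (h :: bool list \<times> bool list \<Rightarrow> bool)" "pb UNIV length c" "\<forall>x u. h (x, u) \<longrightarrow> x \<in> B"
    "\<forall>x\<in>B. \<exists>u. length u \<le> c x \<and> h (x, u)"
    using assms(2) unfolding certifiable_def by blast
  show ?thesis unfolding certifiable_def
  proof (intro exI[of _ "\<lambda>p. g (fst p, unpair1 (snd p)) \<and> h (fst p, unpair2 (snd p))"]
      exI[of _ "\<lambda>x. 2 * b x + 2 + c x"] conjI ballI)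
    show "fp (\<lambda>p. g (fst p, unpair1 (snd p)) \<and> h (fst p, unpair2 (snd p)))"
      by (intro fpi fp_comp[OF g(1)] fp_comp[OF h(1)])
    show "pb UNIV length (\<lambda>x. 2 * b x + 2 + c x)" by (intro pb_intros g h)
    fix x assume "x \<in> A \<inter> B"
    then obtain u v where "length u \<le> b x" "g (x, u)" "length v \<le> c x" "h (x, v)"
      using g(4) h(4) by blast
    then show "\<exists>w. length w \<le> 2 * b x + 2 + c x \<and> g (fst (x, w), unpair1 (snd (x, w))) \<and> h (fst (x, w), unpair2 (snd (x, w)))"
      by (intro exI[of _ "pair_str u v"]) (simp add: length_pair_str)
  qed (use g(3) h(3) in auto)
qed

section \<open>Boolean combinations of NP languages lie in the Boolean hierarchy\<close>

definition hits :: "bool list \<Rightarrow> lang list \<Rightarrow> nat" where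
  "hits x Hs = length (filter (\<lambda>H. x \<in> H) Hs)"

text \<open>Symmetric differences of certifiable languages are closed under the Boolean operations,
  because intersection distributes over symmetric difference.\<close>

definition xor_np :: "lang \<Rightarrow> bool" where
  "xor_np A \<longleftrightarrow> (\<exists>Hs. (\<forall>H\<in>set Hs. certifiable H) \<and> (\<forall>x. x \<in> A \<longleftrightarrow> odd (hits x Hs)))"

lemma xor_np_certifiable: "certifiable A \<Longrightarrow> xor_np A"
  unfolding xor_np_def hits_def by (intro exI[of _ "[A]"]) auto

lemma certifiable_UNIV: "certifiable UNIV"
  by (rule certifiable_fp) (simp add: fp_const)

lemma certifiable_empty: "certifiable {}"
  by (rule certifiable_fp) (simp add: fp_const)

lemma xor_np_Compl: "xor_np A \<Longrightarrow> xor_np (- A)"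
proof -
  assume "xor_np A"
  then obtain Hs where "\<forall>H\<in>set Hs. certifiable H" "\<forall>x. x \<in> A \<longleftrightarrow> odd (hits x Hs)"
    unfolding xor_np_def by blast
  \<comment> \<open>\<open>UNIV\<close> contributes one hit to every string and thereby flips the
    parity.\<close>
  then show ?thesis unfolding xor_np_def
    by (intro exI[of _ "UNIV # Hs"]) (simp add: hits_def certifiable_UNIV)
qed

text \<open>A product is odd exactly if both factors are, so the pairwise intersections represent
  the intersection of two symmetric differences.\<close>

lemma hits_product:
  "hits x (concat (map (\<lambda>H. map (\<lambda>K. H \<inter> K) Ks) Hs)) = hits x Hs * hits x Ks"
  by (induction Hs) (auto simp: hits_def filter_map o_def)

lemma xor_np_Int:
  assumes "xor_np A" "xor_np B"
  shows "xor_np (A \<inter> B)"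
proof -
  obtain Hs Ks where "\<forall>H\<in>set Hs. certifiable H" "\<forall>x. x \<in> A \<longleftrightarrow> odd (hits x Hs)"
    "\<forall>K\<in>set Ks. certifiable K" "\<forall>x. x \<in> B \<longleftrightarrow> odd (hits x Ks)"
    using assms unfolding xor_np_def by blast
  then show ?thesis unfolding xor_np_def
    by (intro exI[of _ "concat (map (\<lambda>H. map (\<lambda>K. H \<inter> K) Ks) Hs)"])
      (auto simp: hits_product intro: certifiable_Int)
qed

lemma xor_np_Un: "xor_np A \<Longrightarrow> xor_np B \<Longrightarrow> xor_np (A \<union> B)"
  using xor_np_Compl[OF xor_np_Int[OF xor_np_Compl xor_np_Compl]] by simp

text \<open>A threshold is monotone in the languages counted, so unions and intersections suffice
  and no complement leads out of NP.\<close>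

lemma certifiable_hits: "\<forall>H\<in>set Hs. certifiable H \<Longrightarrow> certifiable {x. j \<le> hits x Hs}"
proof (induction Hs arbitrary: j)
  case Nil
  then show ?case by (cases j) (auto simp: hits_def certifiable_UNIV certifiable_empty)
next
  case (Cons H Hs)
  show ?case
  proof (cases j)
    case 0
    then show ?thesis by (simp add: certifiable_UNIV)
  next
    case (Suc j')
    have "{x. j \<le> hits x (H # Hs)} = {x. j \<le> hits x Hs} \<union> (H \<inter> {x. j' \<le> hits x Hs})"
      using Suc by (auto simp: hits_def)
    then show ?thesis using Cons by (auto intro: certifiable_Un certifiable_Int)
  qed
qed

text \<open>With \<open>A\<^sub>1 \<supseteq> A\<^sub>2 \<supseteq> \<dots>\<close> the parity of the largest \<open>j\<close> with \<open>x \<in> A\<^sub>j\<close> decides membership in the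
  \<open>k\<close>-th combination.\<close>

lemma parity_BH:
  assumes "\<And>j. {x. j \<le> c x} \<in> NP"
  shows "{x. odd (min (c x) (Suc k))} \<in> BH (Suc k)"
proof (induction k)
  case 0
  have "{x. odd (min (c x) (Suc 0))} = {x. 1 \<le> c x}"
    by (auto simp: min_def not_le Suc_le_eq odd_pos)
  then show ?case using assms[of 1] by simp
next
  case (Suc k)
  let ?A = "{x. odd (min (c x) (Suc k))}" and ?B = "{x. Suc (Suc k) \<le> c x}"
  show ?case
  proof (cases "even k")
    case True
    have "{x. odd (min (c x) (Suc (Suc k)))} = ?A \<inter> (- ?B)"
      using True by (auto simp: min_def not_le less_Suc_eq_le le_Suc_eq)
    moreover have "- ?B \<in> coNP" using assms by (simp add: coNP_def)
    ultimately show ?thesis using True Suc by auto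
  next
    case False
    have "{x. odd (min (c x) (Suc (Suc k)))} = ?A \<union> ?B"
      using False by (auto simp: min_def not_le less_Suc_eq_le le_Suc_eq)
    then show ?thesis using False Suc assms by auto
  qed
qed

lemma xor_np_BH:
  assumes "xor_np A"
  shows "\<exists>k\<ge>1. A \<in> BH k"
proof -
  obtain Hs where Hs: "\<forall>H\<in>set Hs. certifiable H" "\<forall>x. x \<in> A \<longleftrightarrow> odd (hits x Hs)"
    using assms unfolding xor_np_def by blast
  have "{x. odd (min (hits x Hs) (Suc (length Hs)))} \<in> BH (Suc (length Hs))"
    using Hs(1) by (intro parity_BH certifiable_NP certifiable_hits)
  \<comment> \<open>At most \<open>length Hs\<close> languages can be hit, so the level
    \<open>Suc (length Hs)\<close> truncates nothing.\<close>
  moreover have "min (hits x Hs) (Suc (length Hs)) = hits x Hs" for x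
    unfolding hits_def by (intro min_absorb1 le_SucI length_filter_le)
  moreover have "A = {x. odd (hits x Hs)}" using Hs(2) by blast
  ultimately have "A \<in> BH (Suc (length Hs))" by simp
  then show ?thesis by (metis One_nat_def Suc_le_mono zero_le)
qed

section \<open>The upper bound\<close>

lemma finite_fv [simp]: "finite (fv \<phi>)"
  by (induction \<phi>) auto

lemma set_free_vars [simp]: "set (free_vars \<phi>) = fv \<phi>"
  by (simp add: free_vars_def)

lemma sat_cong: "(\<And>v. v \<in> fv \<phi> \<Longrightarrow> \<sigma> v = \<sigma>' v) \<Longrightarrow> sat n t \<sigma> \<phi> = sat n t \<sigma>' \<phi>"
proof (induction \<phi> arbitrary: \<sigma> \<sigma>')
  case (Exists x \<phi>)
  have "sat n t (\<sigma>(x := e)) \<phi> = sat n t (\<sigma>'(x := e)) \<phi>" for e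
    using Exists.prems by (intro Exists.IH) auto
  then show ?case by simp
next
  case (Forall x \<phi>)
  have "sat n t (\<sigma>(x := e)) \<phi> = sat n t (\<sigma>'(x := e)) \<phi>" for e
    using Forall.prems by (intro Forall.IH) auto
  then show ?case by simp
next
  case (Conj \<phi> \<psi>)
  have "sat n t \<sigma> \<phi> = sat n t \<sigma>' \<phi>" "sat n t \<sigma> \<psi> = sat n t \<sigma>' \<psi>"
    using Conj.prems by (intro Conj.IH; simp)+
  then show ?case by simp
next
  case (Disj \<phi> \<psi>)
  have "sat n t \<sigma> \<phi> = sat n t \<sigma>' \<phi>" "sat n t \<sigma> \<psi> = sat n t \<sigma>' \<psi>"
    using Disj.prems by (intro Disj.IH; simp)+
  then show ?case by simp
next
  case (Impl \<phi> \<psi>)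
  have "sat n t \<sigma> \<phi> = sat n t \<sigma>' \<phi>" "sat n t \<sigma> \<psi> = sat n t \<sigma>' \<psi>"
    using Impl.prems by (intro Impl.IH; simp)+
  then show ?case by simp
next
  case (Neg \<phi>)
  have "sat n t \<sigma> \<phi> = sat n t \<sigma>' \<phi>"
    using Neg.prems by (intro Neg.IH) simp
  then show ?case by simp
qed auto

section \<open>Certificates as sequences of instances\<close>

definition block :: "nat \<Rightarrow> (nat \<Rightarrow> bool option) \<Rightarrow> nat \<Rightarrow> pinst" where
  "block n F j = map (\<lambda>i. F (j * n + i)) [0..<n]"

lemma nth_concat_blocks:
  "\<forall>e\<in>set es. length e = n \<Longrightarrow> j < length es \<Longrightarrow> i < n \<Longrightarrow> concat es ! (j * n + i) = es ! j ! i"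
proof (induction es arbitrary: j)
  case (Cons e es)
  then show ?case by (cases j) (auto simp: nth_append)
qed simp

lemma block_index: "j < m \<Longrightarrow> i < n \<Longrightarrow> j * n + i < m * (n :: nat)"
proof -
  assume "j < m" "i < n"
  then have "j * n + i < Suc j * n" by simp
  also have "\<dots> \<le> m * n" using \<open>j < m\<close> by (intro mult_right_mono) auto
  finally show ?thesis .
qed

lemma block_concat:
  assumes "\<forall>e\<in>set es. length e = n" "j < length es" "\<And>q. q < length es * n \<Longrightarrow> F q = concat es ! q"
  shows "block n F j = es ! j"
proof (rule nth_equalityI)
  show "length (block n F j) = length (es ! j)" using assms by (simp add: block_def)
  show "block n F j ! i = es ! j ! i" if "i < length (block n F j)" for i
    using that assms(3)[OF block_index[OF assms(2)]] nth_concat_blocks[OF assms(1,2)]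
    by (simp add: block_def)
qed

text \<open>Two bits of the certificate encode a value: whether it is defined, and which bit it is.\<close>

definition cert_val :: "bool list \<Rightarrow> nat \<Rightarrow> bool option" where
  "cert_val u q = (if nthd False u (2 * q) then Some (nthd False u (2 * q + 1)) else None)"

lemma cert_val_exists: "\<exists>u. length u = 2 * length vs \<and> (\<forall>q<length vs. cert_val u q = vs ! q)"
proof (induction vs)
  case (Cons v vs)
  then obtain u where u: "length u = 2 * length vs" "\<forall>q<length vs. cert_val u q = vs ! q" by blast
  have s: "cert_val (a # b # u) (Suc q) = cert_val u q" for a b q
    by (simp add: cert_val_def nthd_def)
  have z: "cert_val ((v \<noteq> None) # (v = Some True) # u) 0 = v"
    by (cases v) (auto simp: cert_val_def nthd_def)
  show ?case
    using u s z by (intro exI[of _ "(v \<noteq> None) # (v = Some True) # u"]) (auto simp: nth_Cons split: nat.split)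
qed simp

lemma fp_cert_val [fpi]: "fp u \<Longrightarrow> fp q \<Longrightarrow> fp (\<lambda>x. cert_val (u x) (q x))"
  unfolding cert_val_def by (intro fpi)

lemma fp_block:
  assumes "fp n" "fp (\<lambda>p. F (fst p) (snd p))"
  shows "fp (\<lambda>x. block (n x) (F x) j)"
  unfolding block_def
  by (intro fpi assms fp_comp[OF assms(2), of "\<lambda>p. (fst p, j * n (fst p) + snd p)", simplified] fp_fst_comp[OF assms(1)])

text \<open>The reversal places inner bindings in front, so that \<open>lookup\<close> finds them
  before an outer binding of the same variable.\<close>

lemma sat_foldr_Exists:
  "sat n t (lookup al) (foldr Exists xs \<phi>) \<longleftrightarrow>
    (\<exists>ds. length ds = length xs \<and> (\<forall>d\<in>set ds. length d = n) \<and> sat n t (lookup (rev (zip xs ds) @ al)) \<phi>)"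
proof (induction xs arbitrary: al)
  case (Cons x xs)
  have "sat n t (lookup al) (foldr Exists (x # xs) \<phi>) \<longleftrightarrow>
      (\<exists>d. length d = n \<and> sat n t (lookup ((x, d) # al)) (foldr Exists xs \<phi>))" by simp
  also have "\<dots> \<longleftrightarrow> (\<exists>d ds. length d = n \<and> length ds = length xs \<and> (\<forall>d\<in>set ds. length d = n) \<and>
      sat n t (lookup (rev (zip xs ds) @ (x, d) # al)) \<phi>)"
    unfolding Cons by blast
  also have "\<dots> \<longleftrightarrow> (\<exists>ds. length ds = length (x # xs) \<and> (\<forall>d\<in>set ds. length d = n) \<and>
      sat n t (lookup (rev (zip (x # xs) ds) @ al)) \<phi>)"
  proof
    assume "\<exists>d ds. length d = n \<and> length ds = length xs \<and> (\<forall>d\<in>set ds. length d = n) \<and>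
      sat n t (lookup (rev (zip xs ds) @ (x, d) # al)) \<phi>"
    then obtain d ds where "length d = n" "length ds = length xs" "\<forall>d\<in>set ds. length d = n"
      "sat n t (lookup (rev (zip xs ds) @ (x, d) # al)) \<phi>" by blast
    then show "\<exists>ds. length ds = length (x # xs) \<and> (\<forall>d\<in>set ds. length d = n) \<and>
      sat n t (lookup (rev (zip (x # xs) ds) @ al)) \<phi>"
      by (intro exI[of _ "d # ds"]) simp
  next
    assume "\<exists>ds. length ds = length (x # xs) \<and> (\<forall>d\<in>set ds. length d = n) \<and>
      sat n t (lookup (rev (zip (x # xs) ds) @ al)) \<phi>"
    then obtain ds0 where ds0: "length ds0 = length (x # xs)" "\<forall>d\<in>set ds0. length d = n"
      "sat n t (lookup (rev (zip (x # xs) ds0) @ al)) \<phi>" by blast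
    obtain d ds where "ds0 = d # ds" using ds0(1) by (cases ds0) auto
    with ds0 show "\<exists>d ds. length d = n \<and> length ds = length xs \<and> (\<forall>d\<in>set ds. length d = n) \<and>
      sat n t (lookup (rev (zip xs ds) @ (x, d) # al)) \<phi>"
      by (intro exI[of _ d] exI[of _ ds]) simp
  qed
  finally show ?case .
qed simp

lemma sat_foldr_Forall: "sat n t \<sigma> (foldr Forall xs \<phi>) = (\<not> sat n t \<sigma> (foldr Exists xs (Neg \<phi>)))"
  by (induction xs arbitrary: \<sigma>) auto

lemma fv_foldr: "fv (foldr Exists xs \<phi>) = fv \<phi> - set xs" "fv (foldr Forall xs \<phi>) = fv \<phi> - set xs"
  by (induction xs) auto

text \<open>\<open>V\<close> may contain more variables than \<open>\<psi>\<close> has: subformulas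
  are evaluated on inputs made for the whole formula, so that one encoding serves the entire
  induction over Boolean combinations.\<close>

definition sub_lang :: "nat list \<Rightarrow> fm \<Rightarrow> lang" where
  "sub_lang V \<psi> = {enc_input n t es | n t es. valid_input (length V) n t es \<and> sat n t (assign V es) \<psi>}"

lemma Eval_sub_lang: "Eval \<phi> = sub_lang (free_vars \<phi>) \<phi>"
  unfolding Eval_def sub_lang_def valid_input_def by simp

lemma enc_input_in_sub_lang:
  assumes "valid_input (length V) n t es"
  shows "enc_input n t es \<in> sub_lang V \<psi> \<longleftrightarrow> sat n t (assign V es) \<psi>"
proof
  assume "enc_input n t es \<in> sub_lang V \<psi>"
  then obtain n' t' es' where "enc_input n t es = enc_input n' t' es'"
    "valid_input (length V) n' t' es'" "sat n' t' (assign V es') \<psi>"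
    unfolding sub_lang_def by blast
  then show "sat n t (assign V es) \<psi>"
    using enc_input_inj[of n t es n' t' es'] assms by (simp add: valid_input_def)
next
  assume "sat n t (assign V es) \<psi>"
  then show "enc_input n t es \<in> sub_lang V \<psi>" using assms unfolding sub_lang_def by blast
qed

definition valid_lang :: "nat \<Rightarrow> lang" where
  "valid_lang m = {x. snd (snd (snd (parse m x)))}"

lemma valid_lang_iff: "x \<in> valid_lang m \<longleftrightarrow> (\<exists>n t es. x = enc_input n t es \<and> valid_input m n t es)"
  unfolding valid_lang_def using parse_sound parse_enc_input by fastforce

lemma sub_lang_valid: "sub_lang V \<psi> \<subseteq> valid_lang (length V)"
  unfolding sub_lang_def valid_lang_iff subset_iff by blast

text \<open>A plain complement would also contain strings that encode no input; intersecting with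
  \<open>valid_lang\<close> removes them.\<close>

lemma sub_lang_cong:
  assumes "\<And>n t es. valid_input (length V) n t es \<Longrightarrow> sat n t (assign V es) \<psi> \<longleftrightarrow> enc_input n t es \<in> A"
  shows "sub_lang V \<psi> = valid_lang (length V) \<inter> A"
proof (rule set_eqI)
  fix x
  show "x \<in> sub_lang V \<psi> \<longleftrightarrow> x \<in> valid_lang (length V) \<inter> A"
    using assms enc_input_in_sub_lang[of V _ _ _ \<psi>] sub_lang_valid[of V \<psi>] valid_lang_iff[of x "length V"] by blast
qed

lemma certifiable_valid_lang: "certifiable (valid_lang m)"
  unfolding valid_lang_def
  by (rule certifiable_fp, unfold mem_Collect_eq) (intro fpi fp_comp[OF fp_parse])

lemma lookup_zip_assign:
  assumes "v \<in> set V" "length es = length V"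
  shows "lookup (zip V es) v = assign V es v"
proof -
  have "map_of (zip V es) v \<noteq> None" using assms by simp
  then show ?thesis unfolding lookup_def assign_def by auto
qed

lemma certifiable_Exists:
  assumes "dt_foil \<phi>" "fv (foldr Exists xs \<phi>) \<subseteq> set V"
  shows "certifiable (sub_lang V (foldr Exists xs \<phi>))"
proof -
  let ?\<psi> = "foldr Exists xs \<phi>" and ?m = "length V"
  obtain g where g: "fp g" "decides g \<phi>"
    using decidable_dt_foil[OF assms(1)] by (rule decidableE)
  define as where "as = (\<lambda>n vs. map (\<lambda>j. (V ! j, block n (nthd None vs) j)) [0..<?m])"
  define ds where "ds = (\<lambda>n u. map (\<lambda>j. block n (cert_val u) j) [0..<length xs])"
  \<comment> \<open>Bits missing from the certificate are read as undefined values, so every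
    certificate yields instances of the right dimension and soundness holds for all lengths.\<close>
  define h where "h = (\<lambda>p. let q = parse ?m (fst p) in snd (snd (snd q)) \<and>
    g (fst q, node_list (fst q) (fst (snd q)), pos_list (fst q) (fst (snd q)),
       rev (map (\<lambda>j. (xs ! j, block (fst q) (cert_val (snd p)) j)) [0..<length xs]) @ as (fst q) (fst (snd (snd q)))))"
  have zip_ds: "map (\<lambda>j. (xs ! j, block n (cert_val u) j)) [0..<length xs] = zip xs (ds n u)" for n u
    by (rule nth_equalityI) (auto simp: ds_def)
  have "fp h"
    unfolding h_def Let_def as_def
    by (intro fpi fp_comp[OF g(1)] fp_comp[OF fp_parse] fp_map_const fp_block)
  moreover have h: "h (enc_input n t es, u) \<longleftrightarrow> sat n t (lookup (rev (zip xs (ds n u)) @ zip V es)) \<phi>"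
    if valid: "valid_input ?m n t es" for n t es u
  proof -
    have "block n (nthd None (concat es)) j = es ! j" if "j < ?m" for j
      using that valid length_concat_blocks[of es n]
      by (intro block_concat) (auto simp: valid_input_def nthd_def)
    then have as: "as n (concat es) = zip V es"
      using valid by (intro nth_equalityI) (auto simp: as_def valid_input_def)
    let ?al = "rev (zip xs (ds n u)) @ zip V es"
    have "length (lookup ?al v) = n" if "v \<in> fv \<phi>" for v
    proof -
      have "v \<in> set xs \<union> set V" using that assms(2) unfolding fv_foldr by blast
      then have "v \<in> fst ` set ?al"
        using valid by (auto simp: valid_input_def ds_def image_Un simp flip: set_map)
      then obtain e where e: "map_of ?al v = Some e"
        by (metis map_of_eq_None_iff not_None_eq)
      then have "(v, e) \<in> set ?al" by (rule map_of_SomeD)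
      then have "length e = n"
        using valid by (auto simp: valid_input_def ds_def block_def dest!: set_zip_rightD)
      then show ?thesis using e by (simp add: lookup_def)
    qed
    then have "g (env_of n t ?al) = sat n t (lookup ?al) \<phi>"
      using g(2) unfolding decides_def by blast
    then show ?thesis
      unfolding h_def Let_def by (simp only: fst_conv snd_conv parse_enc_input[OF valid] as zip_ds simp_thms)
  qed
  have assign: "sat n t (assign V es) ?\<psi> = sat n t (lookup (zip V es)) ?\<psi>" if "valid_input ?m n t es" for n t es
    using assms(2) lookup_zip_assign[of _ V es] that by (intro sat_cong) (auto simp: valid_input_def)
  show ?thesis unfolding certifiable_def
  proof (intro exI[of _ h] exI[of _ "\<lambda>x. 2 * (length xs * length x)"] conjI allI impI ballI)
    show "fp h" by fact
    \<comment> \<open>Two bits for each of the \<open>length xs * n\<close> values, where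
      \<open>n \<le> length x\<close> because the dimension is written in unary.\<close>
    show "pb UNIV length (\<lambda>x. 2 * (length xs * length x))" by (intro pb_intros pb_id)
    fix x u assume hx: "h (x, u)"
    then have "x \<in> valid_lang ?m" by (simp add: h_def Let_def valid_lang_def)
    then obtain n t es where x: "x = enc_input n t es" "valid_input ?m n t es"
      unfolding valid_lang_iff by blast
    have "sat n t (lookup (zip V es)) ?\<psi>"
      unfolding sat_foldr_Exists
      using hx h[OF x(2)] x(1) by (intro exI[of _ "ds n u"]) (auto simp: ds_def block_def)
    then show "x \<in> sub_lang V ?\<psi>"
      unfolding x(1) enc_input_in_sub_lang[OF x(2)] assign[OF x(2)] .
  next
    fix x assume "x \<in> sub_lang V ?\<psi>"
    then obtain n t es where x: "x = enc_input n t es" "valid_input ?m n t es" "sat n t (assign V es) ?\<psi>"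
      unfolding sub_lang_def by blast
    then obtain ds' where ds': "length ds' = length xs" "\<forall>d\<in>set ds'. length d = n"
      "sat n t (lookup (rev (zip xs ds') @ zip V es)) \<phi>"
      unfolding assign[OF x(2)] sat_foldr_Exists by blast
    obtain u where u: "length u = 2 * length (concat ds')" "\<forall>q<length (concat ds'). cert_val u q = concat ds' ! q"
      using cert_val_exists by blast
    have len: "length (concat ds') = length xs * n" using length_concat_blocks[OF ds'(2)] ds'(1) by simp
    have "block n (cert_val u) j = ds' ! j" if "j < length ds'" for j
      using u(2) len ds' that by (intro block_concat) auto
    then have "ds n u = ds'" using ds'(1) by (intro nth_equalityI) (auto simp: ds_def)
    then have "h (x, u)" using h[OF x(2)] ds'(3) x(1) by simp
    moreover have "n \<le> length x" unfolding x(1) by (simp add: enc_input_def enc_nat_def)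
    ultimately show "\<exists>u. length u \<le> 2 * (length xs * length x) \<and> h (x, u)"
      using u(1) len by (intro exI[of _ u]) simp
  qed
qed

text \<open>A DT-FOIL formula is the case of an empty prefix. A universal prefix is the complement
  of an existential one over the negated matrix, which is again in DT-FOIL.\<close>

lemma xor_np_q_dt_foil: "q_dt_foil \<psi> \<Longrightarrow> fv \<psi> \<subseteq> set V \<Longrightarrow> xor_np (sub_lang V \<psi>)"
proof (induction rule: q_dt_foil.induct)
  case (1 \<phi>)
  then show ?case using certifiable_Exists[of \<phi> "[]" V] xor_np_certifiable by simp
next
  case (2 \<phi>)
  have "sub_lang V (Neg \<phi>) = valid_lang (length V) \<inter> - sub_lang V \<phi>"
    by (rule sub_lang_cong) (simp add: enc_input_in_sub_lang)
  then show ?case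
    using 2 by (auto intro: xor_np_Int xor_np_Compl xor_np_certifiable certifiable_valid_lang)
next
  case (3 \<phi> \<psi>)
  have "sub_lang V (Conj \<phi> \<psi>) = valid_lang (length V) \<inter> (sub_lang V \<phi> \<inter> sub_lang V \<psi>)"
    by (rule sub_lang_cong) (simp add: enc_input_in_sub_lang)
  then show ?case
    using 3 by (auto intro: xor_np_Int xor_np_certifiable certifiable_valid_lang)
next
  case (4 \<phi> \<psi>)
  have "sub_lang V (Disj \<phi> \<psi>) = valid_lang (length V) \<inter> (sub_lang V \<phi> \<union> sub_lang V \<psi>)"
    by (rule sub_lang_cong) (simp add: enc_input_in_sub_lang)
  then show ?case
    using 4 by (auto intro: xor_np_Int xor_np_Un xor_np_certifiable certifiable_valid_lang)
next
  case (5 \<phi> \<psi>)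
  have "sub_lang V (Impl \<phi> \<psi>) = valid_lang (length V) \<inter> (- sub_lang V \<phi> \<union> sub_lang V \<psi>)"
    by (rule sub_lang_cong) (simp add: enc_input_in_sub_lang)
  then show ?case
    using 5 by (auto intro: xor_np_Int xor_np_Un xor_np_Compl xor_np_certifiable certifiable_valid_lang)
next
  case (6 \<phi> xs)
  then show ?case by (intro xor_np_certifiable certifiable_Exists)
next
  case (7 \<phi> xs)
  have "sub_lang V (foldr Forall xs \<phi>) = valid_lang (length V) \<inter> - sub_lang V (foldr Exists xs (Neg \<phi>))"
    by (rule sub_lang_cong) (simp add: enc_input_in_sub_lang sat_foldr_Forall)
  moreover have "certifiable (sub_lang V (foldr Exists xs (Neg \<phi>)))"
    using 7 by (intro certifiable_Exists dt_foil.intros(2)) (auto simp: fv_foldr)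
  ultimately show ?case
    by (auto intro: xor_np_Int xor_np_Compl xor_np_certifiable certifiable_valid_lang)
qed

lemma Eval_in_BH: "q_dt_foil \<phi> \<Longrightarrow> \<exists>k\<ge>1. Eval \<phi> \<in> BH k"
  unfolding Eval_sub_lang by (intro xor_np_BH xor_np_q_dt_foil) auto

section \<open>Computations as satisfiability\<close>

declare step.simps [simp del]

subsection \<open>Runs with head-relative cells\<close>

locale machine =
  fixes M :: tm
  assumes wf: "wf_tm M"
begin

abbreviation K where "K \<equiv> n_tapes M"

text \<open>A step ignores the transition function in the halting state 1.\<close>

definition tr :: "nat \<Rightarrow> nat list \<Rightarrow> nat \<times> (nat \<times> move) list" where
  "tr q ss = (if q = 1 then (1, idle ss) else delta M q ss)"

definition cfg :: "bool list \<Rightarrow> nat \<Rightarrow> config" where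
  "cfg w t = (step M ^^ t) (init_config M w)"

definition st :: "bool list \<Rightarrow> nat \<Rightarrow> nat" where
  "st w t = fst (cfg w t)"

text \<open>With positions counted from the head, the scanned cell is always at 0 and a head move
  appears as a shift of all cells. Facts about a step are therefore local without mentioning where
  the head is.\<close>

definition cell :: "bool list \<Rightarrow> nat \<Rightarrow> nat \<Rightarrow> int \<Rightarrow> nat" where
  "cell w t j p = (let tp = snd (cfg w t) ! j in fst tp (snd tp + p))"

definition scanned :: "bool list \<Rightarrow> nat \<Rightarrow> nat list" where
  "scanned w t = map (\<lambda>j. cell w t j 0) [0..<K]"

definition acts :: "bool list \<Rightarrow> nat \<Rightarrow> (nat \<times> move) list" where
  "acts w t = snd (tr (st w t) (scanned w t))"

lemma step_tr: "step M (q, ts) = (fst (tr q (heads ts)), map2 act (snd (tr q (heads ts))) ts)"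
  using act_idle[of ts] by (auto simp: tr_def heads_def step.simps split: prod.splits)

lemma tr_bounds:
  assumes "q < n_states M" "length ss = K" "set ss \<subseteq> {..<n_syms M}"
  shows "fst (tr q ss) < n_states M" "length (snd (tr q ss)) = K" "fst ` set (snd (tr q ss)) \<subseteq> {..<n_syms M}"
proof -
  obtain q' as where *: "delta M q ss = (q', as)" by fastforce
  then show "fst (tr q ss) < n_states M" "length (snd (tr q ss)) = K" "fst ` set (snd (tr q ss)) \<subseteq> {..<n_syms M}"
    using wf assms unfolding wf_tm_def by (auto simp: tr_def idle_def)
qed

lemma cfg_0: "cfg w 0 = init_config M w"
  by (simp add: cfg_def)

lemma cfg_Suc: "cfg w (Suc t) = step M (cfg w t)"
  by (simp add: cfg_def)

lemma cfg_inv: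
  "st w t < n_states M \<and> length (snd (cfg w t)) = K \<and>
    (\<forall>j<K. (\<forall>i. fst (snd (cfg w t) ! j) i < n_syms M) \<and> \<bar>snd (snd (cfg w t) ! j)\<bar> \<le> int t)"
proof (induction t)
  case 0
  have "n_tapes M \<ge> 1" "n_states M \<ge> 2" "n_syms M \<ge> 3" using wf by (auto simp: wf_tm_def)
  then show ?case
    by (auto simp: st_def cfg_0 init_config_def nth_Cons content_def split: nat.splits)
next
  case (Suc t)
  obtain q ts where c: "cfg w t = (q, ts)" by fastforce
  have q: "q < n_states M" and ts: "length ts = K"
    and cells: "\<And>j i. j < K \<Longrightarrow> fst (ts ! j) i < n_syms M" and pos: "\<And>j. j < K \<Longrightarrow> \<bar>snd (ts ! j)\<bar> \<le> int t"
    using Suc by (auto simp: c st_def)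
  have hd: "length (heads ts) = K" "set (heads ts) \<subseteq> {..<n_syms M}"
  proof -
    have "heads ts ! j < n_syms M" if "j < K" for j
      using that ts cells by (simp add: heads_def split_beta)
    moreover show "length (heads ts) = K" by (simp add: heads_def ts)
    ultimately show "set (heads ts) \<subseteq> {..<n_syms M}" by (auto simp: in_set_conv_nth)
  qed
  note b = tr_bounds[OF q hd]
  have sh: "\<bar>shift d\<bar> \<le> 1" for d by (cases d) auto
  have "(\<forall>i. fst (act a tp) i < n_syms M) \<and> \<bar>snd (act a tp)\<bar> \<le> int (Suc t)"
    if "fst a < n_syms M" "\<forall>i. fst tp i < n_syms M" "\<bar>snd tp\<bar> \<le> int t" for a tp
    using that sh[of "snd a"] by (cases a; cases tp) auto
  moreover have "fst (snd (tr q (heads ts)) ! j) < n_syms M" if "j < K" for j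
    using b that by (auto simp: subset_iff)
  ultimately show ?case
    using b ts cells pos by (auto simp: cfg_Suc c step_tr st_def)
qed

lemma scanned_heads: "scanned w t = heads (snd (cfg w t))"
  using cfg_inv[of w t] by (intro nth_equalityI) (auto simp: scanned_def heads_def cell_def Let_def split_beta)

lemma st_less: "st w t < n_states M"
  using cfg_inv[of w t] by blast

lemma cell_less: "j < K \<Longrightarrow> cell w t j p < n_syms M"
  using cfg_inv[of w t] by (simp add: cell_def Let_def)

lemma scanned_props: "length (scanned w t) = K" "set (scanned w t) \<subseteq> {..<n_syms M}"
  by (auto simp: scanned_def cell_less)

lemma length_acts: "length (acts w t) = K"
  unfolding acts_def by (rule tr_bounds[OF st_less scanned_props])

lemma acts_less: "j < K \<Longrightarrow> fst (acts w t ! j) < n_syms M"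
  using tr_bounds(3)[OF st_less scanned_props, of w t w t] length_acts[of w t]
  by (auto simp: acts_def subset_iff)

lemma st_Suc: "st w (Suc t) = fst (tr (st w t) (scanned w t))"
  unfolding scanned_heads by (cases "cfg w t") (simp add: st_def cfg_Suc step_tr)

lemma cell_Suc:
  assumes "j < K"
  shows "cell w (Suc t) j p =
    (if p = - shift (snd (acts w t ! j)) then fst (acts w t ! j) else cell w t j (p + shift (snd (acts w t ! j))))"
proof -
  obtain q ts where c: "cfg w t = (q, ts)" by fastforce
  have len: "length ts = K" using cfg_inv[of w t] by (simp add: c)
  have as: "acts w t = snd (tr q (heads ts))"
    unfolding acts_def scanned_heads by (simp add: st_def c)
  obtain s d where a: "acts w t ! j = (s, d)" by fastforce
  obtain f h where f: "ts ! j = (f, h)" by fastforce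
  have "snd (cfg w (Suc t)) ! j = act (acts w t ! j) (ts ! j)"
    using assms len length_acts[of w t] by (simp add: cfg_Suc c step_tr as)
  then show ?thesis by (auto simp: cell_def Let_def a f c algebra_simps)
qed

lemma st_0: "st w 0 = 0"
  by (simp add: st_def cfg_0 init_config_def)

lemma cell_0: "j < K \<Longrightarrow> cell w 0 j p = content (if j = 0 then w else []) p"
  by (auto simp: cell_def Let_def cfg_0 init_config_def nth_Cons split: nat.splits)

text \<open>The output is only located up to the position of the head, which is at most \<open>T\<close> away
  from the origin.\<close>

lemma last_cell:
  assumes "computes_within M w y T"
  shows "\<exists>h. \<bar>h\<bar> \<le> int T \<and> (\<forall>p. cell w T (K - 1) p = content y (p + h))"
proof -
  obtain t ts where t: "t \<le> T" "(step M ^^ t) (init_config M w) = (1, ts)" "fst (last ts) = content y"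
    using assms unfolding computes_within_def by blast
  \<comment> \<open>A halted configuration is a fixed point, so the output reached at time
    \<open>t\<close> is still there at time \<open>T\<close>.\<close>
  have idle: "(step M ^^ i) (1, ts) = (1, ts)" for i by (induction i) (auto simp: step.simps)
  obtain i where "T = i + t" using t(1) by (metis add.commute le_Suc_ex)
  then have c: "cfg w T = (1, ts)"
    using t(2) idle by (simp add: cfg_def funpow_add)
  have K: "K \<ge> 1" using wf by (simp add: wf_tm_def)
  have len: "length ts = K" "\<bar>snd (ts ! (K - 1))\<bar> \<le> int T"
    using cfg_inv[of w T] K by (auto simp: c)
  have "last ts = ts ! (K - 1)" using len K by (metis last_conv_nth length_0_conv not_one_le_zero)
  then have "cell w T (K - 1) p = content y (p + snd (ts ! (K - 1)))" for p
    using t(3) by (simp add: cell_def Let_def c add.commute)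
  then show ?thesis using len(2) by blast
qed

end

subsection \<open>The clauses\<close>

text \<open>A clause is given by the assignments to its variables that violate it.\<close>

type_synonym clause = "(nat \<times> bool) list"

definition satisfies :: "(nat \<Rightarrow> bool) \<Rightarrow> clause list \<Rightarrow> bool" where
  "satisfies v F \<longleftrightarrow> (\<forall>c\<in>set F. \<exists>l\<in>set c. v (fst l) \<noteq> snd l)"

lemma satisfies_append [simp]: "satisfies v (F @ G) \<longleftrightarrow> satisfies v F \<and> satisfies v G"
  by (auto simp: satisfies_def)

lemma satisfies_concat_map [simp]:
  "satisfies v (concat (map f xs)) \<longleftrightarrow> (\<forall>x\<in>set xs. satisfies v (f x))"
  by (auto simp: satisfies_def)

lemma satisfies_Cons [simp]: "satisfies v (c # F) \<longleftrightarrow> (\<exists>l\<in>set c. v (fst l) \<noteq> snd l) \<and> satisfies v F"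
  by (auto simp: satisfies_def)

lemma satisfies_Nil [simp]: "satisfies v []"
  by (simp add: satisfies_def)

text \<open>
  Codes of the facts "relative to its head, tape \<open>j\<close> contains \<open>s\<close>", "the state is \<open>q\<close>" and
  "head \<open>j\<close> moves in direction \<open>d\<close>".  In \<open>var\<close> they are combined with a time and a position; the
  latter is 0 for states and moves.
\<close>

definition sC :: "nat \<Rightarrow> nat \<Rightarrow> nat" where "sC j s = prod_encode (0, prod_encode (j, s))"
definition sQ :: "nat \<Rightarrow> nat" where "sQ q = prod_encode (1, q)"
definition sD :: "nat \<Rightarrow> move \<Rightarrow> nat" where
  "sD j d = prod_encode (case d of MLeft \<Rightarrow> 2 | MStay \<Rightarrow> 3 | MRight \<Rightarrow> 4, j)"

lemma s_inject [simp]: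
  "sC j s = sC j' s' \<longleftrightarrow> j = j' \<and> s = s'" "sQ q = sQ q' \<longleftrightarrow> q = q'" "sD j d = sD j' d' \<longleftrightarrow> j = j' \<and> d = d'"
  "sC j s \<noteq> sQ q" "sQ q \<noteq> sC j s" "sC j s \<noteq> sD j' d" "sD j' d \<noteq> sC j s" "sQ q \<noteq> sD j d" "sD j d \<noteq> sQ q"
  by (auto simp: sC_def sQ_def sD_def split: move.splits)

definition var :: "nat \<Rightarrow> nat \<Rightarrow> nat \<Rightarrow> nat \<Rightarrow> nat \<Rightarrow> nat" where
  "var P S t p c = (t * P + p) * S + c"

lemma var_decode:
  assumes "p < P" "c < S"
  shows "var P S t p c mod S = c" "var P S t p c div S mod P = p" "var P S t p c div S div P = t"
proof -
  have "(t * P + p) mod P = p" "(t * P + p) div P = t" using assms(1) by auto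
  moreover have "var P S t p c mod S = c" "var P S t p c div S = t * P + p" using assms(2) by (auto simp: var_def)
  ultimately show "var P S t p c mod S = c" "var P S t p c div S mod P = p" "var P S t p c div S div P = t" by auto
qed

lemma var_inject:
  "p < P \<Longrightarrow> c < S \<Longrightarrow> p' < P \<Longrightarrow> c' < S \<Longrightarrow> var P S t p c = var P S t' p' c' \<longleftrightarrow> t = t' \<and> p = p' \<and> c = c'"
  by (metis var_decode)

lemma fp_var [fpi]: "fp P \<Longrightarrow> fp t \<Longrightarrow> fp p \<Longrightarrow> fp c \<Longrightarrow> fp (\<lambda>x. var (P x) S (t x) (p x) (c x))"
  unfolding var_def by (intro fpi)

text \<open>The head-relative position after a move \<open>d\<close> of the cell that was at
  \<open>p\<close> before it: when the head goes left, the cell appears one further to the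
  right.\<close>

fun pos_before :: "move \<Rightarrow> nat \<Rightarrow> nat" where
  "pos_before MLeft p = p + 1"
| "pos_before MStay p = p"
| "pos_before MRight p = p - 1"

lemma fp_pos_before [fpi]: "fp p \<Longrightarrow> fp (\<lambda>x. pos_before d (p x))"
  by (cases d) (auto intro!: fpi)

lemma pos_before_int: "0 < p \<Longrightarrow> int (pos_before d p) = int p - shift d"
  by (cases d) auto

lemma pos_before_less: "p < P - 1 \<Longrightarrow> pos_before d p < P"
  by (cases d) auto

lemma fp_concat_map_const:
  "(\<And>v. v \<in> set V \<Longrightarrow> fp (g v)) \<Longrightarrow> fp (\<lambda>x. concat (map (\<lambda>v. g v x) V))"
  by (intro fp_concat fp_map_const)

context machine
begin

definition codes :: "nat set" where
  "codes = sQ ` {..<n_states M} \<union> (\<lambda>(j, s). sC j s) ` ({..<K} \<times> {..<n_syms M}) \<union>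
     (\<lambda>(j, d). sD j d) ` ({..<K} \<times> {MLeft, MStay, MRight})"

definition S :: nat where "S = Suc (Max codes)"

lemma code_less: "c \<in> codes \<Longrightarrow> c < S"
proof -
  have "finite codes" by (simp add: codes_def)
  then show "c \<in> codes \<Longrightarrow> c < S" by (simp add: S_def less_Suc_eq_le)
qed

lemma codes_less [simp]:
  "q < n_states M \<Longrightarrow> sQ q < S" "j < K \<Longrightarrow> s < n_syms M \<Longrightarrow> sC j s < S" "j < K \<Longrightarrow> sD j d < S"
  by (auto intro!: code_less simp: codes_def image_iff) (cases d; auto)

lemma machine_bounds: "0 < K" "Suc 0 < n_states M" "2 < n_syms M"
  using wf by (auto simp: wf_tm_def)

abbreviation vr where "vr P t p c \<equiv> var P S t p c"

definition body :: "nat \<Rightarrow> nat \<Rightarrow> nat \<Rightarrow> nat \<Rightarrow> nat list \<Rightarrow> clause" where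
  "body P Z t q ss = (vr P t 0 (sQ q), True) # map (\<lambda>j. (vr P t Z (sC j (ss ! j)), True)) [0..<K]"

definition consequences :: "nat \<Rightarrow> nat \<Rightarrow> nat \<Rightarrow> nat \<Rightarrow> nat list \<Rightarrow> clause" where
  "consequences P Z t q ss = (vr P (Suc t) 0 (sQ (fst (tr q ss))), False) #
     concat (map (\<lambda>j. [(vr P t 0 (sD j (snd (snd (tr q ss) ! j))), False),
       (vr P (Suc t) (pos_before (snd (snd (tr q ss) ! j)) Z) (sC j (fst (snd (tr q ss) ! j))), False)]) [0..<K])"

text \<open>Implications in violated form: all premises in \<open>body\<close> hold and one
  consequence fails. The table ranges over all states and scanned tuples, finitely many for a fixed
  machine.\<close>

definition trans_clauses :: "nat \<Rightarrow> nat \<Rightarrow> nat \<Rightarrow> clause list" where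
  "trans_clauses P Z t = concat (map (\<lambda>qs. map (\<lambda>l. body P Z t (fst qs) (snd qs) @ [l])
     (consequences P Z t (fst qs) (snd qs)))
     (List.product [0..<n_states M] (List.n_lists K [0..<n_syms M])))"

text \<open>Position \<open>Z\<close> is left out because the scanned cell is rewritten; its new
  content is fixed by \<open>consequences\<close>.\<close>

definition move_clauses :: "nat \<Rightarrow> nat \<Rightarrow> nat \<Rightarrow> nat \<Rightarrow> clause list" where
  "move_clauses P Z t p = (if p = Z then [] else concat (map (\<lambda>j. concat (map (\<lambda>s. map (\<lambda>d.
     [(vr P t 0 (sD j d), True), (vr P t p (sC j s), True), (vr P (Suc t) (pos_before d p) (sC j s), False)])
     [MLeft, MStay, MRight]) [0..<n_syms M])) [0..<K]))"

text \<open>In the free region a cell holds a blank or a bit, and a blank forces its right neighbour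
  to be blank. The unknown part is therefore a contiguous string directly after \<open>w\<close>,
  possibly shorter than the space allotted.\<close>

definition input_clauses :: "nat \<Rightarrow> nat \<Rightarrow> bool list \<Rightarrow> nat \<Rightarrow> nat \<Rightarrow> clause list" where
  "input_clauses P Z w N p =
     (if p < Z \<or> Z + N \<le> p then [[(vr P 0 p (sC 0 0), False)]]
      else if p - Z < length w
      then [[(vr P 0 p (if nthd False w (p - Z) then sC 0 2 else sC 0 1), False)]]
      else [[(vr P 0 p (sC 0 0), False), (vr P 0 p (sC 0 1), False), (vr P 0 p (sC 0 2), False)],
            [(vr P 0 p (sC 0 0), True), (vr P 0 (Suc p) (sC 0 0), False)]])"

definition blank_clauses :: "nat \<Rightarrow> nat \<Rightarrow> clause list" where
  "blank_clauses P p = map (\<lambda>j. [(vr P 0 p (sC j 0), False)]) [1..<K]"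

text \<open>
  The input is \<open>w\<close> followed by an unknown string, of total length at most \<open>N\<close>.  Position \<open>Z\<close> is
  the position of the head; the last clauses reject runs with output 0.
\<close>

definition tableau :: "nat \<Rightarrow> nat \<Rightarrow> bool list \<Rightarrow> nat \<Rightarrow> nat \<Rightarrow> clause list" where
  "tableau P Z w N T = [[(vr P 0 0 (sQ 0), False)]] @
     concat (map (\<lambda>p. input_clauses P Z w N p @ blank_clauses P p) [0..<P]) @
     concat (map (\<lambda>t. trans_clauses P Z t @ concat (map (\<lambda>p. move_clauses P Z t p) [1..<P - 1])) [0..<T]) @
     map (\<lambda>p. [(vr P T p (sC (K - 1) 1), True)]) [0..<P]"

lemma fp_body [fpi]: "fp P \<Longrightarrow> fp Z \<Longrightarrow> fp t \<Longrightarrow> fp (\<lambda>x. body (P x) (Z x) (t x) q ss)"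
  unfolding body_def by (rule fp_Cons[OF _ fp_map_const]) (intro fpi; assumption)+

lemma fp_consequences [fpi]:
  "fp P \<Longrightarrow> fp Z \<Longrightarrow> fp t \<Longrightarrow> fp (\<lambda>x. consequences (P x) (Z x) (t x) q ss)"
  unfolding consequences_def by (rule fp_Cons[OF _ fp_concat_map_const]) (intro fpi; assumption)+

lemma fp_trans_clauses [fpi]:
  assumes "fp P" "fp Z" "fp t"
  shows "fp (\<lambda>x. trans_clauses (P x) (Z x) (t x))"
  unfolding trans_clauses_def
  by (rule fp_concat_map_const, rule fp_map)
    (intro fpi assms fp_fst_comp[OF assms(1)] fp_fst_comp[OF assms(2)] fp_fst_comp[OF assms(3)])+

lemma fp_move_clauses [fpi]:
  assumes "fp P" "fp Z" "fp t" "fp p"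
  shows "fp (\<lambda>x. move_clauses (P x) (Z x) (t x) (p x))"
  unfolding move_clauses_def
  by (rule fp_if, intro fpi assms, rule fp_const, (rule fp_concat_map_const)+, rule fp_map_const, intro fpi assms)

lemma fp_input_clauses [fpi]:
  assumes "fp P" "fp Z" "fp w" "fp N" "fp p"
  shows "fp (\<lambda>x. input_clauses (P x) (Z x) (w x) (N x) (p x))"
  unfolding input_clauses_def by (intro fpi assms)

lemma fp_blank_clauses [fpi]:
  assumes "fp P" "fp p"
  shows "fp (\<lambda>x. blank_clauses (P x) (p x))"
  unfolding blank_clauses_def by (rule fp_map_const) (intro fpi assms)

lemma fp_tableau:
  assumes "fp P" "fp Z" "fp w" "fp N" "fp T"
  shows "fp (\<lambda>x. tableau (P x) (Z x) (w x) (N x) (T x))"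
  unfolding tableau_def
  by (intro fpi assms fp_fst_comp[OF assms(1)] fp_fst_comp[OF assms(2)] fp_fst_comp[OF assms(3)]
      fp_fst_comp[OF assms(4)] fp_fst_comp[OF assms(5)]
      fp_fst_comp[OF fp_fst_comp[OF assms(1)]] fp_fst_comp[OF fp_fst_comp[OF assms(2)]])

lemma satisfies_implications:
  "satisfies v (map (\<lambda>l. b @ [l]) ls) \<Longrightarrow> \<forall>l\<in>set b. v (fst l) = snd l \<Longrightarrow> l \<in> set ls \<Longrightarrow> v (fst l) \<noteq> snd l"
  by (auto simp: satisfies_def)

subsection \<open>Every model contains the run\<close>

context
  fixes v w0 N T P Z
  assumes sat: "satisfies v (tableau P Z w0 N T)"
    and P: "P = 4 * T + 3" and Z: "Z = 2 * T + 1" and NT: "N \<le> T"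
begin

lemma model_trans:
  assumes "t < T" "v (vr P t 0 (sQ (st w t)))" "\<And>j. j < K \<Longrightarrow> v (vr P t Z (sC j (cell w t j 0)))"
  shows "v (vr P (Suc t) 0 (sQ (st w (Suc t))))"
    "\<And>j. j < K \<Longrightarrow> v (vr P t 0 (sD j (snd (acts w t ! j))))"
    "\<And>j. j < K \<Longrightarrow> v (vr P (Suc t) (pos_before (snd (acts w t ! j)) Z) (sC j (fst (acts w t ! j))))"
proof -
  let ?q = "st w t" and ?ss = "scanned w t"
  have "satisfies v (trans_clauses P Z t)"
    using sat assms(1) by (auto simp: tableau_def)
  moreover have "(?q, ?ss) \<in> set (List.product [0..<n_states M] (List.n_lists K [0..<n_syms M]))"
    using st_less scanned_props[of w t] by (auto simp: set_n_lists)
  ultimately have "satisfies v (map (\<lambda>l. body P Z t ?q ?ss @ [l]) (consequences P Z t ?q ?ss))"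
    unfolding trans_clauses_def satisfies_concat_map by fastforce
  moreover have "\<forall>l\<in>set (body P Z t ?q ?ss). v (fst l) = snd l"
    using assms(2,3) by (auto simp: body_def scanned_def)
  ultimately have c: "\<And>l. l \<in> set (consequences P Z t ?q ?ss) \<Longrightarrow> v (fst l) \<noteq> snd l"
    by (rule satisfies_implications)
  show "v (vr P (Suc t) 0 (sQ (st w (Suc t))))"
    using c[of "(vr P (Suc t) 0 (sQ (fst (tr ?q ?ss))), False)"] by (simp add: consequences_def st_Suc)
  fix j assume "j < K"
  then have "(vr P t 0 (sD j (snd (acts w t ! j))), False) \<in> set (consequences P Z t ?q ?ss)"
    "(vr P (Suc t) (pos_before (snd (acts w t ! j)) Z) (sC j (fst (acts w t ! j))), False)
      \<in> set (consequences P Z t ?q ?ss)"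
    unfolding consequences_def acts_def by (auto intro!: bexI[of _ j])
  from this[THEN c] show "v (vr P t 0 (sD j (snd (acts w t ! j))))"
    "v (vr P (Suc t) (pos_before (snd (acts w t ! j)) Z) (sC j (fst (acts w t ! j))))"
    by simp_all
qed

lemma model_move:
  assumes "t < T" "1 \<le> p" "p < P - 1" "p \<noteq> Z" "j < K" "s < n_syms M"
    "v (vr P t 0 (sD j d))" "v (vr P t p (sC j s))"
  shows "v (vr P (Suc t) (pos_before d p) (sC j s))"
proof -
  have "satisfies v (move_clauses P Z t p)"
    using sat assms(1-3) by (auto simp: tableau_def)
  then show ?thesis using assms(4-) by (cases d) (auto simp: move_clauses_def)
qed

text \<open>Only facts of the true run are derived; a model may satisfy further ones. A step
  computes a cell from its neighbours, so the controlled window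
  \<open>\<bar>p\<bar> \<le> 2 * T - t\<close> shrinks by one on each side. With
  \<open>Z = 2 * T + 1\<close> and \<open>P = 4 * T + 3\<close> it starts at the indices 1 to
  \<open>4 * T + 1\<close>, where no shift leaves the range, and at time \<open>T\<close> it still
  covers distance \<open>T\<close> from the head.\<close>

lemma model_run:
  assumes init: "\<And>p. p < P \<Longrightarrow> v (vr P 0 p (sC 0 (content w (int p - int Z))))"
  shows "t \<le> T \<Longrightarrow> v (vr P t 0 (sQ (st w t))) \<and>
    (\<forall>j<K. \<forall>p. \<bar>p\<bar> \<le> 2 * int T - int t \<longrightarrow> v (vr P t (nat (p + int Z)) (sC j (cell w t j p))))"
proof (induction t)
  case 0
  have blank: "v (vr P 0 p (sC j 0))" if "p < P" "j < K" "0 < j" for p j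
  proof -
    have "satisfies v (blank_clauses P p)" using sat that(1) by (simp add: tableau_def)
    then show ?thesis using that by (auto simp: blank_clauses_def satisfies_def)
  qed
  have "v (vr P 0 (nat (p + int Z)) (sC j (cell w 0 j p)))" if "j < K" "\<bar>p\<bar> \<le> 2 * int T" for j p
  proof -
    have p: "nat (p + int Z) < P" "int (nat (p + int Z)) - int Z = p" using that(2) by (auto simp: P Z)
    show ?thesis
    proof (cases "j = 0")
      case True
      then show ?thesis using init[OF p(1)] p(2) by (simp add: cell_0 machine_bounds)
    next
      case False
      moreover have "content [] p = 0" by (auto simp: content_def)
      ultimately show ?thesis using blank[OF p(1) that(1)] by (simp add: cell_0 that)
    qed
  qed
  moreover have "v (vr P 0 0 (sQ 0))" using sat by (simp add: tableau_def)
  ultimately show ?case by (simp add: st_0)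
next
  case (Suc t)
  then have t: "t < T" and IH: "v (vr P t 0 (sQ (st w t)))"
    "\<And>j p. j < K \<Longrightarrow> \<bar>p\<bar> \<le> 2 * int T - int t \<Longrightarrow> v (vr P t (nat (p + int Z)) (sC j (cell w t j p)))"
    by auto
  have c: "\<And>j. j < K \<Longrightarrow> v (vr P t Z (sC j (cell w t j 0)))"
    using IH(2)[of _ 0] t by simp
  have tr: "v (vr P (Suc t) 0 (sQ (st w (Suc t))))"
    "\<And>j. j < K \<Longrightarrow> v (vr P t 0 (sD j (snd (acts w t ! j))))"
    "\<And>j. j < K \<Longrightarrow> v (vr P (Suc t) (pos_before (snd (acts w t ! j)) Z) (sC j (fst (acts w t ! j))))"
    using model_trans[OF t IH(1)] c by blast+
  have "v (vr P (Suc t) (nat (p + int Z)) (sC j (cell w (Suc t) j p)))"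
    if j: "j < K" and p: "\<bar>p\<bar> \<le> 2 * int T - int (Suc t)" for j p
  proof -
    let ?d = "snd (acts w t ! j)"
    have sh: "\<bar>shift ?d\<bar> \<le> 1" by (cases ?d) auto
    show ?thesis
    proof (cases "p = - shift ?d")
      case True
      have "nat (p + int Z) = pos_before ?d Z"
        using pos_before_int[of Z ?d] True by (simp add: Z)
      then show ?thesis using tr(3)[OF j] True by (simp add: cell_Suc[OF j])
    next
      case False
      let ?p = "nat (p + shift ?d + int Z)"
      have ip: "int ?p = p + shift ?d + int Z" using p sh t by (simp add: Z)
      have "v (vr P t ?p (sC j (cell w t j (p + shift ?d))))"
        using IH(2)[OF j, of "p + shift ?d"] p sh by simp
      then have "v (vr P (Suc t) (pos_before ?d ?p) (sC j (cell w t j (p + shift ?d))))"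
        using ip p sh t False tr(2)[OF j] j by (intro model_move cell_less) (auto simp: P Z)
      moreover have "pos_before ?d ?p = nat (p + int Z)"
      proof -
        have "0 < ?p" using p sh t by (simp add: Z)
        then have "int (pos_before ?d ?p) = p + int Z" using pos_before_int[of ?p ?d] ip by linarith
        then show ?thesis by (metis nat_int)
      qed
      ultimately show ?thesis using False by (simp add: cell_Suc[OF j])
    qed
  qed
  then show ?case using tr(1) by simp
qed

text \<open>The first blank \<open>m\<close> in the free region marks the end of the word: blanks
  propagate to the right up to \<open>N\<close>, and everything from \<open>N\<close> on is blank by
  a clause.\<close>

lemma model_input:
  assumes "length w0 \<le> N"
  shows "\<exists>u. length (w0 @ u) \<le> N \<and> (\<forall>p<P. v (vr P 0 p (sC 0 (content (w0 @ u) (int p - int Z)))))"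
proof -
  define has where "has i s = v (vr P 0 (Z + i) (sC 0 s))" for i s
  have cl: "satisfies v (input_clauses P Z w0 N p)" if "p < P" for p
    using sat that by (auto simp: tableau_def)
  have low: "v (vr P 0 p (sC 0 0))" if "p < Z" for p
    using cl[of p] that by (simp add: input_clauses_def P Z)
  have high: "has i 0" if "N \<le> i" "Z + i < P" for i
    using cl[of "Z + i"] that by (simp add: input_clauses_def has_def)
  have input: "has i (bit_sym (w0 ! i))" if "i < length w0" for i
    using cl[of "Z + i"] that assms NT by (auto simp: input_clauses_def has_def P Z nthd_def split: if_splits)
  have free: "has i 0 \<or> has i 1 \<or> has i 2" "has i 0 \<longrightarrow> has (Suc i) 0" if "length w0 \<le> i" "i < N" for i
    using cl[of "Z + i"] that NT by (auto simp: input_clauses_def has_def P Z)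
  define m where "m = (LEAST i. length w0 \<le> i \<and> has i 0)"
  have N0: "length w0 \<le> N \<and> has N 0" using high[of N] assms NT by (simp add: P Z)
  have m: "length w0 \<le> m" "has m 0" using LeastI[of "\<lambda>i. length w0 \<le> i \<and> has i 0", OF N0] by (auto simp: m_def)
  have mN: "m \<le> N" unfolding m_def by (rule Least_le) (rule N0)
  have notblank: "\<not> has i 0" if "length w0 \<le> i" "i < m" for i
    using not_less_Least[of i "\<lambda>i. length w0 \<le> i \<and> has i 0"] that by (auto simp: m_def)
  have blank: "has i 0" if "m \<le> i" "Z + i < P" for i
    using that
  proof (induction i)
    case 0
    then show ?case using m by simp
  next
    case (Suc i)
    show ?case
    proof (cases "m = Suc i")
      case True
      then show ?thesis using m by simp
    next
      case False
      then show ?thesis using Suc free(2)[of i] high[of "Suc i"] m(1) by (cases "i < N") auto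
    qed
  qed
  \<comment> \<open>A model may put both bits into one cell; then 1 is chosen. A cell before
    \<open>m\<close> is not blank, so without symbol 2 it must hold symbol 1.\<close>
  define u where "u = map (\<lambda>i. has (length w0 + i) 2) [0..<m - length w0]"
  have len: "length (w0 @ u) = m" using m(1) by (simp add: u_def)
  have "has i (content (w0 @ u) (int i))" if "Z + i < P" for i
  proof (cases "i < m")
    case False
    then show ?thesis using blank that len by (simp add: content_def)
  next
    case True
    then have *: "content (w0 @ u) (int i) = bit_sym ((w0 @ u) ! i)" using len by (simp add: content_def)
    show ?thesis
    proof (cases "i < length w0")
      case True
      then show ?thesis using input * by (simp add: nth_append)
    next
      case False
      then have "i - length w0 < m - length w0" using True by linarith
      with False have "(w0 @ u) ! i = has i 2" by (simp add: nth_append u_def)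
      then show ?thesis using free(1)[of i] notblank[of i] False True mN unfolding * by auto
    qed
  qed
  then have "v (vr P 0 p (sC 0 (content (w0 @ u) (int p - int Z))))" if "p < P" for p
  proof (cases "p < Z")
    case True
    then show ?thesis using low by (simp add: content_def)
  next
    case False
    then obtain i where "p = Z + i" by (metis le_Suc_ex not_less)
    then show ?thesis using \<open>\<And>i. Z + i < P \<Longrightarrow> has i (content (w0 @ u) (int i))\<close>[of i] that
      by (simp add: has_def)
  qed
  then show ?thesis using len mN by metis
qed

text \<open>Symbol 1, the bit 0, is forbidden on the whole last tape at time \<open>T\<close>. A
  rejecting run has it at the origin, which is at distance at most \<open>T\<close> from the head
  and thus in the window where the model agrees with the run.\<close>

lemma model_accepts:
  assumes "length w0 \<le> N"
    and "\<And>w. length w \<le> N \<Longrightarrow> computes_within M w [w \<in> V] T"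
  shows "\<exists>u. length (w0 @ u) \<le> N \<and> w0 @ u \<in> V"
proof -
  obtain u where u: "length (w0 @ u) \<le> N" "\<forall>p<P. v (vr P 0 p (sC 0 (content (w0 @ u) (int p - int Z))))"
    using model_input[OF assms(1)] by blast
  let ?w = "w0 @ u"
  obtain h where h: "\<bar>h\<bar> \<le> int T" "\<And>p. cell ?w T (K - 1) p = content [?w \<in> V] (p + h)"
    using last_cell[OF assms(2)[OF u(1)]] by blast
  have "v (vr P T (nat (- h + int Z)) (sC (K - 1) (cell ?w T (K - 1) (- h))))"
  proof -
    have "\<forall>j<K. \<forall>p. \<bar>p\<bar> \<le> 2 * int T - int T \<longrightarrow> v (vr P T (nat (p + int Z)) (sC j (cell ?w T j p)))"
      using model_run[of ?w T] u(2) by blast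
    moreover have "K - 1 < K" "\<bar>- h\<bar> \<le> 2 * int T - int T" using h(1) machine_bounds(1) by auto
    ultimately show ?thesis by blast
  qed
  moreover have "\<not> v (vr P T (nat (- h + int Z)) (sC (K - 1) 1))"
  proof -
    have "nat (- h + int Z) < P" using h(1) by (auto simp: P Z)
    then show ?thesis using sat by (auto simp: tableau_def satisfies_def[of _ "map _ _"])
  qed
  ultimately have "?w \<in> V" using h(2)[of "- h"] by (auto simp: content_def split: if_splits)
  then show ?thesis using u(1) by blast
qed

end

subsection \<open>The accepting run is a model\<close>

text \<open>The codes of states, moves and symbols are disjoint, so at most one disjunct applies to
  a variable; state and move facts hold irrespective of the position.\<close>

definition run_model :: "bool list \<Rightarrow> nat \<Rightarrow> nat \<Rightarrow> nat \<Rightarrow> bool" where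
  "run_model w P Z f \<longleftrightarrow> (let c = f mod S; p = f div S mod P; t = f div S div P in
     c = sQ (st w t) \<or> (\<exists>j<K. c = sD j (snd (acts w t ! j))) \<or>
     (\<exists>j<K. c = sC j (cell w t j (int p - int Z))))"

lemma run_model_iff:
  "p < P \<Longrightarrow> q < n_states M \<Longrightarrow> run_model w P Z (vr P t p (sQ q)) \<longleftrightarrow> q = st w t"
  "p < P \<Longrightarrow> j < K \<Longrightarrow> run_model w P Z (vr P t p (sD j d)) \<longleftrightarrow> d = snd (acts w t ! j)"
  "p < P \<Longrightarrow> j < K \<Longrightarrow> s < n_syms M \<Longrightarrow>
    run_model w P Z (vr P t p (sC j s)) \<longleftrightarrow> s = cell w t j (int p - int Z)"
  unfolding run_model_def Let_def by (simp_all add: var_decode)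

lemma run_model_trans:
  assumes "0 < Z" "Z + 1 < P"
  shows "satisfies (run_model w P Z) (trans_clauses P Z t)"
proof -
  have "\<exists>l\<in>set (body P Z t q ss @ [l]). run_model w P Z (fst l) \<noteq> snd l"
    if q: "q < n_states M" and ss: "length ss = K" "set ss \<subseteq> {..<n_syms M}"
      and l: "l \<in> set (consequences P Z t q ss)" for q ss l
  \<comment> \<open>Only the entry with the actual state and scanned symbols has true premises; the
    clauses of all other entries hold through a false premise.\<close>
  proof (cases "q = st w t \<and> ss = scanned w t")
    case False
    then have "q \<noteq> st w t \<or> (\<exists>j<K. ss ! j \<noteq> cell w t j 0)"
      using ss(1) by (auto simp: scanned_def list_eq_iff_nth_eq)
    moreover have "ss ! j < n_syms M" if "j < K" for j using ss that by (auto simp: subset_iff)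
    ultimately show ?thesis
      using assms q by (force simp: body_def run_model_iff)
  next
    case True
    have "run_model w P Z (fst l) \<noteq> snd l"
    proof -
      have sQ': "fst (tr q ss) < n_states M" using True st_less[of w "Suc t"] by (simp add: st_Suc)
      have "pos_before d Z < P" for d using assms by (cases d) auto
      moreover have "int (pos_before d Z) - int Z = - shift d" for d using assms(1) pos_before_int[of Z d] by simp
      ultimately show ?thesis
        using l True assms sQ' acts_less[of _ w t]
        by (auto simp: consequences_def acts_def[symmetric] run_model_iff st_Suc cell_Suc)
    qed
    then show ?thesis by simp
  qed
  then show ?thesis
    unfolding trans_clauses_def satisfies_concat_map
    by (auto simp: set_n_lists satisfies_def atLeast0LessThan)
qed

lemma run_model_move:
  assumes "0 < p" "p < P - 1"
  shows "satisfies (run_model w P Z) (move_clauses P Z t p)"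
proof -
  have c: "\<exists>l\<in>set [(vr P t 0 (sD j d), True), (vr P t p (sC j s), True), (vr P (Suc t) (pos_before d p) (sC j s), False)].
      run_model w P Z (fst l) \<noteq> snd l" if "p \<noteq> Z" "j < K" "s < n_syms M" for j s d
  proof -
    have "int (pos_before d p) - int Z = int p - int Z - shift d" using pos_before_int[OF assms(1)] by simp
    then show ?thesis
      using assms that pos_before_less[OF assms(2), of d]
      by (auto simp: run_model_iff cell_Suc)
  qed
  show ?thesis using c[of _ _ MLeft] c[of _ _ MStay] c[of _ _ MRight] by (auto simp: move_clauses_def)
qed

lemma run_model_input:
  assumes "length w0 \<le> length w" "length w \<le> N" "take (length w0) w = w0" "p < P" "Z + N < P"
  shows "satisfies (run_model w P Z) (input_clauses P Z w0 N p)"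
proof -
  have c: "run_model w P Z (vr P 0 p' (sC 0 s)) \<longleftrightarrow> s = content w (int p' - int Z)"
    if "p' < P" "s \<le> 2" for p' s
    using that machine_bounds by (simp add: run_model_iff cell_0)
  consider (blank) "p < Z \<or> Z + N \<le> p" | (given) "Z \<le> p" "p - Z < length w0"
    | (free) "Z \<le> p" "p < Z + N" "\<not> p - Z < length w0" by linarith
  then show ?thesis
  proof cases
    case blank
    then have "content w (int p - int Z) = 0" using assms(2) by (auto simp: content_def)
    then show ?thesis using blank c[of p 0] assms(4) by (simp add: input_clauses_def)
  next
    case given
    have "w ! (p - Z) = w0 ! (p - Z)" using assms(3) given(2) by (metis nth_take)
    then have "content w (int p - int Z) = (if nthd False w0 (p - Z) then 2 else 1)"
      using given assms(1) by (auto simp: content_def nthd_def nat_diff_distrib)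
    moreover have "\<not> (p < Z \<or> Z + N \<le> p)" using given assms(1,2) by linarith
    ultimately show ?thesis
      using given c[of p 1] c[of p 2] assms(4) by (simp add: input_clauses_def)
  next
    case free
    have "content w (int p - int Z) = 0 \<or> content w (int p - int Z) = 1 \<or> content w (int p - int Z) = 2"
      by (simp add: content_def)
    then have 1: "run_model w P Z (vr P 0 p (sC 0 0)) \<or> run_model w P Z (vr P 0 p (sC 0 1)) \<or>
        run_model w P Z (vr P 0 p (sC 0 2))"
      using c[OF assms(4), of 0] c[OF assms(4), of 1] c[OF assms(4), of 2] by fastforce
    have "content w (int p - int Z) = 0 \<Longrightarrow> content w (int (Suc p) - int Z) = 0"
      using free by (simp add: content_def split: if_splits)
    then have 2: "run_model w P Z (vr P 0 p (sC 0 0)) \<longrightarrow> run_model w P Z (vr P 0 (Suc p) (sC 0 0))"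
      using c[OF assms(4), of 0] c[of "Suc p" 0] free assms(5) by simp
    have "input_clauses P Z w0 N p =
       [[(vr P 0 p (sC 0 0), False), (vr P 0 p (sC 0 1), False), (vr P 0 p (sC 0 2), False)],
        [(vr P 0 p (sC 0 0), True), (vr P 0 (Suc p) (sC 0 0), False)]]"
      using free by (simp add: input_clauses_def)
    then show ?thesis using 1 2 by (simp add: satisfies_def)
  qed
qed

lemma run_model_blank:
  assumes "p < P"
  shows "satisfies (run_model w P Z) (blank_clauses P p)"
proof -
  have "content [] i = 0" for i by (auto simp: content_def)
  then show ?thesis
    using assms machine_bounds by (auto simp: blank_clauses_def satisfies_def run_model_iff cell_0)
qed

lemma run_model_tableau:
  assumes "P = 4 * T + 3" "Z = 2 * T + 1" "N \<le> T" "length (w0 @ u) \<le> N"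
    and "computes_within M (w0 @ u) [True] T"
  shows "satisfies (run_model (w0 @ u) P Z) (tableau P Z w0 N T)"
proof -
  obtain h where h: "\<And>p. cell (w0 @ u) T (K - 1) p = content [True] (p + h)"
    using last_cell[OF assms(5)] by blast
  \<comment> \<open>The output \<open>[True]\<close> leaves symbol 2 as the only nonblank one on the
    last tape.\<close>
  have "\<not> run_model (w0 @ u) P Z (vr P T p (sC (K - 1) 1))" if "p < P" for p
    using that machine_bounds h by (simp add: run_model_iff) (auto simp: content_def)
  then have "satisfies (run_model (w0 @ u) P Z) (map (\<lambda>p. [(vr P T p (sC (K - 1) 1), True)]) [0..<P])"
    by (auto simp: satisfies_def)
  moreover have "run_model (w0 @ u) P Z (vr P 0 0 (sQ 0))"
    using machine_bounds assms(1) by (simp add: run_model_iff st_0)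
  moreover have "satisfies (run_model (w0 @ u) P Z) (input_clauses P Z w0 N p @ blank_clauses P p)"
    if "p < P" for p
    using that assms(1-4) by (simp add: run_model_input run_model_blank)
  moreover have "satisfies (run_model (w0 @ u) P Z) (trans_clauses P Z t)" for t
    using assms(1,2) by (intro run_model_trans) auto
  moreover have "satisfies (run_model (w0 @ u) P Z) (move_clauses P Z t p)" if "p \<in> set [1..<P - 1]" for t p
    using that by (intro run_model_move) auto
  ultimately show ?thesis
    unfolding tableau_def by simp
qed

text \<open>Needed because a clause is going to be a path of a decision tree, on which no feature
  may repeat.\<close>

lemma distinct_tableau:
  assumes "P = 4 * T + 3" "Z = 2 * T + 1" "N \<le> T" "c \<in> set (tableau P Z w N T)"
  shows "distinct (map fst c)"
proof -
  have Z: "0 < Z" "Z + 1 < P" using assms(1,2) by auto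
  have pb: "pos_before d p < P" if "p < P - 1" for d p using that by (rule pos_before_less)
  have trans: "distinct (map fst (body P Z t q ss @ [l]))"
    if "q < n_states M" "length ss = K" "set ss \<subseteq> {..<n_syms M}" "l \<in> set (consequences P Z t q ss)" for t q ss l
  proof -
    have ss: "ss ! j < n_syms M" if "j < K" for j using \<open>length ss = K\<close> \<open>set ss \<subseteq> _\<close> that by (auto simp: subset_iff)
    have as: "fst (tr q ss) < n_states M" "length (snd (tr q ss)) = K" "fst ` set (snd (tr q ss)) \<subseteq> {..<n_syms M}"
      using tr_bounds that by auto
    then have "fst (snd (tr q ss) ! j) < n_syms M" if "j < K" for j using that by (auto simp: subset_iff)
    then have "fst l \<notin> set (map fst (body P Z t q ss))"
      using that(1,4) ss as(1) Z pb[of Z] by (auto simp: body_def consequences_def var_inject)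
    moreover have "distinct (map fst (body P Z t q ss))"
      using that(1) ss Z by (auto simp: body_def var_inject distinct_map inj_on_def)
    ultimately show ?thesis by simp
  qed
  have move: "distinct (map fst [(vr P t 0 (sD j d), True), (vr P t p (sC j s), True), (vr P (Suc t) (pos_before d p) (sC j s), False)])"
    if "j < K" "s < n_syms M" "0 < p" "p < P - 1" for t j d s p
    using that pb[of p d] by (auto simp: var_inject)
  have input: "distinct (map fst c)" if "c \<in> set (input_clauses P Z w N p)" "p < P" for p
    using that machine_bounds assms(1-3) by (auto simp: input_clauses_def var_inject split: if_splits)
  have trans': "distinct (map fst c)" if "c \<in> set (trans_clauses P Z t)" for t
  proof -
    from that obtain q ss l where "q < n_states M" "length ss = K" "set ss \<subseteq> {..<n_syms M}"
      "l \<in> set (consequences P Z t q ss)" "c = body P Z t q ss @ [l]"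
      by (auto simp: trans_clauses_def set_n_lists atLeast0LessThan)
    then show ?thesis using trans by blast
  qed
  have move': "distinct (map fst c)" if "c \<in> set (move_clauses P Z t p)" "p \<in> set [1..<P - 1]" for t p
  proof -
    from that(1) obtain j s d where "j < K" "s < n_syms M"
      "c = [(vr P t 0 (sD j d), True), (vr P t p (sC j s), True), (vr P (Suc t) (pos_before d p) (sC j s), False)]"
      by (auto simp: move_clauses_def simp del: pos_before.simps split: if_splits)
    moreover have "0 < p" "p < P - 1" using that(2) by auto
    ultimately show ?thesis using move by blast
  qed
  have blank': "distinct (map fst c)" if "c \<in> set (blank_clauses P p)" for p
    using that by (auto simp: blank_clauses_def)
  from assms(4) consider "c = [(vr P 0 0 (sQ 0), False)]"
    | p where "p < P" "c \<in> set (input_clauses P Z w N p)" | p where "c \<in> set (blank_clauses P p)"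
    | t where "c \<in> set (trans_clauses P Z t)" | t p where "c \<in> set (move_clauses P Z t p)" "p \<in> set [1..<P - 1]"
    | p where "c = [(vr P T p (sC (K - 1) 1), True)]"
    unfolding tableau_def by auto
  then show ?thesis
    by cases (use input trans' move' blank' in auto)
qed

end

subsection \<open>NP languages reduce to satisfiability\<close>

lemma poly_nat_mono: "x \<le> y \<Longrightarrow> poly (p :: nat poly) x \<le> poly p y"
  by (induction p) (auto intro!: add_mono mult_mono)

lemma NP_satisfiability:
  assumes "A \<in> NP"
  shows "\<exists>F. fp F \<and> (\<forall>x. x \<in> A \<longleftrightarrow> (\<exists>v. satisfies v (F x))) \<and> (\<forall>x. \<forall>c\<in>set (F x). distinct (map fst c))"
proof -
  obtain V p where V: "V \<in> PTIME" "\<And>x. x \<in> A \<longleftrightarrow> (\<exists>u. length u \<le> poly p (length x) \<and> pair_str x u \<in> V)"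
    using assms unfolding NP_def by blast
  then obtain M q where M: "wf_tm M" "\<And>w. computes_within M w [w \<in> V] (poly q (length w))"
    unfolding PTIME_def polytime_def by blast
  interpret machine M using M(1) by unfold_locales
  \<comment> \<open>\<open>pair_str x u\<close> is \<open>w0 x\<close> followed by \<open>u\<close>,
    so the certificate is exactly the unknown end of the input in the tableau.\<close>
  define w0 where "w0 x = pair_str x []" for x
  define N where "N x = length (w0 x) + poly p (length x)" for x
  \<comment> \<open>By monotonicity \<open>poly q (N x)\<close> bounds the time on all words of
    length at most \<open>N x\<close>; the summand \<open>N x\<close> makes the window wide enough
    for the input.\<close>
  define T where "T x = poly q (N x) + N x" for x
  define Z where "Z x = 2 * T x + 1" for x
  define P where "P x = 4 * T x + 3" for x
  define F where "F x = tableau (P x) (Z x) (w0 x) (N x) (T x)" for x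
  have pair: "pair_str x u = w0 x @ u" for x u by (simp add: w0_def pair_str_def)
  have within: "computes_within M w [w \<in> V] (T x)" if "length w \<le> N x" for w x
    using M(2)[of w] poly_nat_mono[OF that, of q] unfolding computes_within_def T_def
    by (meson le_trans trans_le_add1)
  have x_A: "x \<in> A \<longleftrightarrow> (\<exists>u. length (w0 x @ u) \<le> N x \<and> w0 x @ u \<in> V)" for x
    unfolding V(2) pair by (simp add: N_def)
  have NT: "N x \<le> T x" for x by (simp add: T_def)
  have "x \<in> A \<longleftrightarrow> (\<exists>v. satisfies v (F x))" for x
  proof
    assume "x \<in> A"
    then obtain u where u: "length (w0 x @ u) \<le> N x" "w0 x @ u \<in> V" unfolding x_A by blast
    have "computes_within M (w0 x @ u) [True] (T x)" using within[OF u(1)] u(2) by simp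
    from run_model_tableau[OF P_def Z_def NT u(1) this] show "\<exists>v. satisfies v (F x)"
      unfolding F_def by blast
  next
    assume "\<exists>v. satisfies v (F x)"
    then obtain v where "satisfies v (F x)" by blast
    from model_accepts[OF this[unfolded F_def] P_def Z_def NT _ within]
    show "x \<in> A" unfolding x_A by (simp add: N_def)
  qed
  moreover have "fp F"
  proof -
    have "fp w0" unfolding w0_def by (intro fpi)
    then have "fp N" unfolding N_def by (intro fpi)
    then have "fp T" unfolding T_def by (intro fpi)
    then have "fp Z" unfolding Z_def by (intro fpi)
    have "fp P" unfolding P_def by (intro fpi \<open>fp T\<close>)
    show ?thesis unfolding F_def by (intro fp_tableau) fact+
  qed
  moreover have "distinct (map fst c)" if "c \<in> set (F x)" for c x
    using distinct_tableau[OF P_def Z_def NT] that unfolding F_def by blast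
  ultimately show ?thesis by blast
qed

section \<open>Hardness\<close>

subsection \<open>Clauses as a decision tree\<close>

text \<open>The only positive leaf lies at the end of the violating assignment; each deviation from
  it ends at once in a negative leaf.\<close>

primrec clause_tree :: "clause \<Rightarrow> dtree" where
  "clause_tree [] = Leaf True"
| "clause_tree (l # c) = (if snd l then Branch (fst l) (Leaf False) (clause_tree c)
     else Branch (fst l) (clause_tree c) (Leaf False))"

text \<open>Selector features \<open>m, m + 1, \<dots>\<close> along the spine; selector \<open>m + l\<close> with value 0 leads to
  clause \<open>l\<close>.\<close>

primrec spine :: "nat \<Rightarrow> clause list \<Rightarrow> dtree" where
  "spine m [] = Leaf False"
| "spine m (c # F) = Branch m (clause_tree c) (spine (Suc m) F)"

lemma path_Leaf_iff: "path_to (Leaf b) ps u \<longleftrightarrow> ps = [] \<and> u = Leaf b"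
  by (subst path_to.simps) auto

lemma path_Branch_iff:
  "path_to (Branch i t0 t1) ps u \<longleftrightarrow> ps = [] \<and> u = Branch i t0 t1 \<or>
    (\<exists>qs. ps = (i, False) # qs \<and> path_to t0 qs u) \<or> (\<exists>qs. ps = (i, True) # qs \<and> path_to t1 qs u)"
  by (subst path_to.simps) auto

lemma clause_tree_pos: "path_to (clause_tree c) ps (Leaf True) \<longleftrightarrow> ps = c"
proof (induction c arbitrary: ps)
  case (Cons l c)
  obtain i b where "l = (i, b)" by fastforce
  then show ?case by (cases b) (simp_all add: path_Branch_iff path_Leaf_iff Cons)
qed (simp add: path_Leaf_iff)

lemma clause_tree_path:
  "path_to (clause_tree c) ps u \<Longrightarrow> \<exists>k. map fst ps = take k (map fst c)"
proof (induction c arbitrary: ps)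
  case (Cons l c)
  show ?case
  proof (cases ps)
    case Nil
    then show ?thesis by (intro exI[of _ 0]) simp
  next
    case (Cons p qs)
    then have "fst p = fst l" and "qs = [] \<or> path_to (clause_tree c) qs u"
      using Cons.prems by (auto simp: path_Branch_iff path_Leaf_iff split: if_splits)
    then obtain k where "map fst qs = take k (map fst c)" using Cons.IH by (metis list.map(1) take_0)
    then show ?thesis using Cons \<open>fst p = fst l\<close> by (intro exI[of _ "Suc k"]) simp
  qed
qed (auto simp: path_Leaf_iff)

definition selectors :: "nat \<Rightarrow> nat \<Rightarrow> (nat \<times> bool) list" where
  "selectors m l = map (\<lambda>i. (i, True)) [m..<m + l] @ [(m + l, False)]"

lemma selectors_Suc: "selectors m (Suc l) = (m, True) # selectors (Suc m) l"
  by (simp add: selectors_def upt_conv_Cons del: upt_Suc)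

lemma selectors_0: "selectors m 0 = [(m, False)]"
  by (simp add: selectors_def)

lemma fst_selectors: "map fst (selectors m l) = [m..<Suc (m + l)]"
  by (simp add: selectors_def o_def)

lemma spine_pos:
  "path_to (spine m F) ps (Leaf True) \<longleftrightarrow> (\<exists>l<length F. ps = selectors m l @ F ! l)"
proof (induction F arbitrary: m ps)
  case Nil
  then show ?case by (auto simp: path_Leaf_iff)
next
  case (Cons c F)
  have "(\<exists>l<length (c # F). ps = selectors m l @ (c # F) ! l) \<longleftrightarrow>
    ps = (m, False) # c \<or> (\<exists>l<length F. ps = (m, True) # selectors (Suc m) l @ F ! l)"
    by (auto simp: selectors_0 selectors_Suc less_Suc_eq_0_disj)
  then show ?case by (auto simp: path_Branch_iff clause_tree_pos Cons)
qed

lemma spine_path: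
  "path_to (spine m F) ps u \<Longrightarrow>
    \<exists>l k c. l \<le> length F \<and> (c = [] \<or> c \<in> set F) \<and> map fst ps = [m..<m + l] @ take k (map fst c)"
proof (induction F arbitrary: m ps)
  case Nil
  then show ?case by (auto simp: path_Leaf_iff)
next
  case (Cons c F)
  consider "ps = []" | qs where "ps = (m, False) # qs" "path_to (clause_tree c) qs u"
    | qs where "ps = (m, True) # qs" "path_to (spine (Suc m) F) qs u"
    using Cons.prems by (auto simp: path_Branch_iff)
  then show ?case
  proof cases
    case 1
    then show ?thesis by (intro exI[of _ 0] exI[of _ "[]"]) simp
  next
    case 2
    then obtain k where "map fst qs = take k (map fst c)" using clause_tree_path by blast
    then show ?thesis using 2 by (intro exI[of _ 1] exI[of _ k] exI[of _ c]) simp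
  next
    case 3
    then obtain l k c' where "l \<le> length F" "c' = [] \<or> c' \<in> set F"
      "map fst qs = [Suc m..<Suc m + l] @ take k (map fst c')" using Cons.IH by blast
    then show ?thesis using 3
      by (intro exI[of _ "Suc l"] exI[of _ k] exI[of _ c']) (auto simp: upt_conv_Cons simp del: upt_Suc)
  qed
qed

lemma decision_tree_spine:
  assumes "\<And>c. c \<in> set F \<Longrightarrow> distinct (map fst c) \<and> (\<forall>l\<in>set c. fst l < m)"
  shows "decision_tree (m + length F) (spine m F)"
  unfolding decision_tree_def
proof (intro allI impI)
  fix ps b assume "path_to (spine m F) ps (Leaf b)"
  from spine_path[OF this] obtain l k c where l: "l \<le> length F" and c: "c = [] \<or> c \<in> set F"
    and ps: "map fst ps = [m..<m + l] @ take k (map fst c)" by (elim exE conjE)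
  have c': "distinct (map fst c)" "set (map fst c) \<subseteq> {..<m}" using assms[of c] c by auto
  define fs where "fs = take k (map fst c)"
  have fs: "distinct fs" "set fs \<subseteq> {..<m}"
    using distinct_take[OF c'(1)] subset_trans[OF set_take_subset c'(2)] unfolding fs_def by this+
  have eq: "map fst ps = [m..<m + l] @ fs" by (simp only: ps fs_def)
  have "distinct (map fst ps)" "set (map fst ps) \<subseteq> {..<m + length F}"
    unfolding eq using l fs by auto
  then show "distinct (map fst ps) \<and> fst ` set ps \<subseteq> {..<m + length F}" by simp
qed

text \<open>Replaces recursion on the tree by two passes over the clause. Negative leaves to the
  left of the path are written on the way down, those to the right after the positive leaf, the
  innermost first.\<close>

lemma enc_clause_tree:
  "enc_tree (clause_tree c) =
    concat (map (\<lambda>l. True # enc_nat (fst l) @ (if snd l then [False, False] else [])) c) @ [False, True] @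
    concat (map (\<lambda>l. if snd l then [] else [False, False]) (rev c))"
  by (induction c) auto

lemma enc_spine:
  "enc_tree (spine m F) =
    concat (map (\<lambda>l. True # enc_nat (m + l) @ enc_tree (clause_tree (nthd [] F l))) [0..<length F]) @ [False, False]"
proof (induction F arbitrary: m)
  case (Cons c F)
  have upt: "[0..<length (c # F)] = 0 # map Suc [0..<length F]"
    by (simp add: map_Suc_upt upt_conv_Cons del: upt_Suc)
  have "nthd [] (c # F) 0 = c" "nthd [] (c # F) (Suc l) = nthd [] F l" for l
    by (simp_all add: nthd_def)
  then show ?case unfolding upt using Cons by (simp add: o_def)
qed simp

lemma fp_enc_nat [fpi]: "fp n \<Longrightarrow> fp (\<lambda>x. enc_nat (n x))"
  unfolding enc_nat_def by (intro fpi)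

lemma fp_enc_spine [fpi]:
  assumes "fp m" "fp F"
  shows "fp (\<lambda>x. enc_tree (spine (m x) (F x)))"
  unfolding enc_spine enc_clause_tree
  by (intro fpi assms fp_fst_comp[OF assms(1)] fp_fst_comp[OF assms(2)]
      fp_fst_comp[OF fp_fst_comp[OF assms(1)]] fp_fst_comp[OF fp_fst_comp[OF assms(2)]])

lemma enc_val_code: "enc_val v = (case v of None \<Rightarrow> [False] | Some b \<Rightarrow> [True, b])"
  by (cases v) auto

lemma fp_enc_inst [fpi]: "fp e \<Longrightarrow> fp (\<lambda>x. enc_inst (e x))"
  unfolding enc_inst_def enc_val_code by (intro fpi)

subsection \<open>The formulas\<close>

text \<open>Variables 0 and 1 hold the instances that assign 0 and 1, respectively, to all selectors and
  nothing else, and variable \<open>i + 2\<close> holds the instance that only sets feature \<open>i\<close> to 1.\<close>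

definition compat :: "nat \<Rightarrow> nat \<Rightarrow> nat \<Rightarrow> fm" where
  "compat z a b = Exists z (Conj (Sub a z) (Sub b z))"

text \<open>Compatibility with variables 0 and 1 makes the instance undefined on all selectors, so
  it can contradict a positive leaf only at a variable of the clause. \<open>Sub (i + 2) N\<close>
  activates the \<open>i\<close>-th clause set. The quantifier inside \<open>compat\<close> belongs
  to an order formula, so that the unguarded prefix is just the variable \<open>N\<close>.\<close>

definition sat_fm :: "nat \<Rightarrow> nat \<Rightarrow> fm" where
  "sat_fm N i = Exists N (Conj (Sub (i + 2) N) (Conj (compat (N + 2) N 0) (Conj (compat (N + 2) N 1)
     (Forall (N + 1) (Impl (PosLeaf (N + 1)) (Neg (compat (N + 2) N (N + 1))))))))"

lemma q_dt_foil_sat_fm: "q_dt_foil (sat_fm N i)"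
proof -
  let ?\<phi> = "Conj (Sub (i + 2) N) (Conj (compat (N + 2) N 0) (Conj (compat (N + 2) N 1)
     (Forall (N + 1) (Impl (PosLeaf (N + 1)) (Neg (compat (N + 2) N (N + 1)))))))"
  have o: "dt_foil (compat z a b)" "dt_foil (Sub a b)" for z a b
    by (auto intro!: dt_foil.intros(1) simp: compat_def)
  have "dt_foil ?\<phi>"
    by (intro dt_foil.intros(3) o dt_foil.intros(9) dt_foil.intros(2))
  from q_dt_foil.intros(6)[OF this, of "[N]"] show ?thesis by (simp add: sat_fm_def)
qed

lemma fv_sat_fm: "i + 2 < N \<Longrightarrow> fv (sat_fm N i) = {0, 1, i + 2}"
  by (auto simp: sat_fm_def compat_def)

definition compatible :: "pinst \<Rightarrow> pinst \<Rightarrow> bool" where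
  "compatible x y \<longleftrightarrow> (\<forall>i<length x. x ! i = None \<or> y ! i = None \<or> x ! i = y ! i)"

lemma sat_compat:
  assumes "z \<noteq> a" "z \<noteq> b" "length (\<sigma> a) = n" "length (\<sigma> b) = n"
  shows "sat n t \<sigma> (compat z a b) \<longleftrightarrow> compatible (\<sigma> a) (\<sigma> b)"
proof
  assume "sat n t \<sigma> (compat z a b)"
  then obtain e where "subsumed (\<sigma> a) e" "subsumed (\<sigma> b) e" using assms by (auto simp: compat_def)
  then show "compatible (\<sigma> a) (\<sigma> b)"
    unfolding subsumed_def compatible_def by (metis assms(3,4))
next
  assume c: "compatible (\<sigma> a) (\<sigma> b)"
  define e where "e = map (\<lambda>i. if \<sigma> a ! i = None then \<sigma> b ! i else \<sigma> a ! i) [0..<n]"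
  have "subsumed (\<sigma> a) e" "subsumed (\<sigma> b) e" "length e = n"
    using c assms(3,4) by (auto simp: e_def subsumed_def compatible_def)
  then show "sat n t \<sigma> (compat z a b)" using assms by (auto simp: compat_def)
qed

lemma path_inst_nth: "i < n \<Longrightarrow> path_inst n ps ! i = map_of ps i"
  by (simp add: path_inst_def)

text \<open>A partial instance is as good as an assignment: it contradicts each clause at a feature
  where it is defined, so reading undefined features as false does no harm.\<close>

lemma sat_fm_iff:
  assumes N: "i + 2 < N"
    and F: "\<And>c. c \<in> set F \<Longrightarrow> distinct (map fst c) \<and> (\<forall>l\<in>set c. fst l < m)"
    and n: "n = m + length F"
    and sel: "\<sigma> 0 = replicate m None @ replicate (length F) (Some False)"
      "\<sigma> 1 = replicate m None @ replicate (length F) (Some True)"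
    and tag: "\<sigma> (i + 2) = map (\<lambda>j. if j = i then Some True else None) [0..<n]" "i < m"
  shows "sat n (spine m F) \<sigma> (sat_fm N i) \<longleftrightarrow> (\<exists>v. v i \<and> satisfies v F)"
proof -
  have leaf: "is_pos_leaf n (spine m F) y \<longleftrightarrow> (\<exists>l<length F. y = path_inst n (selectors m l @ F ! l))" for y
    unfolding is_pos_leaf_def spine_pos by blast
  have at: "path_inst n (selectors m l @ c) ! f = map_of c f" if "f < m" for l c f
  proof -
    have "f \<notin> fst ` set (selectors m l)"
      using that fst_selectors[of m l] by (metis atLeastLessThan_iff list.set_map not_le set_upt)
    then have "map_of (selectors m l) f = None" by (simp add: map_of_eq_None_iff)
    then show ?thesis using that n by (simp add: path_inst_nth map_add_def)
  qed
  have sem: "sat n (spine m F) \<sigma> (sat_fm N i) \<longleftrightarrow> (\<exists>x. length x = n \<and> subsumed (\<sigma> (i + 2)) x \<and>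
      compatible x (\<sigma> 0) \<and> compatible x (\<sigma> 1) \<and>
      (\<forall>l<length F. \<not> compatible x (path_inst n (selectors m l @ F ! l))))"
  proof -
    have c: "sat n (spine m F) (\<sigma>(N := x)) (compat (N + 2) N 0) \<longleftrightarrow> compatible x (\<sigma> 0)"
      "sat n (spine m F) (\<sigma>(N := x)) (compat (N + 2) N 1) \<longleftrightarrow> compatible x (\<sigma> 1)"
      "length y = n \<Longrightarrow> sat n (spine m F) (\<sigma>(N := x, N + 1 := y)) (compat (N + 2) N (N + 1)) \<longleftrightarrow> compatible x y"
      if "length x = n" for x y
      using that N sel n by (subst sat_compat; simp)+
    have "sat n (spine m F) (\<sigma>(N := x)) (Forall (N + 1) (Impl (PosLeaf (N + 1)) (Neg (compat (N + 2) N (N + 1))))) \<longleftrightarrow>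
        (\<forall>y. length y = n \<longrightarrow> is_pos_leaf n (spine m F) y \<longrightarrow> \<not> compatible x y)" if "length x = n" for x
      unfolding sat.simps fun_upd_same using c(3)[OF that] by (intro all_cong1 imp_cong refl) simp
    then have inner: "sat n (spine m F) (\<sigma>(N := x)) (Forall (N + 1) (Impl (PosLeaf (N + 1)) (Neg (compat (N + 2) N (N + 1))))) \<longleftrightarrow>
        (\<forall>l<length F. \<not> compatible x (path_inst n (selectors m l @ F ! l)))" if "length x = n" for x
      using that length_pos_leaf[of n "spine m F"] leaf by metis
    show ?thesis
      unfolding sat_fm_def sat.simps(1,7,10)
      by (intro ex_cong1 conj_cong refl) (use N c inner in simp_all)
  qed
  show ?thesis unfolding sem
  proof
    assume "\<exists>x. length x = n \<and> subsumed (\<sigma> (i + 2)) x \<and> compatible x (\<sigma> 0) \<and> compatible x (\<sigma> 1) \<and>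
      (\<forall>l<length F. \<not> compatible x (path_inst n (selectors m l @ F ! l)))"
    then obtain x where x: "length x = n" "subsumed (\<sigma> (i + 2)) x" "compatible x (\<sigma> 0)" "compatible x (\<sigma> 1)"
      "\<And>l. l < length F \<Longrightarrow> \<not> compatible x (path_inst n (selectors m l @ F ! l))" by blast
    have none: "x ! f = None" if "m \<le> f" "f < n" for f
    proof -
      have "x ! f = None \<or> x ! f = Some False" "x ! f = None \<or> x ! f = Some True"
        using x(1,3,4) that sel n by (auto simp: compatible_def nth_append)
      then show ?thesis by auto
    qed
    define v where "v f = (x ! f = Some True)" for f
    have "\<sigma> (i + 2) ! i = Some True" "i < length (\<sigma> (i + 2))" using tag n by simp_all
    then have "x ! i = Some True" using x(2) unfolding subsumed_def by force
    then have "v i" by (simp add: v_def)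
    moreover have "\<exists>l\<in>set c. v (fst l) \<noteq> snd l" if c: "c \<in> set F" for c
    proof -
      obtain l where l: "l < length F" "F ! l = c" using c unfolding in_set_conv_nth by blast
      obtain f where f: "f < n" "x ! f \<noteq> None" "path_inst n (selectors m l @ c) ! f \<noteq> None"
        "x ! f \<noteq> path_inst n (selectors m l @ c) ! f"
        using x(5)[OF l(1)] x(1) unfolding l(2) compatible_def by blast
      have "f < m" using none f(1,2) by (meson not_le)
      then obtain b where b: "map_of c f = Some b" "x ! f = Some (\<not> b)"
        using f(2-4) unfolding at[OF \<open>f < m\<close>] by auto
      then show ?thesis by (intro bexI[of _ "(f, b)"]) (auto simp: v_def dest: map_of_SomeD)
    qed
    ultimately show "\<exists>v. v i \<and> satisfies v F" unfolding satisfies_def by blast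
  next
    assume "\<exists>v. v i \<and> satisfies v F"
    then obtain v where v: "v i" "satisfies v F" by blast
    define x where "x = map (\<lambda>f. if f < m then Some (v f) else None) [0..<n]"
    have "\<not> compatible x (path_inst n (selectors m l @ F ! l))" if l: "l < length F" for l
    proof -
      have c: "F ! l \<in> set F" using l by simp
      then obtain p where "p \<in> set (F ! l)" "v (fst p) \<noteq> snd p"
        using v(2) unfolding satisfies_def by blast
      then obtain f b where fb: "(f, b) \<in> set (F ! l)" "v f \<noteq> b" by (metis prod.collapse)
      have "f < m" "map_of (F ! l) f = Some b" using F[OF c] fb by auto
      then have "path_inst n (selectors m l @ F ! l) ! f = Some b" "x ! f = Some (v f)" "f < length x"
        using at n by (auto simp: x_def)
      then show ?thesis using fb(2) unfolding compatible_def by (metis option.inject option.distinct(1))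
    qed
    moreover have "subsumed (\<sigma> (i + 2)) x" using v(1) tag n by (auto simp: subsumed_def x_def)
    moreover have "compatible x (\<sigma> 0)" "compatible x (\<sigma> 1)"
      using sel n by (auto simp: compatible_def x_def nth_append)
    moreover have "length x = n" by (simp add: x_def)
    ultimately show "\<exists>x. length x = n \<and> subsumed (\<sigma> (i + 2)) x \<and> compatible x (\<sigma> 0) \<and> compatible x (\<sigma> 1) \<and>
      (\<forall>l<length F. \<not> compatible x (path_inst n (selectors m l @ F ! l)))" by blast
  qed
qed

subsection \<open>Levels of the hierarchy\<close>

primrec bh_fm :: "(nat \<Rightarrow> fm) \<Rightarrow> nat \<Rightarrow> fm" where
  "bh_fm f 0 = f 0"
| "bh_fm f (Suc k) = (if even k then Conj (bh_fm f k) (Neg (f (Suc k))) else Disj (bh_fm f k) (f (Suc k)))"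

primrec bh_comb :: "(nat \<Rightarrow> bool) \<Rightarrow> nat \<Rightarrow> bool" where
  "bh_comb b 0 = b 0"
| "bh_comb b (Suc k) = (if even k then bh_comb b k \<and> \<not> b (Suc k) else bh_comb b k \<or> b (Suc k))"

lemma bh_comb_cong: "(\<And>i. i \<le> k \<Longrightarrow> b i = b' i) \<Longrightarrow> bh_comb b k = bh_comb b' k"
  by (induction k) auto

lemma sat_bh_fm: "sat n t \<sigma> (bh_fm f k) = bh_comb (\<lambda>i. sat n t \<sigma> (f i)) k"
  by (induction k) auto

lemma fv_bh_fm: "fv (bh_fm f k) = (\<Union>i\<le>k. fv (f i))"
  by (induction k) (auto simp: atMost_Suc)

lemma q_dt_foil_bh_fm: "(\<And>i. q_dt_foil (f i)) \<Longrightarrow> q_dt_foil (bh_fm f k)"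
  by (induction k) (auto intro: q_dt_foil.intros(2-4))

text \<open>Unrolls the levels into NP languages only: an intersection with a coNP language becomes
  the removal of its complement, matching the negation in \<open>bh_comb\<close>.\<close>

lemma BH_comb:
  "A \<in> BH (Suc k) \<Longrightarrow> \<exists>As. (\<forall>i\<le>k. As i \<in> NP) \<and> (\<forall>x. x \<in> A \<longleftrightarrow> bh_comb (\<lambda>i. x \<in> As i) k)"
proof (induction k arbitrary: A)
  case 0
  then show ?case by (intro exI[of _ "\<lambda>_. A"]) simp
next
  case (Suc k)
  obtain A' B where A': "A' \<in> BH (Suc k)" and B: "B \<in> NP" and
    A: "\<And>x. x \<in> A \<longleftrightarrow> (if even k then x \<in> A' \<and> x \<notin> B else x \<in> A' \<or> x \<in> B)"
  proof (cases "even k")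
    case True
    then obtain A' B where "A = A' \<inter> B" "A' \<in> BH (Suc k)" "B \<in> coNP" using Suc.prems by auto
    then show ?thesis using True by (intro that[of A' "- B"]) (auto simp: coNP_def)
  next
    case False
    then obtain A' B where "A = A' \<union> B" "A' \<in> BH (Suc k)" "B \<in> NP" using Suc.prems by auto
    then show ?thesis using False by (intro that[of A' B]) auto
  qed
  obtain As where As: "\<forall>i\<le>k. As i \<in> NP" "\<forall>x. x \<in> A' \<longleftrightarrow> bh_comb (\<lambda>i. x \<in> As i) k"
    using Suc.IH[OF A'] by blast
  have "bh_comb (\<lambda>i. x \<in> (As(Suc k := B)) i) k = bh_comb (\<lambda>i. x \<in> As i) k" for x
    by (rule bh_comb_cong) simp
  then show ?case using As A B
    by (intro exI[of _ "As(Suc k := B)"]) (simp add: le_Suc_eq)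
qed

subsection \<open>The reduction\<close>

text \<open>The \<open>i\<close>-th clause set is only active if feature \<open>i\<close> is 1.\<close>

definition tagged :: "nat \<Rightarrow> nat \<Rightarrow> clause list \<Rightarrow> clause list" where
  "tagged k i F = map (\<lambda>c. (i, True) # map (\<lambda>l. (fst l + Suc k, snd l)) c) F"

definition combined :: "nat \<Rightarrow> (nat \<Rightarrow> bool list \<Rightarrow> clause list) \<Rightarrow> bool list \<Rightarrow> clause list" where
  "combined k Fs x = concat (map (\<lambda>i. tagged k i (Fs i x)) [0..<Suc k])"

text \<open>The clause sets share their variables, which is harmless because each is tested under
  its own tag: the witness for \<open>i\<close> switches on tag \<open>i\<close> alone, and the
  other sets hold through their tag literals.\<close>

lemma satisfies_combined:
  assumes "i \<le> k"
  shows "(\<exists>v. v i \<and> satisfies v (combined k Fs x)) \<longleftrightarrow> (\<exists>v. satisfies v (Fs i x))"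
proof
  assume "\<exists>v. v i \<and> satisfies v (combined k Fs x)"
  then obtain v where v: "v i" "satisfies v (combined k Fs x)" by blast
  have "satisfies v (tagged k i (Fs i x))"
    using v(2) assms unfolding combined_def satisfies_concat_map by (auto simp del: upt_Suc)
  then have "satisfies (\<lambda>f. v (f + Suc k)) (Fs i x)"
    using v(1) by (auto simp: satisfies_def tagged_def)
  then show "\<exists>v. satisfies v (Fs i x)" by blast
next
  assume "\<exists>v. satisfies v (Fs i x)"
  then obtain v where v: "satisfies v (Fs i x)" by blast
  define w where "w f = (if f \<le> k then f = i else v (f - Suc k))" for f
  have "satisfies w (tagged k j (Fs j x))" if "j \<le> k" for j
    using that v by (cases "j = i") (auto simp: satisfies_def tagged_def w_def)
  then have "satisfies w (combined k Fs x)"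
    unfolding combined_def satisfies_concat_map by (auto simp: less_Suc_eq_le simp del: upt_Suc)
  then show "\<exists>v. v i \<and> satisfies v (combined k Fs x)" using assms by (intro exI[of _ w]) (simp add: w_def)
qed

lemma distinct_combined:
  assumes "\<And>i c. i \<le> k \<Longrightarrow> c \<in> set (Fs i x) \<Longrightarrow> distinct (map fst c)" "c \<in> set (combined k Fs x)"
  shows "distinct (map fst c)"
proof -
  obtain i c' where i: "i \<le> k" "c' \<in> set (Fs i x)" "c = (i, True) # map (\<lambda>l. (fst l + Suc k, snd l)) c'"
    using assms(2) by (auto simp: combined_def tagged_def less_Suc_eq_le simp del: upt_Suc)
  have "map fst (map (\<lambda>l. (fst l + Suc k, snd l)) c') = map (\<lambda>f. f + Suc k) (map fst c')" by simp
  moreover have "distinct (map (\<lambda>f. f + Suc k) (map fst c'))"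
    using assms(1)[OF i(1,2)] by (subst distinct_map) (auto simp: inj_on_def)
  ultimately have "distinct (map fst (map (\<lambda>l. (fst l + Suc k, snd l)) c'))" by (simp only:)
  moreover have "i \<notin> set (map fst (map (\<lambda>l. (fst l + Suc k, snd l)) c'))" using i(1) by auto
  ultimately show ?thesis unfolding i(3) list.map(2) fst_conv by (simp only: distinct.simps simp_thms)
qed

lemma fp_combined:
  assumes "\<And>i. i \<le> k \<Longrightarrow> fp (Fs i)"
  shows "fp (combined k Fs)"
proof -
  have "fp (\<lambda>x. concat (map (\<lambda>i. tagged k i (Fs i x)) [0..<Suc k]))"
  proof (rule fp_concat_map_const)
    fix i assume "i \<in> set [0..<Suc k]"
    then have "fp (Fs i)" using assms by auto
    then show "fp (\<lambda>x. tagged k i (Fs i x))" unfolding tagged_def by (intro fpi)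
  qed
  then show ?thesis by (simp add: combined_def[abs_def])
qed

text \<open>The sum of all features bounds every single feature.\<close>

definition feature_bound :: "nat \<Rightarrow> clause list \<Rightarrow> nat" where
  "feature_bound k F = Suc k + sum_list (map fst (concat F))"

lemma feature_bound: "c \<in> set F \<Longrightarrow> l \<in> set c \<Longrightarrow> fst l < feature_bound k F"
  using member_le_sum_list[of "fst l" "map fst (concat F)"] by (force simp: feature_bound_def)

definition instances :: "nat \<Rightarrow> clause list \<Rightarrow> pinst list" where
  "instances k F = (let m = feature_bound k F; n = m + length F in
     [replicate m None @ replicate (length F) (Some False), replicate m None @ replicate (length F) (Some True)] @
     map (\<lambda>i. map (\<lambda>j. if j = i then Some True else None) [0..<n]) [0..<Suc k])"

definition reduction :: "nat \<Rightarrow> clause list \<Rightarrow> bool list" where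
  "reduction k F = enc_input (feature_bound k F + length F) (spine (feature_bound k F) F) (instances k F)"

lemma fp_feature_bound [fpi]: "fp F \<Longrightarrow> fp (\<lambda>x. feature_bound k (F x))"
  unfolding feature_bound_def by (intro fpi)

lemma fp_instances [fpi]:
  assumes "fp F"
  shows "fp (\<lambda>x. instances k (F x))"
  unfolding instances_def Let_def
  by (rule fp_append[OF _ fp_map_const]) (intro fpi assms)+

lemma fp_reduction: "fp (reduction k)"
proof -
  have "fp (\<lambda>F. reduction k F)" unfolding reduction_def enc_input_def by (intro fpi)
  then show ?thesis by simp
qed

lemma length_instances [simp]: "length (instances k F) = k + 3"
  by (simp add: instances_def Let_def)

lemma nth_instances:
  "instances k F ! 0 = replicate (feature_bound k F) None @ replicate (length F) (Some False)"
  "instances k F ! 1 = replicate (feature_bound k F) None @ replicate (length F) (Some True)"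
  "i \<le> k \<Longrightarrow> instances k F ! (i + 2) =
    map (\<lambda>j. if j = i then Some True else None) [0..<feature_bound k F + length F]"
  by (simp_all add: instances_def Let_def nth_append del: upt_Suc)

lemma assign_upt: "length es = N \<Longrightarrow> v < N \<Longrightarrow> assign [0..<N] es v = es ! v"
proof -
  assume "length es = N" "v < N"
  then have "map_of (zip [0..<N] es) v = Some (es ! v)"
    using map_of_zip_nth[of "[0..<N]" es v] by simp
  then show ?thesis by (simp add: assign_def)
qed

text \<open>Variables 0 to \<open>k + 2\<close> are the parameters and the quantified ones start at
  \<open>k + 3\<close>; \<open>min i k\<close> keeps the tag variable below these for every
  \<open>i\<close>.\<close>

definition hard_fm :: "nat \<Rightarrow> fm" where
  "hard_fm k = bh_fm (\<lambda>i. sat_fm (k + 3) (min i k)) k"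

lemma free_vars_hard_fm: "free_vars (hard_fm k) = [0..<k + 3]"
proof -
  have "fv (sat_fm (k + 3) (min i k)) = {0, 1, i + 2}" if "i \<le> k" for i
    using that by (simp add: fv_sat_fm min_def)
  then have "fv (hard_fm k) = (\<Union>i\<le>k. {0, 1, i + 2})"
    unfolding hard_fm_def fv_bh_fm by (intro SUP_cong) auto
  also have "\<dots> = {0..<k + 3}"
  proof (intro set_eqI iffI)
    fix v assume "v \<in> {0..<k + 3}"
    then show "v \<in> (\<Union>i\<le>k. {0, 1, i + 2})"
      by (cases "v < 2") (auto intro: bexI[of _ "v - 2"])
  qed auto
  finally show ?thesis by (simp add: free_vars_def del: upt_Suc)
qed

text \<open>One tree serves all levels: the \<open>i\<close>-th subformula has a quantifier of its
  own and asks for a model with feature \<open>i\<close> true, so its truth value is membership in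
  \<open>As i\<close> regardless of the other subformulas.\<close>

lemma hard_for_BH: "hard_for (BH (Suc k)) (Eval (hard_fm k))"
  unfolding hard_for_def poly_reducible_def
proof
  fix A assume "A \<in> BH (Suc k)"
  then obtain As where As: "\<forall>i\<le>k. As i \<in> NP" "\<forall>x. x \<in> A \<longleftrightarrow> bh_comb (\<lambda>i. x \<in> As i) k"
    using BH_comb by blast
  have "\<forall>i. \<exists>F. i \<le> k \<longrightarrow> fp F \<and> (\<forall>x. x \<in> As i \<longleftrightarrow> (\<exists>v. satisfies v (F x))) \<and>
      (\<forall>x. \<forall>c\<in>set (F x). distinct (map fst c))"
    using NP_satisfiability As(1) by blast
  from choice[OF this] obtain Fs where "\<forall>i. i \<le> k \<longrightarrow> fp (Fs i) \<and>
      (\<forall>x. x \<in> As i \<longleftrightarrow> (\<exists>v. satisfies v (Fs i x))) \<and> (\<forall>x. \<forall>c\<in>set (Fs i x). distinct (map fst c))"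
    by (rule exE)
  then have Fs: "\<And>i. i \<le> k \<Longrightarrow> fp (Fs i)"
    "\<And>i x. i \<le> k \<Longrightarrow> x \<in> As i \<longleftrightarrow> (\<exists>v. satisfies v (Fs i x))"
    "\<And>i x c. i \<le> k \<Longrightarrow> c \<in> set (Fs i x) \<Longrightarrow> distinct (map fst c)"
    by simp_all
  define f where "f x = reduction k (combined k Fs x)" for x
  have "x \<in> A \<longleftrightarrow> f x \<in> Eval (hard_fm k)" for x
  proof -
    let ?F = "combined k Fs x" and ?N = "k + 3"
    let ?m = "feature_bound k ?F"
    let ?n = "?m + length ?F" and ?es = "instances k ?F"
    let ?\<sigma> = "assign [0..<?N] ?es"
    have wf: "distinct (map fst c) \<and> (\<forall>l\<in>set c. fst l < ?m)" if "c \<in> set ?F" for c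
    proof
      show "distinct (map fst c)" by (rule distinct_combined[OF _ that]) (rule Fs(3))
      show "\<forall>l\<in>set c. fst l < ?m" using feature_bound[OF that] by blast
    qed
    have lens: "\<forall>e\<in>set ?es. length e = ?n"
      by (auto simp: instances_def Let_def)
    have valid: "valid_input (length [0..<?N]) ?n (spine ?m ?F) ?es"
      using decision_tree_spine[of ?F ?m] wf lens by (simp add: valid_input_def)
    have "sat ?n (spine ?m ?F) ?\<sigma> (sat_fm ?N (min i k)) \<longleftrightarrow> x \<in> As i" if i: "i \<le> k" for i
    proof -
      have "sat ?n (spine ?m ?F) ?\<sigma> (sat_fm ?N i) \<longleftrightarrow> (\<exists>v. v i \<and> satisfies v ?F)"
        using i wf nth_instances[where k = k and F = ?F]
        by (intro sat_fm_iff) (simp_all add: assign_upt feature_bound_def del: upt_Suc)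
      then show ?thesis using i satisfies_combined[OF i] Fs(2)[OF i] by (simp add: min_def)
    qed
    then have "sat ?n (spine ?m ?F) ?\<sigma> (hard_fm k) = bh_comb (\<lambda>i. x \<in> As i) k"
      unfolding hard_fm_def sat_bh_fm by (rule bh_comb_cong)
    then have "x \<in> A \<longleftrightarrow> sat ?n (spine ?m ?F) ?\<sigma> (hard_fm k)" using As(2) by blast
    also have "\<dots> \<longleftrightarrow> f x \<in> Eval (hard_fm k)"
      unfolding Eval_sub_lang free_vars_hard_fm f_def reduction_def
      using enc_input_in_sub_lang[OF valid] by blast
    finally show ?thesis .
  qed
  moreover have "polytime f"
    unfolding f_def using fp_comp[OF fp_reduction fp_combined[OF Fs(1)]] by (intro fp_polytime) simp
  ultimately show "\<exists>f. polytime f \<and> (\<forall>x. x \<in> A \<longleftrightarrow> f x \<in> Eval (hard_fm k))" by blast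
qed

lemma q_dt_foil_hard_fm: "q_dt_foil (hard_fm k)"
  unfolding hard_fm_def by (intro q_dt_foil_bh_fm q_dt_foil_sat_fm)

theorem theorem6:
  shows "(\<forall>\<phi>. q_dt_foil \<phi> \<longrightarrow> (\<exists>k\<ge>1. Eval \<phi> \<in> BH k)) \<and>
         (\<forall>k\<ge>1. \<exists>\<phi>. q_dt_foil \<phi> \<and> hard_for (BH k) (Eval \<phi>))"
proof (intro conjI allI impI)
  fix \<phi> assume "q_dt_foil \<phi>"
  then show "\<exists>k\<ge>1. Eval \<phi> \<in> BH k" by (rule Eval_in_BH)
next
  fix k :: nat assume "k \<ge> 1"
  \<comment> \<open>Level \<open>Suc j\<close> combines NP languages with the indices 0 to
    \<open>j\<close>, so the formulas are numbered from 0.\<close>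
  then obtain j where "k = Suc j" by (cases k) auto
  then show "\<exists>\<phi>. q_dt_foil \<phi> \<and> hard_for (BH k) (Eval \<phi>)"
    using q_dt_foil_hard_fm hard_for_BH by blast
qed

end
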